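(* Let $0<\ell\le1$. There exist $\widetilde p\in L^2_0(\omega)\cap H^1(\omega)$, independent of $z$, and $\widehat p_1\in L^2(\omega;L^2_\#(Z))$ such that, up to a subsequence, as $\varepsilon\to0$, $$\varepsilon^2p^0_\varepsilon\rightharpoonup\widetilde p\ \text{ in }H^1(\omega),\qquad\varepsilon^2p^0_\varepsilon\to\widetilde p\ \text{ in }L^2(\omega),\qquad\varepsilon^2\widehat p^0_\varepsilon\to\widetilde p\ \text{ in }L^2(\omega\times Z'),$$ $$\varepsilon\,\widehat p^1_\varepsilon\rightharpoonup\widehat p_1\ \text{ in }L^2(\omega;L^2(Z)).$$
   Context: **Geometry.** $\omega\subset\mathbb R^2$ is a bounded connected open set with Lipschitz boundary, $Z'=(-1/2,1/2)^2$, $h:\mathbb R^2\to\mathbb R$ is a $Z'$-periodic $W^{1,\infty}$ function with $0<\min h\le h\le\max h$. For small $\varepsilon>0$, $\Omega^\varepsilon=\{(x',x_3): x'\in\omega,\ 0<x_3<\varepsilon h(x'/\varepsilon^\ell)\}$, $\widetilde\Omega^\varepsilon=\{(x',z_3): x'\in\omega,\ 0<z_3<h(x'/\varepsilon^\ell)\}$, $Z=\{(z',z_3): z'\in Z',\ 0<z_3<h(z')\}$. For $k'\in\mathbb Z^2$ put $Z'_{k',\varepsilon^\ell}=\varepsilon^\ell k'+\varepsilon^\ell Z'$; $\omega$ is divided by the mesh formed by the (finitely many) cells $Z'_{k',\varepsilon^\ell}$ meeting $\omega$. **Problem.** $\mu,\mu_{\rm eff},K$ are positive constants, ${\bf f}'\in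 L^2(\omega)^2$, $\mathbb D[{\bf v}]=\frac12(D{\bf v}+(D{\bf v})^T)$, $L^2_0$ denotes mean-zero $L^2$ functions. For each $\varepsilon$, $({\bf u}_\varepsilon,p_\varepsilon)\in H^1_0(\Omega^\varepsilon)^3\times L^2_0(\Omega^\varepsilon)$ satisfies $$2\mu_{\rm eff}\int_{\Omega^\varepsilon}\mathbb D[{\bf u}_\varepsilon]:\mathbb D[{\bf v}]\,dx+\frac{\mu}{K}\varepsilon^{-2}\int_{\Omega^\varepsilon}{\bf u}_\varepsilon\cdot{\bf v}\,dx-\int_{\Omega^\varepsilon}p_\varepsilon\,{\rm div}\,{\bf v}\,dx=\varepsilon^{-2}\int_{\Omega^\varepsilon}{\bf f}'\cdot{\bf v}'\,dx,\qquad \int_{\Omega^\varepsilon}{\bf u}_\varepsilon\cdot\nabla\psi\,dx=0$$ for all ${\bf v}\in H^1_0(\Omega^\varepsilon)^3$, $\psi\in H^1_0(\Omega^\varepsilon)$. **Pressure decomposition (known from earlier work).** $p_\varepsilon=p^0_\varepsilon+p^1_\varepsilon$ with $p^0_\varepsilon=p^0_\varepsilon(x')\in H^1(\omega)$, $p^1_\varepsilon\in L^2(\Omega^\varepsilon)$, and, with $C$ independent of $\varepsilon$, $\|p^0_\varepsilon\|_{H^1(\omega)}\le C\varepsilon^{-2}$, $\|\widetilde p^1_\varepsilon\|_{L^2(\widetilde\Omega^\varepsilon)}\le C\varepsilon^{-1}$, where $\widetilde p^1_\varepsilon(x',z_3)=p^1_\varepsilon(x',\varepsilon z_3)$. This decomposition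 is fixed. **Unfolding.** $\kappa(x')=k'$ iff $x'\in k'+Z'$ ($k'\in\mathbb Z^2$, a.e. $x'$). With functions extended by zero outside $\omega$ in $x'$, $$\widehat p^0_\varepsilon(x',z')=p^0_\varepsilon(\varepsilon^\ell\kappa(x'/\varepsilon^\ell)+\varepsilon^\ell z')\ \text{ on }\omega\times Z',\qquad\widehat p^1_\varepsilon(x',z)=\widetilde p^1_\varepsilon(\varepsilon^\ell\kappa(x'/\varepsilon^\ell)+\varepsilon^\ell z',z_3)\ \text{ on }\omega\times Z.$$ $L^2_\#(Z)$ denotes $L^2$ functions on $Z$ that are $Z'$-periodic in $z'$; $\rightharpoonup$ is weak convergence. *)

theory Defs
  imports "HOL-Analysis.Analysis"
begin

text \<open>Points of three-dimensional space are written as pairs \<open>(x', x\<^sub>3)\<close> of type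
  \<open>(real^2) \<times> real\<close>; the product of Euclidean spaces carries the Euclidean norm, and \<open>Basis\<close>
  consists of the three coordinate vectors.\<close>

type_synonym R3 = "(real^2) \<times> real"

section \<open>Lebesgue and Sobolev spaces\<close>

text \<open>Elements of function spaces are represented by honest functions on the ambient space; only
  their values on \<open>S\<close> matter. The seminorms below are meaningful only on the
  corresponding spaces (the Bochner integral of a non-integrable function is \<open>0\<close>), so membership is
  always required separately.\<close>

definition L2 :: "'a::euclidean_space set \<Rightarrow> ('a \<Rightarrow> 'b::euclidean_space) set" where
  "L2 S = {u \<in> borel_measurable (lebesgue_on S). integrable (lebesgue_on S) (\<lambda>x. (norm (u x))\<^sup>2)}"

definition L2norm :: "'a::euclidean_space set \<Rightarrow> ('a \<Rightarrow> 'b::euclidean_space) \<Rightarrow> real" where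
  "L2norm S u = sqrt (\<integral>x. (norm (u x))\<^sup>2 \<partial>lebesgue_on S)"

definition L2_0 :: "'a::euclidean_space set \<Rightarrow> ('a \<Rightarrow> real) set" where
  "L2_0 S = {u \<in> L2 S. (\<integral>x. u x \<partial>lebesgue_on S) = 0}"

definition Linf :: "'a::euclidean_space set \<Rightarrow> ('a \<Rightarrow> real) set" where
  "Linf S = {u \<in> borel_measurable (lebesgue_on S). \<exists>M. AE x in lebesgue_on S. \<bar>u x\<bar> \<le> M}"

definition L1_loc :: "'a::euclidean_space set \<Rightarrow> ('a \<Rightarrow> real) set" where
  "L1_loc S = {u. \<forall>K. compact K \<and> K \<subseteq> S \<longrightarrow> integrable (lebesgue_on K) u}"

abbreviation partial :: "'a::euclidean_space \<Rightarrow> ('a \<Rightarrow> real) \<Rightarrow> 'a \<Rightarrow> real" where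
  "partial b f x \<equiv> frechet_derivative f (at x) b"

primrec C_k :: "nat \<Rightarrow> ('a::euclidean_space \<Rightarrow> real) \<Rightarrow> bool" where
  "C_k 0 f \<longleftrightarrow> continuous_on UNIV f"
| "C_k (Suc k) f \<longleftrightarrow> (\<forall>x. f differentiable at x) \<and> (\<forall>b\<in>Basis. C_k k (partial b f))"

definition test_functions :: "'a::euclidean_space set \<Rightarrow> ('a \<Rightarrow> real) set" where
  "test_functions S = {\<phi>. (\<forall>k. C_k k \<phi>) \<and>
     compact (closure {x. \<phi> x \<noteq> 0}) \<and> closure {x. \<phi> x \<noteq> 0} \<subseteq> S}"

definition weak_partial ::
    "'a::euclidean_space set \<Rightarrow> 'a \<Rightarrow> ('a \<Rightarrow> real) \<Rightarrow> ('a \<Rightarrow> real) \<Rightarrow> bool" where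
  "weak_partial S b u g \<longleftrightarrow> u \<in> L1_loc S \<and> g \<in> L1_loc S \<and>
     (\<forall>\<phi>\<in>test_functions S.
        (\<integral>x. u x * partial b \<phi> x \<partial>lebesgue_on S) = - (\<integral>x. g x * \<phi> x \<partial>lebesgue_on S))"

text \<open>A representative of the weak partial derivative of an \<open>H\<^sup>1\<close> function; it is unique up to a
  null set, so that the choice does not affect any integral.\<close>

definition wpartial :: "'a::euclidean_space set \<Rightarrow> 'a \<Rightarrow> ('a \<Rightarrow> real) \<Rightarrow> 'a \<Rightarrow> real" where
  "wpartial S b u = (SOME g. g \<in> L2 S \<and> weak_partial S b u g)"

definition H1 :: "'a::euclidean_space set \<Rightarrow> ('a \<Rightarrow> real) set" where
  "H1 S = {u \<in> L2 S. \<forall>b\<in>Basis. \<exists>g\<in>L2 S. weak_partial S b u g}"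

definition H1norm :: "'a::euclidean_space set \<Rightarrow> ('a \<Rightarrow> real) \<Rightarrow> real" where
  "H1norm S u = sqrt ((L2norm S u)\<^sup>2 + (\<Sum>b\<in>Basis. (L2norm S (wpartial S b u))\<^sup>2))"

definition H1_0 :: "'a::euclidean_space set \<Rightarrow> ('a \<Rightarrow> real) set" where
  "H1_0 S = {u \<in> H1 S. \<exists>\<phi>. (\<forall>n::nat. \<phi> n \<in> test_functions S) \<and>
                           (\<lambda>n. H1norm S (\<lambda>x. u x - \<phi> n x)) \<longlonglongrightarrow> 0}"

definition H1_0_vec :: "'a::euclidean_space set \<Rightarrow> ('a \<Rightarrow> 'a) set" where
  "H1_0_vec S = {v. \<forall>b\<in>Basis. (\<lambda>x. v x \<bullet> b) \<in> H1_0 S}"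

definition W1inf :: "'a::euclidean_space set \<Rightarrow> ('a \<Rightarrow> real) set" where
  "W1inf S = {u \<in> Linf S. \<forall>b\<in>Basis. \<exists>g\<in>Linf S. weak_partial S b u g}"

text \<open>The space \<open>L\<^sup>2(A; X)\<close> for a subspace \<open>X\<close> of \<open>L\<^sup>2(B)\<close>, an element being represented by a jointly
  measurable function of \<open>(x, z)\<close>.\<close>

definition L2_vec :: "'a::euclidean_space set \<Rightarrow> 'b::euclidean_space set \<Rightarrow> ('b \<Rightarrow> real) set
    \<Rightarrow> ('a \<times> 'b \<Rightarrow> real) set" where
  "L2_vec A B X = {q \<in> borel_measurable (lebesgue_on (A \<times> B)).
     (AE x in lebesgue_on A. (\<lambda>z. q (x, z)) \<in> X) \<and> (\<lambda>x. L2norm B (\<lambda>z. q (x, z))) \<in> L2 A}"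

definition L2_vec_norm :: "'a::euclidean_space set \<Rightarrow> 'b::euclidean_space set
    \<Rightarrow> ('a \<times> 'b \<Rightarrow> real) \<Rightarrow> real" where
  "L2_vec_norm A B q = L2norm A (\<lambda>x. L2norm B (\<lambda>z. q (x, z)))"

section \<open>Convergence in a function space \<open>V\<close> with (semi)norm \<open>N\<close>\<close>

definition strongly_tendsto :: "('x \<Rightarrow> real) set \<Rightarrow> (('x \<Rightarrow> real) \<Rightarrow> real)
    \<Rightarrow> (nat \<Rightarrow> 'x \<Rightarrow> real) \<Rightarrow> ('x \<Rightarrow> real) \<Rightarrow> bool" where
  "strongly_tendsto V N u v \<longleftrightarrow> (\<forall>n. u n \<in> V) \<and> v \<in> V \<and> (\<lambda>n. N (\<lambda>x. u n x - v x)) \<longlonglongrightarrow> 0"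

definition bounded_functional :: "('x \<Rightarrow> real) set \<Rightarrow> (('x \<Rightarrow> real) \<Rightarrow> real)
    \<Rightarrow> (('x \<Rightarrow> real) \<Rightarrow> real) \<Rightarrow> bool" where
  "bounded_functional V N F \<longleftrightarrow>
     (\<forall>u\<in>V. \<forall>v\<in>V. \<forall>a b. F (\<lambda>x. a * u x + b * v x) = a * F u + b * F v) \<and>
     (\<exists>C. \<forall>u\<in>V. \<bar>F u\<bar> \<le> C * N u)"

definition weakly_tendsto :: "('x \<Rightarrow> real) set \<Rightarrow> (('x \<Rightarrow> real) \<Rightarrow> real)
    \<Rightarrow> (nat \<Rightarrow> 'x \<Rightarrow> real) \<Rightarrow> ('x \<Rightarrow> real) \<Rightarrow> bool" where
  "weakly_tendsto V N u v \<longleftrightarrow> (\<forall>n. u n \<in> V) \<and> v \<in> V \<and>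
     (\<forall>F. bounded_functional V N F \<longrightarrow> (\<lambda>n. F (u n)) \<longlonglongrightarrow> F v)"

section \<open>Geometry\<close>

text \<open>Near each boundary point \<open>S\<close> is, in a suitable orthonormal frame with last axis \<open>\<nu>\<close>, the strict
  epigraph of a Lipschitz function \<open>\<gamma>\<close> on the hyperplane orthogonal to \<open>\<nu>\<close>.\<close>

definition lipschitz_boundary :: "'a::euclidean_space set \<Rightarrow> bool" where
  "lipschitz_boundary S \<longleftrightarrow> (\<forall>x0\<in>frontier S. \<exists>r>0. \<exists>\<nu> L \<gamma>. norm \<nu> = 1 \<and>
     L-lipschitz_on {y. y \<bullet> \<nu> = 0} \<gamma> \<and>
     (\<forall>x\<in>ball x0 r. x \<in> S \<longleftrightarrow> \<gamma> (x - (x \<bullet> \<nu>) *\<^sub>R \<nu>) < x \<bullet> \<nu>))"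

definition lattice_vec :: "int^2 \<Rightarrow> real^2" where
  "lattice_vec k = (\<chi> i. of_int (k $ i))"

definition Z'_periodic :: "(real^2 \<Rightarrow> real) \<Rightarrow> bool" where
  "Z'_periodic h \<longleftrightarrow> (\<forall>k z. h (z + lattice_vec k) = h z)"

definition Zcell' :: "(real^2) set" where
  "Zcell' = {z. \<forall>i. -1/2 < z $ i \<and> z $ i < 1/2}"

definition Zcell :: "(real^2 \<Rightarrow> real) \<Rightarrow> R3 set" where
  "Zcell h = {(z', z3). z' \<in> Zcell' \<and> 0 < z3 \<and> z3 < h z'}"

definition thin_domain :: "(real^2) set \<Rightarrow> (real^2 \<Rightarrow> real) \<Rightarrow> real \<Rightarrow> real \<Rightarrow> R3 set" where
  "thin_domain \<omega> h ell \<epsilon> = {(x', x3). x' \<in> \<omega> \<and> 0 < x3 \<and> x3 < \<epsilon> * h ((1 / \<epsilon> powr ell) *\<^sub>R x')}"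

definition rescaled_domain :: "(real^2) set \<Rightarrow> (real^2 \<Rightarrow> real) \<Rightarrow> real \<Rightarrow> real \<Rightarrow> R3 set" where
  "rescaled_domain \<omega> h ell \<epsilon> = {(x', z3). x' \<in> \<omega> \<and> 0 < z3 \<and> z3 < h ((1 / \<epsilon> powr ell) *\<^sub>R x')}"

text \<open>\<open>L\<^sup>2\<^sub>#(Z)\<close>: the lateral translates of \<open>Z\<close> tile (up to a null set) the layer
  \<open>0 < z\<^sub>3 < h z'\<close>, and a periodic element is represented by a function that is periodic on all of
  \<open>(real^2) \<times> real\<close>.\<close>

definition L2_per :: "(real^2 \<Rightarrow> real) \<Rightarrow> (R3 \<Rightarrow> real) set" where
  "L2_per h = {g \<in> L2 (Zcell h). \<forall>k z' z3. g (z' + lattice_vec k, z3) = g (z', z3)}"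

section \<open>The boundary value problem\<close>

definition sym_grad :: "'a::euclidean_space set \<Rightarrow> ('a \<Rightarrow> 'a) \<Rightarrow> 'a \<Rightarrow> 'a \<Rightarrow> 'a \<Rightarrow> real" where
  "sym_grad S v i j x = (wpartial S j (\<lambda>y. v y \<bullet> i) x + wpartial S i (\<lambda>y. v y \<bullet> j) x) / 2"

definition weak_div :: "'a::euclidean_space set \<Rightarrow> ('a \<Rightarrow> 'a) \<Rightarrow> 'a \<Rightarrow> real" where
  "weak_div S v x = (\<Sum>b\<in>Basis. wpartial S b (\<lambda>y. v y \<bullet> b) x)"

definition weak_grad :: "'a::euclidean_space set \<Rightarrow> ('a \<Rightarrow> real) \<Rightarrow> 'a \<Rightarrow> 'a" where
  "weak_grad S u x = (\<Sum>b\<in>Basis. wpartial S b u x *\<^sub>R b)"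

definition weak_solution :: "real \<Rightarrow> real \<Rightarrow> real \<Rightarrow> (real^2 \<Rightarrow> real^2) \<Rightarrow> R3 set \<Rightarrow> real
    \<Rightarrow> (R3 \<Rightarrow> R3) \<Rightarrow> (R3 \<Rightarrow> real) \<Rightarrow> bool" where
  "weak_solution \<mu> \<mu>eff K f' \<Omega> \<epsilon> u p \<longleftrightarrow>
     u \<in> H1_0_vec \<Omega> \<and> p \<in> L2_0 \<Omega> \<and>
     (\<forall>v\<in>H1_0_vec \<Omega>.
        2 * \<mu>eff * (\<integral>x. (\<Sum>i\<in>Basis. \<Sum>j\<in>Basis. sym_grad \<Omega> u i j x * sym_grad \<Omega> v i j x) \<partial>lebesgue_on \<Omega>)
        + \<mu> / K * (1 / \<epsilon>\<^sup>2) * (\<integral>x. u x \<bullet> v x \<partial>lebesgue_on \<Omega>)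
        - (\<integral>x. p x * weak_div \<Omega> v x \<partial>lebesgue_on \<Omega>)
        = 1 / \<epsilon>\<^sup>2 * (\<integral>x. f' (fst x) \<bullet> fst (v x) \<partial>lebesgue_on \<Omega>)) \<and>
     (\<forall>\<psi>\<in>H1_0 \<Omega>. (\<integral>x. u x \<bullet> weak_grad \<Omega> \<psi> x \<partial>lebesgue_on \<Omega>) = 0)"

section \<open>Rescaling and unfolding\<close>

definition rescale :: "real \<Rightarrow> (R3 \<Rightarrow> real) \<Rightarrow> R3 \<Rightarrow> real" where
  "rescale \<epsilon> p = (\<lambda>(x', z3). p (x', \<epsilon> * z3))"

text \<open>The cell index; unspecified on the null set of points lying on no open cell.\<close>

definition cell_index :: "real^2 \<Rightarrow> int^2" where
  "cell_index x = (THE k. x \<in> (+) (lattice_vec k) ` Zcell')"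

definition unfold_point :: "real \<Rightarrow> real \<Rightarrow> real^2 \<Rightarrow> real^2 \<Rightarrow> real^2" where
  "unfold_point ell \<epsilon> x' z' =
     (\<epsilon> powr ell) *\<^sub>R lattice_vec (cell_index ((1 / \<epsilon> powr ell) *\<^sub>R x')) + (\<epsilon> powr ell) *\<^sub>R z'"

definition unfold0 :: "(real^2) set \<Rightarrow> real \<Rightarrow> real \<Rightarrow> (real^2 \<Rightarrow> real)
    \<Rightarrow> (real^2) \<times> (real^2) \<Rightarrow> real" where
  "unfold0 \<omega> ell \<epsilon> p = (\<lambda>(x', z'). let y = unfold_point ell \<epsilon> x' z' in if y \<in> \<omega> then p y else 0)"

definition unfold1 :: "(real^2) set \<Rightarrow> real \<Rightarrow> real \<Rightarrow> (R3 \<Rightarrow> real) \<Rightarrow> (real^2) \<times> R3 \<Rightarrow> real" where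
  "unfold1 \<omega> ell \<epsilon> p =
     (\<lambda>(x', (z', z3)). let y = unfold_point ell \<epsilon> x' z' in if y \<in> \<omega> then p (y, z3) else 0)"

end

theory Submission
  imports Defs "HOL-Complex_Analysis.Great_Picard"
begin

text \<open>
  The bound \<open>C / \<epsilon>\<^sup>2\<close> on \<open>p\<^sup>0\<close> makes \<open>\<epsilon>\<^sup>2 p\<^sup>0\<close> bounded in \<open>H\<^sup>1(\<omega>)\<close>, and the bound \<open>C / \<epsilon>\<close> on the rescaled
  \<open>p\<^sup>1\<close> makes \<open>\<epsilon>\<close> times its unfolding bounded in \<open>L\<^sup>2(\<omega> \<times> Z)\<close>, because the unfolding map carries
  Lebesgue measure to Lebesgue measure (\<open>nn_integral_unfold\<close>). Both sequences therefore have weakly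
  convergent subsequences. The spaces are treated uniformly as sets of functions with a complete
  semidefinite inner product: the Riesz representation \<open>riesz\<close> gives the weak limits, and it
  identifies the bounded functionals against which convergence is tested (\<open>weakly_compact\<close>).

  Strong convergence of \<open>\<epsilon>\<^sup>2 p\<^sup>0\<close> in \<open>L\<^sup>2(\<omega>)\<close> is the Rellich theorem (\<open>rellich\<close>). Its only analytic
  input is the estimate \<open>translation_estimate\<close>: a translation by \<open>t\<close> changes an \<open>H\<^sup>1\<close> function, in
  \<open>L\<^sup>2\<close> of a set whose points \<open>x\<close> have the whole segment from \<open>x\<close> to \<open>x + t\<close> inside the domain, by at
  most \<open>|t|\<close> times its \<open>H\<^sup>1\<close> norm. Hence a function is close to its means over small balls, uniformly
  along the sequence, and for a weakly null sequence these means tend to \<open>0\<close>; this settles compact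
  subsets. Near the boundary, a Lipschitz domain can be pushed along the axis of its graph into a
  compact subset of itself, and the same estimate controls the error.

  The unfolded functions converge strongly because the unfolding is isometric and moves points by at
  most twice the cell size, so that a comparison with a continuous function suffices
  (\<open>unfold_strong_convergence\<close>). The weak limit of the unfolded \<open>p\<^sup>1\<close> lives on a single cell in the
  variable \<open>z'\<close> and is extended periodically.

  The limit \<open>l\<close> of \<open>\<epsilon>\<^sup>2 p\<^sup>0\<close> has mean zero because the pressure has. The integral of \<open>p\<^sup>0\<close> over the thin
  domain is \<open>\<epsilon>\<close> times the integral of \<open>p\<^sup>0\<close> against the oscillating height, which unfolds to an
  integral against the height over one cell; up to the factors, it converges to the product of the
  integral of \<open>l\<close> and the positive mean height, while the contribution of \<open>p\<^sup>1\<close> is of lower order.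
\<close>

section \<open>Hilbert spaces of functions\<close>

lemma quadratic_nonneg_imp_discriminant:
  fixes a b c :: real
  assumes "0 \<le> a" "\<And>t. 0 \<le> a * t\<^sup>2 + 2 * b * t + c"
  shows "b\<^sup>2 \<le> a * c"
proof (cases "a = 0")
  case True
  have "b = 0"
  proof (rule ccontr)
    assume "b \<noteq> 0"
    then show False using assms(2)[of "- (c + 1) / (2 * b)"] True by simp
  qed
  with True show ?thesis by simp
next
  case False
  with assms(1) have "0 < a" by simp
  moreover have "a * (- b / a)\<^sup>2 + 2 * b * (- b / a) + c = c - b\<^sup>2 / a"
    using False by (simp add: field_simps power2_eq_square)
  ultimately have "b\<^sup>2 / a \<le> c" using assms(2)[of "- b / a"] by linarith
  with \<open>0 < a\<close> show ?thesis by (simp add: pos_divide_le_eq mult.commute)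
qed

text \<open>Function spaces are sets of representatives: functions that agree almost everywhere stay
  distinct, so the inner product is only semidefinite and limits are unique only up to null elements.
  The carrier is an explicit set since it varies with the domain.\<close>

locale semi_hilbert =
  fixes V :: "('x \<Rightarrow> real) set" and ip :: "('x \<Rightarrow> real) \<Rightarrow> ('x \<Rightarrow> real) \<Rightarrow> real"
  assumes nonempty: "V \<noteq> {}"
    and lin: "u \<in> V \<Longrightarrow> v \<in> V \<Longrightarrow> (\<lambda>x. a * u x + b * v x) \<in> V"
    and ip_lin: "u \<in> V \<Longrightarrow> v \<in> V \<Longrightarrow> w \<in> V \<Longrightarrow>
      ip (\<lambda>x. a * u x + b * v x) w = a * ip u w + b * ip v w"
    and ip_sym: "u \<in> V \<Longrightarrow> v \<in> V \<Longrightarrow> ip u v = ip v u"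
    and ip_ge0: "u \<in> V \<Longrightarrow> 0 \<le> ip u u"
    and complete: "(\<And>n. s n \<in> V) \<Longrightarrow>
      (\<And>\<epsilon>. 0 < \<epsilon> \<Longrightarrow> \<exists>N. \<forall>m\<ge>N. \<forall>n\<ge>N. ip (\<lambda>x. s m x - s n x) (\<lambda>x. s m x - s n x) < \<epsilon>) \<Longrightarrow>
      \<exists>l\<in>V. (\<lambda>n. ip (\<lambda>x. s n x - l x) (\<lambda>x. s n x - l x)) \<longlonglongrightarrow> 0"
begin

abbreviation nrm :: "('x \<Rightarrow> real) \<Rightarrow> real" where "nrm u \<equiv> sqrt (ip u u)"

abbreviation dist_sq :: "('x \<Rightarrow> real) \<Rightarrow> ('x \<Rightarrow> real) \<Rightarrow> real" where
  "dist_sq u v \<equiv> ip (\<lambda>x. u x - v x) (\<lambda>x. u x - v x)"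

lemma diff_in: "u \<in> V \<Longrightarrow> v \<in> V \<Longrightarrow> (\<lambda>x. u x - v x) \<in> V"
  using lin[of u v 1 "-1"] by simp

lemma ip_diff_left:
  "u \<in> V \<Longrightarrow> v \<in> V \<Longrightarrow> w \<in> V \<Longrightarrow> ip (\<lambda>x. u x - v x) w = ip u w - ip v w"
  using ip_lin[of u v w 1 "-1"] by simp

lemma ip_lin_right:
  assumes "u \<in> V" "v \<in> V" "w \<in> V"
  shows "ip w (\<lambda>x. a * u x + b * v x) = a * ip w u + b * ip w v"
  using assms by (simp add: ip_sym[of w] ip_lin lin)

lemma ip_comb_self:
  assumes "u \<in> V" "v \<in> V"
  shows "ip (\<lambda>x. a * u x + b * v x) (\<lambda>x. a * u x + b * v x)
    = a\<^sup>2 * ip u u + 2 * a * b * ip u v + b\<^sup>2 * ip v v"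
  using assms by (simp add: ip_lin ip_lin_right lin ip_sym[of v u] power2_eq_square algebra_simps)

lemma ip_diff_self:
  assumes "u \<in> V" "v \<in> V"
  shows "dist_sq u v = ip u u - 2 * ip u v + ip v v"
  using ip_comb_self[OF assms, of 1 "-1"] by simp

lemma Cauchy_Schwarz_sq:
  assumes "u \<in> V" "v \<in> V"
  shows "(ip u v)\<^sup>2 \<le> ip u u * ip v v"
proof (rule quadratic_nonneg_imp_discriminant)
  fix t
  show "0 \<le> ip u u * t\<^sup>2 + 2 * ip u v * t + ip v v"
    using ip_ge0[OF lin[OF assms, of t 1]] ip_comb_self[OF assms, of t 1] by (simp add: algebra_simps)
qed (rule ip_ge0[OF assms(1)])

lemma Cauchy_Schwarz:
  assumes "u \<in> V" "v \<in> V"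
  shows "\<bar>ip u v\<bar> \<le> nrm u * nrm v"
  using real_sqrt_le_mono[OF Cauchy_Schwarz_sq[OF assms]] by (simp add: real_sqrt_mult)

lemma tendsto_ip_left:
  assumes s: "\<And>n. s n \<in> V" and l: "l \<in> V" and w: "w \<in> V"
    and lim: "(\<lambda>n. dist_sq (s n) l) \<longlonglongrightarrow> 0"
  shows "(\<lambda>n. ip (s n) w) \<longlonglongrightarrow> ip l w"
proof -
  define d where "d n = sqrt (dist_sq (s n) l)" for n
  have "d \<longlonglongrightarrow> 0"
    using tendsto_real_sqrt[OF lim] by (simp add: d_def[abs_def])
  then have dlim: "(\<lambda>n. d n * nrm w) \<longlonglongrightarrow> 0"
    by (rule tendsto_mult_left_zero)
  have "norm (ip (s n) w - ip l w) \<le> d n * nrm w" for n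
    using Cauchy_Schwarz[OF diff_in[OF s l] w, of n] ip_diff_left[OF s l w, of n]
    by (simp add: d_def)
  then have "\<forall>\<^sub>F n in sequentially. norm (ip (s n) w - ip l w) \<le> d n * nrm w" by simp
  from Lim_null_comparison[OF this dlim] show ?thesis by (simp add: LIM_zero_iff)
qed

text \<open>The representing element minimises \<open>ip v v - 2 * F v\<close>: a minimising sequence is Cauchy by the
  parallelogram identity, and varying its limit \<open>g\<close> in the direction \<open>v\<close> yields \<open>F v = ip v g\<close>.\<close>

theorem riesz:
  assumes F: "bounded_functional V nrm F"
  obtains g where "g \<in> V" "\<And>v. v \<in> V \<Longrightarrow> F v = ip v g"
proof -
  obtain C where C: "\<And>u. u \<in> V \<Longrightarrow> \<bar>F u\<bar> \<le> C * nrm u"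
    using F unfolding bounded_functional_def by blast
  have Flin: "F (\<lambda>x. a * u x + b * v x) = a * F u + b * F v" if "u \<in> V" "v \<in> V" for u v a b
    using F that unfolding bounded_functional_def by blast
  define J where "J v = ip v v - 2 * F v" for v
  have J_ge: "- C\<^sup>2 \<le> J v" if "v \<in> V" for v
  proof -
    have "0 \<le> (nrm v - C)\<^sup>2" by simp
    then show ?thesis using C[OF that] ip_ge0[OF that]
      by (simp add: J_def power2_diff abs_le_iff mult.commute)
  qed
  define m where "m = Inf (J ` V)"
  have bdd: "bdd_below (J ` V)" using J_ge by (auto simp: bdd_below_def)
  have m_le: "m \<le> J v" if "v \<in> V" for v
    unfolding m_def using that bdd by (simp add: cInf_lower)
  have "\<exists>w\<in>V. J w < m + 1 / Suc n" for n
  proof -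
    have "Inf (J ` V) < m + 1 / Suc n" by (simp add: m_def)
    then show ?thesis using nonempty by (subst (asm) cInf_less_iff[OF _ bdd]) auto
  qed
  then obtain w where wV: "\<And>n. w n \<in> V" and w: "\<And>n. J (w n) < m + 1 / Suc n" by metis
  \<comment> \<open>The parallelogram identity turns near-minimality of two functions into their closeness.\<close>
  have near: "dist_sq (w i) (w j) \<le> 2 * (1 / Suc i) + 2 * (1 / Suc j)" for i j
  proof -
    have mid: "(\<lambda>x. 1/2 * w i x + 1/2 * w j x) \<in> V" using lin wV by blast
    have "m \<le> (ip (w i) (w i) + 2 * ip (w i) (w j) + ip (w j) (w j)) / 4 - F (w i) - F (w j)"
      using m_le[OF mid] ip_comb_self[OF wV[of i] wV[of j], of "1/2" "1/2"]
        Flin[OF wV[of i] wV[of j], of "1/2" "1/2"]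
      by (simp add: J_def power2_eq_square field_simps)
    moreover have "J (w i) = ip (w i) (w i) - 2 * F (w i)" "J (w j) = ip (w j) (w j) - 2 * F (w j)"
      by (simp_all add: J_def)
    ultimately have "dist_sq (w i) (w j) \<le> 2 * (J (w i) - m) + 2 * (J (w j) - m)"
      using ip_diff_self[OF wV[of i] wV[of j]] by argo
    also have "\<dots> \<le> 2 * (1 / Suc i) + 2 * (1 / Suc j)"
      using w[of i] w[of j] by (intro add_mono mult_left_mono) auto
    finally show ?thesis .
  qed
  obtain g where g: "g \<in> V" and glim: "(\<lambda>n. dist_sq (w n) g) \<longlonglongrightarrow> 0"
  proof -
    have "\<exists>N. \<forall>m\<ge>N. \<forall>n\<ge>N. dist_sq (w m) (w n) < \<epsilon>" if "0 < \<epsilon>" for \<epsilon>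
    proof -
      obtain N where N: "inverse (real (Suc N)) < \<epsilon> / 4" using reals_Archimedean[of "\<epsilon>/4"] \<open>0 < \<epsilon>\<close> by auto
      have "dist_sq (w i) (w j) < \<epsilon>" if "N \<le> i" "N \<le> j" for i j
      proof -
        have "1 / real (Suc i) \<le> 1 / Suc N" "1 / real (Suc j) \<le> 1 / Suc N"
          using that by (auto intro!: divide_left_mono)
        then show ?thesis using near[of i j] N unfolding inverse_eq_divide by linarith
      qed
      then show ?thesis by blast
    qed
    with complete[of w, OF wV] that show thesis by blast
  qed
  have key: "F v = ip v g" if v: "v \<in> V" for v
  proof -
    have "0 \<le> ip v v * t\<^sup>2 + 2 * (ip g v - F v) * t + 0" for t
    proof (rule LIMSEQ_le_const)
      have "(\<lambda>n. t\<^sup>2 * ip v v + 2 * t * (ip (w n) v - F v) + 1 / Suc n) \<longlonglongrightarrow>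
         t\<^sup>2 * ip v v + 2 * t * (ip g v - F v) + 0"
        by (intro tendsto_intros tendsto_ip_left[OF wV g v glim] LIMSEQ_Suc[OF lim_1_over_n])
      then show "(\<lambda>n. t\<^sup>2 * ip v v + 2 * t * (ip (w n) v - F v) + 1 / Suc n) \<longlonglongrightarrow>
        ip v v * t\<^sup>2 + 2 * (ip g v - F v) * t + 0" by (simp add: mult_ac)
      have "0 \<le> t\<^sup>2 * ip v v + 2 * t * (ip (w n) v - F v) + 1 / Suc n" for n
        using m_le[OF lin[OF wV[of n] v, of 1 t]] w[of n] ip_comb_self[OF wV[of n] v, of 1 t]
          Flin[OF wV[of n] v, of 1 t]
        by (simp add: J_def algebra_simps)
      then show "\<exists>N. \<forall>n\<ge>N. 0 \<le> t\<^sup>2 * ip v v + 2 * t * (ip (w n) v - F v) + 1 / Suc n" by blast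
    qed
    from quadratic_nonneg_imp_discriminant[OF ip_ge0[OF v] this] show ?thesis
      using ip_sym[OF v g] by simp
  qed
  with g that show thesis by blast
qed

lemma bounded_functional_ip:
  assumes "w \<in> V" shows "bounded_functional V nrm (\<lambda>v. ip v w)"
  unfolding bounded_functional_def
proof (intro conjI exI[of _ "nrm w"] ballI allI)
  show "\<bar>ip u w\<bar> \<le> nrm w * nrm u" if "u \<in> V" for u
    using Cauchy_Schwarz[OF that assms] by (simp add: mult.commute)
qed (simp add: ip_lin assms)

lemma semi_hilbert_subspace:
  assumes W: "W \<subseteq> V" "W \<noteq> {}" "\<And>u v a b. u \<in> W \<Longrightarrow> v \<in> W \<Longrightarrow> (\<lambda>x. a * u x + b * v x) \<in> W"
    and closed: "\<And>s l. (\<And>n. s n \<in> W) \<Longrightarrow> l \<in> V \<Longrightarrow>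
      (\<lambda>n. dist_sq (s n) l) \<longlonglongrightarrow> 0 \<Longrightarrow> l \<in> W"
  shows "semi_hilbert W ip"
proof
  fix s :: "nat \<Rightarrow> 'x \<Rightarrow> real"
  assume s: "\<And>n. s n \<in> W" and "\<And>\<epsilon>. 0 < \<epsilon> \<Longrightarrow>
    \<exists>N. \<forall>m\<ge>N. \<forall>n\<ge>N. dist_sq (s m) (s n) < \<epsilon>"
  then obtain l where "l \<in> V" "(\<lambda>n. dist_sq (s n) l) \<longlonglongrightarrow> 0"
    using complete[of s] W(1) by (meson subsetD)
  then show "\<exists>l\<in>W. (\<lambda>n. dist_sq (s n) l) \<longlonglongrightarrow> 0"
    using closed[of s, OF s] by blast
next
  show "ip (\<lambda>x. a * u x + b * v x) w = a * ip u w + b * ip v w" if "u \<in> W" "v \<in> W" "w \<in> W" for u v w a b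
    using that W(1) by (intro ip_lin) auto
  show "ip u v = ip v u" if "u \<in> W" "v \<in> W" for u v using that W(1) by (intro ip_sym) auto
  show "0 \<le> ip u u" if "u \<in> W" for u using that W(1) by (intro ip_ge0) auto
qed (use W in auto)

lemma norm_sq_add_le:
  assumes "u \<in> V" "v \<in> V"
  shows "ip (\<lambda>x. a * u x + b * v x) (\<lambda>x. a * u x + b * v x) \<le> 2 * a\<^sup>2 * ip u u + 2 * b\<^sup>2 * ip v v"
proof -
  have "0 \<le> a\<^sup>2 * ip u u + 2 * a * (-b) * ip u v + (-b)\<^sup>2 * ip v v"
    using ip_ge0[OF lin[OF assms, of a "-b"]] unfolding ip_comb_self[OF assms] .
  then show ?thesis unfolding ip_comb_self[OF assms] by (simp add: algebra_simps)
qed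

lemma norm_sq_diff_le:
  assumes "u \<in> V" "v \<in> V" "w \<in> V"
  shows "dist_sq u w
    \<le> 2 * dist_sq u v + 2 * dist_sq v w"
  using norm_sq_add_le[OF diff_in[OF assms(1,2)] diff_in[OF assms(2,3)], of 1 1] by simp

lemma ip_cong_null:
  assumes "u \<in> V" "v \<in> V" "w \<in> V" "dist_sq u v = 0"
  shows "ip u w = ip v w"
  using Cauchy_Schwarz_sq[OF diff_in[OF assms(1,2)] assms(3)] ip_diff_left[OF assms(1-3)] assms(4)
  by simp

text \<open>Take \<open>\<phi>\<close> at distance \<open>\<delta>\<close> from \<open>w\<close> itself: then \<open>ip w w\<close> differs from \<open>ip w \<phi>\<close> by at most
  \<open>nrm w * \<delta>\<close>, and \<open>nrm \<phi>\<close> from \<open>nrm w\<close> by at most \<open>\<delta>\<close>.\<close>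

lemma dual_norm_bound:
  assumes w: "w \<in> V" and T: "T \<subseteq> V"
    and dense: "\<And>\<epsilon>. 0 < \<epsilon> \<Longrightarrow> \<exists>\<phi>\<in>T. dist_sq w \<phi> < \<epsilon>"
    and c: "0 \<le> c" "\<And>\<phi>. \<phi> \<in> T \<Longrightarrow> ip w \<phi> \<le> c * nrm \<phi>"
  shows "ip w w \<le> c\<^sup>2"
proof -
  have bound: "(nrm w)\<^sup>2 \<le> c * (nrm w + \<delta>) + nrm w * \<delta>" if \<delta>: "0 < \<delta>" for \<delta>
  proof -
    obtain \<phi> where \<phi>: "\<phi> \<in> T" and near: "dist_sq w \<phi> < \<delta>\<^sup>2"
      using dense[of "\<delta>\<^sup>2"] \<delta> by auto
    have \<phi>V: "\<phi> \<in> V" using \<phi> T by blast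
    have "nrm (\<lambda>x. w x - \<phi> x) < \<delta>" using near \<delta> by (intro real_less_lsqrt) auto
    then have "nrm w * nrm (\<lambda>x. w x - \<phi> x) \<le> nrm w * \<delta>"
      using ip_ge0[OF w] by (intro mult_left_mono) auto
    then have cs: "\<bar>ip w (\<lambda>x. w x - \<phi> x)\<bar> \<le> nrm w * \<delta>"
      using Cauchy_Schwarz[OF w diff_in[OF w \<phi>V]] by linarith
    have split: "ip w (\<lambda>x. w x - \<phi> x) = ip w w - ip w \<phi>"
      using ip_lin_right[OF w \<phi>V w, of 1 "-1"] by simp
    have "ip \<phi> \<phi> = ip w w - 2 * ip w (\<lambda>x. w x - \<phi> x) + dist_sq w \<phi>"
      unfolding split ip_diff_self[OF w \<phi>V] by simp
    also have "\<dots> \<le> (nrm w)\<^sup>2 + 2 * (nrm w * \<delta>) + \<delta>\<^sup>2"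
      using cs near ip_ge0[OF w] by simp
    also have "\<dots> = (nrm w + \<delta>)\<^sup>2" by (simp add: power2_sum)
    finally have "nrm \<phi> \<le> nrm w + \<delta>"
      using \<delta> ip_ge0[OF w] by (intro real_le_lsqrt) auto
    then have "c * nrm \<phi> \<le> c * (nrm w + \<delta>)" using c(1) by (rule mult_left_mono)
    then show ?thesis using c(2)[OF \<phi>] cs split ip_ge0[OF w] by simp
  qed
  have lim: "(\<lambda>n. c * (nrm w + inverse (real (Suc n))) + nrm w * inverse (real (Suc n))) \<longlonglongrightarrow> c * (nrm w + 0) + nrm w * 0"
    by (intro tendsto_intros LIMSEQ_inverse_real_of_nat)
  have "(nrm w)\<^sup>2 \<le> c * (nrm w + 0) + nrm w * 0"
    by (rule LIMSEQ_le_const[OF lim]) (use bound in auto)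
  then have "nrm w * nrm w \<le> c * nrm w" by (simp add: power2_eq_square)
  moreover have "0 \<le> nrm w" using ip_ge0[OF w] by simp
  ultimately have "nrm w \<le> c" using c(1) by (metis mult_right_le_imp_le order_le_less)
  then have "(nrm w)\<^sup>2 \<le> c\<^sup>2" using \<open>0 \<le> nrm w\<close> by (rule power_mono)
  then show ?thesis using ip_ge0[OF w] by simp
qed

text \<open>The closure \<open>W\<close> of \<open>T\<close> is again complete. Riesz representation inside \<open>W\<close> of the functional given
  by \<open>u\<close> produces the projection \<open>g\<close> of \<open>u\<close> to \<open>W\<close>; then \<open>u - g\<close> is orthogonal to \<open>T\<close>, hence null.\<close>

theorem dense_if_orthogonal_trivial:
  assumes T: "T \<subseteq> V" "T \<noteq> {}" "\<And>u v a b. u \<in> T \<Longrightarrow> v \<in> T \<Longrightarrow> (\<lambda>x. a * u x + b * v x) \<in> T"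
    and orth: "\<And>w. w \<in> V \<Longrightarrow> (\<And>\<phi>. \<phi> \<in> T \<Longrightarrow> ip w \<phi> = 0) \<Longrightarrow> ip w w = 0"
    and u: "u \<in> V" and \<epsilon>: "0 < \<epsilon>"
  obtains \<phi> where "\<phi> \<in> T" "dist_sq u \<phi> < \<epsilon>"
proof -
  define W where "W = {v \<in> V. \<forall>\<epsilon>>0. \<exists>\<phi>\<in>T. dist_sq v \<phi> < \<epsilon>}"
  have TV: "\<phi> \<in> V" if "\<phi> \<in> T" for \<phi> using that T(1) by blast
  have TW: "\<phi> \<in> W" if "\<phi> \<in> T" for \<phi>
    using that TV[OF that] ip_diff_self[OF TV[OF that] TV[OF that]] by (auto simp: W_def intro!: bexI[OF _ that])
  have WV: "w \<in> V" if "w \<in> W" for w using that by (simp add: W_def)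
  have approx: "\<exists>\<phi>\<in>T. dist_sq v \<phi> < \<delta>" if "v \<in> W" "0 < \<delta>" for v \<delta>
    using that by (simp add: W_def)
  have "semi_hilbert W ip"
  proof (rule semi_hilbert_subspace)
    show "W \<subseteq> V" "W \<noteq> {}" using T(2) TW WV by auto
  next
    fix v w a b assume vw: "v \<in> W" "w \<in> W"
    have "\<exists>\<phi>\<in>T. ip (\<lambda>x. (a * v x + b * w x) - \<phi> x) (\<lambda>x. (a * v x + b * w x) - \<phi> x) < \<epsilon>"
      if \<epsilon>: "0 < \<epsilon>" for \<epsilon>
    proof -
      define c where "c = 2 * a\<^sup>2 + 2 * b\<^sup>2 + 1"
      have c: "0 < c" by (simp add: c_def add_nonneg_pos)
      obtain \<phi> \<psi> where \<phi>: "\<phi> \<in> T" "dist_sq v \<phi> < \<epsilon> / c"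
        and \<psi>: "\<psi> \<in> T" "dist_sq w \<psi> < \<epsilon> / c"
        using approx[OF vw(1) divide_pos_pos[OF \<epsilon> c]] approx[OF vw(2) divide_pos_pos[OF \<epsilon> c]] by blast
      have "ip (\<lambda>x. a * (v x - \<phi> x) + b * (w x - \<psi> x)) (\<lambda>x. a * (v x - \<phi> x) + b * (w x - \<psi> x))
        \<le> 2 * a\<^sup>2 * dist_sq v \<phi> + 2 * b\<^sup>2 * dist_sq w \<psi>"
        using vw \<phi>(1) \<psi>(1) by (intro norm_sq_add_le diff_in) (auto dest: TV WV)
      also have "\<dots> \<le> 2 * a\<^sup>2 * (\<epsilon> / c) + 2 * b\<^sup>2 * (\<epsilon> / c)"
        using \<phi>(2) \<psi>(2) by (intro add_mono mult_left_mono) auto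
      also have "\<dots> = (c - 1) * (\<epsilon> / c)" by (simp add: c_def algebra_simps add_divide_distrib)
      also have "\<dots> < c * (\<epsilon> / c)" using c \<epsilon> by (intro mult_strict_right_mono) auto
      also have "\<dots> = \<epsilon>" using c by simp
      finally have "ip (\<lambda>x. a * (v x - \<phi> x) + b * (w x - \<psi> x)) (\<lambda>x. a * (v x - \<phi> x) + b * (w x - \<psi> x)) < \<epsilon>" .
      then have "ip (\<lambda>x. (a * v x + b * w x) - (a * \<phi> x + b * \<psi> x))
          (\<lambda>x. (a * v x + b * w x) - (a * \<phi> x + b * \<psi> x)) < \<epsilon>"
        by (simp add: algebra_simps)
      from bexI[where x="\<lambda>x. a * \<phi> x + b * \<psi> x" and P="\<lambda>\<phi>. ip (\<lambda>x. (a * v x + b * w x) - \<phi> x) (\<lambda>x. (a * v x + b * w x) - \<phi> x) < \<epsilon>", OF this T(3)[OF \<phi>(1) \<psi>(1)]]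
      show ?thesis .
    qed
    then show "(\<lambda>x. a * v x + b * w x) \<in> W"
      using lin[OF WV[OF vw(1)] WV[OF vw(2)], of a b] unfolding W_def by blast
  next
    fix t l assume t: "\<And>n. t n \<in> W" and l: "l \<in> V"
      and lim: "(\<lambda>n. dist_sq (t n) l) \<longlonglongrightarrow> 0"
    have "\<exists>\<phi>\<in>T. dist_sq l \<phi> < \<epsilon>" if \<epsilon>: "0 < \<epsilon>" for \<epsilon>
    proof -
      obtain n where n: "dist_sq (t n) l < \<epsilon> / 4"
        using order_tendstoD(2)[OF lim, of "\<epsilon> / 4"] \<epsilon> by (auto simp: eventually_sequentially)
      obtain \<phi> where \<phi>: "\<phi> \<in> T" "dist_sq (t n) \<phi> < \<epsilon> / 4"
        using approx[OF t[of n], of "\<epsilon> / 4"] \<epsilon> by auto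
      have "dist_sq l (t n) = dist_sq (t n) l"
        using ip_diff_self[OF WV[OF t[of n]] l] ip_diff_self[OF l WV[OF t[of n]]] ip_sym[OF l WV[OF t[of n]]] by simp
      then have "dist_sq l \<phi> < \<epsilon>"
        using norm_sq_diff_le[OF l WV[OF t[of n]] TV[OF \<phi>(1)]] n \<phi>(2) by simp
      with \<phi>(1) show ?thesis by blast
    qed
    with l show "l \<in> W" by (simp add: W_def)
  qed
  then interpret W: semi_hilbert W ip .
  have "bounded_functional W nrm (\<lambda>v. ip v u)"
    using bounded_functional_ip[OF u] unfolding bounded_functional_def by (blast dest: WV)
  then obtain g where g: "g \<in> W" "\<And>v. v \<in> W \<Longrightarrow> ip v u = ip v g" by (rule W.riesz) blast
  have "ip (\<lambda>x. u x - g x) \<phi> = 0" if "\<phi> \<in> T" for \<phi>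
    using that u g TW[OF that] TV[OF that] WV[OF g(1)] ip_sym[of _ \<phi>]
    by (simp add: ip_diff_left)
  then have "dist_sq u g = 0"
    using u WV[OF g(1)] by (intro orth diff_in)
  moreover obtain \<phi> where "\<phi> \<in> T" "dist_sq g \<phi> < \<epsilon> / 2"
    using approx[OF g(1), of "\<epsilon> / 2"] \<epsilon> by auto
  ultimately show thesis
    using that norm_sq_diff_le[OF u WV[OF g(1)] TV] by fastforce
qed

text \<open>A diagonal subsequence makes the inner products with the members of the sequence converge.
  It has a weak limit by two applications of Riesz representation in the closed subspace \<open>W\<close> of all
  elements against which it converges.\<close>

theorem weakly_compact:
  assumes s: "\<And>n :: nat. s n \<in> V" and bound: "\<And>n. nrm (s n) \<le> B"
  obtains l and r :: "nat \<Rightarrow> nat" where "l \<in> V" "strict_mono r" "weakly_tendsto V nrm (s \<circ> r) l"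
proof -
  have "norm (ip (s n) w) \<le> B * nrm w" if "w \<in> V" for n w
    using Cauchy_Schwarz[OF s[of n] that] mult_right_mono[OF bound[of n], of "nrm w"] ip_ge0[OF that]
    by simp
  note ip_bound = this
  have "norm (ip (s n) (s k)) \<le> B * B" for n k
    using ip_bound[OF s[of k], of n] mult_left_mono[OF bound[of k], of B]
      bound[of 0] order_trans[OF real_sqrt_ge_zero[OF ip_ge0[OF s[of 0]]] bound[of 0]] by simp
  then obtain r where r: "strict_mono r" "\<And>k. \<exists>l. (\<lambda>n. ip (s (r n)) (s k)) \<longlonglongrightarrow> l"
    using function_convergent_subsequence[of "UNIV :: nat set" "\<lambda>n k. ip (s n) (s k)" "B * B"]
    by (metis UNIV_I countableI_type)
  \<comment> \<open>\<open>W\<close> is a closed subspace which contains the whole sequence; inside \<open>W\<close> both the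
    limit functional and any given functional are represented by elements of \<open>W\<close>.\<close>
  define W where "W = {w \<in> V. convergent (\<lambda>n. ip (s (r n)) w)}"
  have sW: "s n \<in> W" for n using s r by (auto simp: W_def convergent_def)
  have "semi_hilbert W ip"
  proof (rule semi_hilbert_subspace)
    show "W \<subseteq> V" "W \<noteq> {}" using sW by (auto simp: W_def)
  next
    fix u v a b assume "u \<in> W" "v \<in> W"
    then obtain lu lv where "u \<in> V" "v \<in> V" and lim: "(\<lambda>n. ip (s (r n)) u) \<longlonglongrightarrow> lu"
      "(\<lambda>n. ip (s (r n)) v) \<longlonglongrightarrow> lv" by (auto simp: W_def convergent_def)
    moreover have "(\<lambda>n. a * ip (s (r n)) u + b * ip (s (r n)) v) \<longlonglongrightarrow> a * lu + b * lv"
      by (intro tendsto_intros lim)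
    ultimately show "(\<lambda>x. a * u x + b * v x) \<in> W"
      using s by (auto simp: W_def lin ip_lin_right convergent_def)
  next
    fix t l assume t: "\<And>n. t n \<in> W" and l: "l \<in> V"
      and lim: "(\<lambda>n. dist_sq (t n) l) \<longlonglongrightarrow> 0"
    have tV: "t n \<in> V" for n using t by (auto simp: W_def)
    have "Cauchy (\<lambda>n. ip (s (r n)) l)"
    proof (rule metric_CauchyI)
      fix \<epsilon> :: real assume \<epsilon>: "0 < \<epsilon>"
      have "(\<lambda>n. B * sqrt (dist_sq (t n) l)) \<longlonglongrightarrow> B * sqrt 0"
        by (intro tendsto_intros lim)
      then have "\<forall>\<^sub>F k in sequentially. B * sqrt (dist_sq (t k) l) < \<epsilon> / 3"
        using \<epsilon> by (intro order_tendstoD(2)) auto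
      then obtain k where k: "B * sqrt (dist_sq (t k) l) < \<epsilon> / 3"
        by (auto simp: eventually_sequentially)
      have close: "dist (ip (s n) l) (ip (s n) (t k)) < \<epsilon> / 3" for n
        using ip_bound[OF diff_in[OF tV[of k] l], of n] k
          ip_diff_left[OF tV[of k] l s[of n]] ip_sym[OF s[of n] tV[of k]] ip_sym[OF s[of n] l]
          ip_sym[OF s[of n] diff_in[OF tV[of k] l]]
        by (simp add: dist_real_def abs_minus_commute)
      have "Cauchy (\<lambda>n. ip (s (r n)) (t k))"
        using t[of k] by (auto simp: W_def Cauchy_convergent_iff)
      then obtain N where N: "\<And>m n. m \<ge> N \<Longrightarrow> n \<ge> N \<Longrightarrow>
          dist (ip (s (r m)) (t k)) (ip (s (r n)) (t k)) < \<epsilon> / 3"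
        using \<epsilon> metric_CauchyD[of _ "\<epsilon>/3"] by (metis divide_pos_pos zero_less_numeral)
      have "dist (ip (s (r m)) l) (ip (s (r n)) l) < \<epsilon>" if "m \<ge> N" "n \<ge> N" for m n
        using dist_triangle_third[OF close[of "r m"] N[OF that]] close[of "r n"] by (metis dist_commute)
      then show "\<exists>M. \<forall>m\<ge>M. \<forall>n\<ge>M. dist (ip (s (r m)) l) (ip (s (r n)) l) < \<epsilon>" by blast
    qed
    with l show "l \<in> W" by (simp add: W_def Cauchy_convergent_iff)
  qed
  then interpret W: semi_hilbert W ip .
  have WV: "w \<in> V" if "w \<in> W" for w using that by (simp add: W_def)
  define L where "L w = lim (\<lambda>n. ip (s (r n)) w)" for w
  have L: "(\<lambda>n. ip (s (r n)) w) \<longlonglongrightarrow> L w" if "w \<in> W" for w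
    using that by (simp add: W_def L_def convergent_LIMSEQ_iff)
  have "bounded_functional W nrm L"
    unfolding bounded_functional_def
  proof (intro conjI exI[of _ B] ballI allI)
    fix u v a b assume uv: "u \<in> W" "v \<in> W"
    have "(\<lambda>n. a * ip (s (r n)) u + b * ip (s (r n)) v) \<longlonglongrightarrow> a * L u + b * L v"
      by (intro tendsto_intros L uv)
    then have "(\<lambda>n. ip (s (r n)) (\<lambda>x. a * u x + b * v x)) \<longlonglongrightarrow> a * L u + b * L v"
      using uv s by (simp add: ip_lin_right WV)
    then show "L (\<lambda>x. a * u x + b * v x) = a * L u + b * L v"
      using LIMSEQ_unique L[OF W.lin[OF uv]] by blast
  next
    fix u assume u: "u \<in> W"
    show "\<bar>L u\<bar> \<le> B * nrm u"
      by (rule LIMSEQ_le_const2[OF tendsto_rabs[OF L[OF u]]]) (use ip_bound WV[OF u] in auto)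
  qed
  then obtain l where l: "l \<in> W" "\<And>w. w \<in> W \<Longrightarrow> L w = ip w l" by (rule W.riesz) blast
  have "(\<lambda>n. F ((s \<circ> r) n)) \<longlonglongrightarrow> F l" if F: "bounded_functional V nrm F" for F
  proof -
    have "bounded_functional W nrm F"
      using F unfolding bounded_functional_def by (blast dest: WV)
    then obtain g where g: "g \<in> W" "\<And>w. w \<in> W \<Longrightarrow> F w = ip w g" by (rule W.riesz) blast
    have "(\<lambda>n. ip (s (r n)) g) \<longlonglongrightarrow> ip g l" using L[OF g(1)] l(2)[OF g(1)] by simp
    then show ?thesis using g l(1) sW ip_sym[OF WV[OF l(1)] WV[OF g(1)]] by simp
  qed
  then have "weakly_tendsto V nrm (s \<circ> r) l"
    using s WV[OF l(1)] by (simp add: weakly_tendsto_def)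
  with that r(1) WV[OF l(1)] show thesis by blast
qed

end

section \<open>Completeness of spaces of square integrable functions\<close>

lemma square_integrable_mult:
  fixes f g :: "'a \<Rightarrow> real"
  assumes [measurable]: "f \<in> borel_measurable M" "g \<in> borel_measurable M"
    and "integrable M (\<lambda>x. (f x)\<^sup>2)" "integrable M (\<lambda>x. (g x)\<^sup>2)"
  shows "integrable M (\<lambda>x. f x * g x)"
proof (rule Bochner_Integration.integrable_bound)
  show "integrable M (\<lambda>x. (f x)\<^sup>2 + (g x)\<^sup>2)" using assms by simp
  have "\<bar>a * b\<bar> \<le> a\<^sup>2 + b\<^sup>2" for a b :: real
    using sum_squares_bound[of a b] sum_squares_bound[of a "-b"] by (auto simp: abs_le_iff)
  then show "AE x in M. norm (f x * g x) \<le> norm ((f x)\<^sup>2 + (g x)\<^sup>2)" by simp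
qed simp

lemma square_integrable_lin:
  fixes f g :: "'a \<Rightarrow> real"
  assumes "f \<in> borel_measurable M" "g \<in> borel_measurable M"
    and "integrable M (\<lambda>x. (f x)\<^sup>2)" "integrable M (\<lambda>x. (g x)\<^sup>2)"
  shows "integrable M (\<lambda>x. (a * f x + b * g x)\<^sup>2)"
proof -
  have "(\<lambda>x. (a * f x + b * g x)\<^sup>2) = (\<lambda>x. a\<^sup>2 * (f x)\<^sup>2 + b\<^sup>2 * (g x)\<^sup>2 + 2 * a * b * (f x * g x))"
    by (simp add: power2_eq_square algebra_simps)
  then show ?thesis using square_integrable_mult[OF assms] assms by simp
qed

text \<open>By \<open>a \<le> 2\<^sup>-\<^sup>n + 2\<^sup>n a\<^sup>2\<close>, the weights turn summability of squares into summability.\<close>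

lemma convergent_of_summable_weighted_squares:
  fixes a :: "nat \<Rightarrow> real"
  assumes "summable (\<lambda>n. 2 ^ n * (a (Suc n) - a n)\<^sup>2)"
  shows "convergent a"
proof -
  have "\<bar>a (Suc n) - a n\<bar> \<le> (1/2) ^ n + 2 ^ n * (a (Suc n) - a n)\<^sup>2" for n
  proof -
    have "0 \<le> (1 - 2 ^ n * \<bar>a (Suc n) - a n\<bar>)\<^sup>2" by simp
    then have "2 ^ n * (2 * \<bar>a (Suc n) - a n\<bar>) \<le> 2 ^ n * ((1/2) ^ n + 2 ^ n * (a (Suc n) - a n)\<^sup>2)"
      by (simp add: power2_diff algebra_simps power_mult_distrib power_one_over power2_eq_square)
    then have "2 * \<bar>a (Suc n) - a n\<bar> \<le> (1/2) ^ n + 2 ^ n * (a (Suc n) - a n)\<^sup>2"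
      by (subst (asm) mult_le_cancel_left_pos) auto
    then show ?thesis by (rule order_trans[rotated]) simp
  qed
  moreover have "summable (\<lambda>n. (1/2) ^ n + 2 ^ n * (a (Suc n) - a n)\<^sup>2)"
    using assms by (intro summable_add summable_geometric) auto
  ultimately have "summable (\<lambda>n. a (Suc n) - a n)"
    by (intro summable_comparison_test[of "\<lambda>n. a (Suc n) - a n"]) auto
  then have "convergent (\<lambda>n. \<Sum>i<n. a (Suc i) - a i)" by (simp add: summable_iff_convergent)
  then have "convergent (\<lambda>n. (\<Sum>i<n. a (Suc i) - a i) + a 0)"
    by (intro convergent_add convergent_const)
  then show ?thesis by (simp add: sum_lessThan_telescope)
qed

text \<open>A subsequence whose consecutive differences have squared norm at most \<open>4\<^sup>-\<^sup>k\<close> has weighted squared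
  differences with an integrable sum, so it converges almost everywhere. Fatou's lemma then bounds the
  distance of every late member of the sequence from this pointwise limit.\<close>

theorem L2_complete:
  fixes s :: "nat \<Rightarrow> 'a \<Rightarrow> real"
  assumes [measurable]: "\<And>n. s n \<in> borel_measurable M"
    and int: "\<And>n. integrable M (\<lambda>x. (s n x)\<^sup>2)"
    and Cauchy: "\<And>\<epsilon>. 0 < \<epsilon> \<Longrightarrow> \<exists>N. \<forall>m\<ge>N. \<forall>n\<ge>N. (\<integral>x. (s m x - s n x)\<^sup>2 \<partial>M) < \<epsilon>"
  obtains l where "l \<in> borel_measurable M" "integrable M (\<lambda>x. (l x)\<^sup>2)"
    "(\<lambda>n. \<integral>x. (s n x - l x)\<^sup>2 \<partial>M) \<longlonglongrightarrow> 0"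
proof -
  have intd: "integrable M (\<lambda>x. (s m x - s n x)\<^sup>2)" for m n
    using square_integrable_lin[of "s m" M "s n" 1 "-1"] int by simp
  have "\<exists>N. \<forall>m\<ge>N. \<forall>n\<ge>N. (\<integral>x. (s m x - s n x)\<^sup>2 \<partial>M) < (1/4) ^ k" for k :: nat
    by (rule Cauchy) simp
  then obtain N where N: "\<And>k m n. N k \<le> m \<Longrightarrow> N k \<le> n \<Longrightarrow> (\<integral>x. (s m x - s n x)\<^sup>2 \<partial>M) < (1/4) ^ k"
    by metis
  \<comment> \<open>The sum makes \<open>r\<close> monotone, so that consecutive indices both exceed \<open>N k\<close>.\<close>
  define r where "r k = (\<Sum>i\<le>k. N i) + k" for k
  have r_ge: "N k \<le> r k" "k \<le> r k" for k by (simp_all add: r_def sum.remove[of _ k])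
  have r_Suc: "N k \<le> r (Suc k)" for k
    using r_ge(1)[of k] by (simp add: r_def)
  define D where "D k x = 2 ^ k * (s (r (Suc k)) x - s (r k) x)\<^sup>2" for k x
  have D_nonneg: "0 \<le> D k x" for k x by (simp add: D_def)
  have D_le: "(\<integral>\<^sup>+x. ennreal (D k x) \<partial>M) \<le> ennreal ((1/2) ^ k)" for k
  proof -
    have "(\<integral>\<^sup>+x. ennreal (D k x) \<partial>M) = ennreal (\<integral>x. D k x \<partial>M)"
      unfolding D_def by (intro nn_integral_eq_integral) (simp_all add: intd)
    also have "(\<integral>x. D k x \<partial>M) \<le> 2 ^ k * (1/4) ^ k"
      using N[OF r_Suc[of k] r_ge(1)[of k]] by (simp add: D_def)
    also have "2 ^ k * (1/4) ^ k = ((1/2) :: real) ^ k" by (simp flip: power_mult_distrib)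
    finally show ?thesis by (simp add: ennreal_leI)
  qed
  have "(\<integral>\<^sup>+x. (\<Sum>k. ennreal (D k x)) \<partial>M) = (\<Sum>k. \<integral>\<^sup>+x. ennreal (D k x) \<partial>M)"
    by (intro nn_integral_suminf) (simp add: D_def)
  also have "\<dots> \<le> (\<Sum>k. ennreal ((1/2) ^ k))" by (intro suminf_le D_le) auto
  also have "\<dots> < \<infinity>"
    by (subst suminf_ennreal_eq[where x=2]) (auto intro!: power_half_series sums_def geometric_sums[of "1/2::real", simplified])
  finally have "(\<integral>\<^sup>+x. (\<Sum>k. ennreal (D k x)) \<partial>M) \<noteq> \<infinity>" by simp
  then have "AE x in M. (\<Sum>k. ennreal (D k x)) \<noteq> \<infinity>"
    by (intro nn_integral_noteq_infinite) (auto simp: D_def)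
  then have conv: "AE x in M. convergent (\<lambda>k. s (r k) x)"
  proof eventually_elim
    case (elim x)
    then have "summable (\<lambda>k. D k x)" by (intro summable_suminf_not_top D_nonneg) auto
    then show ?case
      by (intro convergent_of_summable_weighted_squares) (simp add: D_def)
  qed
  define l where "l x = lim (\<lambda>k. s (r k) x)" for x
  have [measurable]: "l \<in> borel_measurable M" unfolding l_def[abs_def] by measurable
  have close: "(\<integral>\<^sup>+x. ennreal ((s n x - l x)\<^sup>2) \<partial>M) \<le> ennreal \<epsilon>"
    if n: "\<forall>m\<ge>K. \<forall>n\<ge>K. (\<integral>x. (s m x - s n x)\<^sup>2 \<partial>M) < \<epsilon>" "K \<le> n" for n K \<epsilon>
  proof -
    have "AE x in M. (\<lambda>k. ennreal ((s n x - s (r k) x)\<^sup>2)) \<longlonglongrightarrow> ennreal ((s n x - l x)\<^sup>2)"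
      using conv
    proof eventually_elim
      case (elim x)
      then have "(\<lambda>k. s (r k) x) \<longlonglongrightarrow> l x" by (simp add: l_def convergent_LIMSEQ_iff)
      then show ?case by (intro tendsto_ennrealI tendsto_intros)
    qed
    then have "AE x in M. ennreal ((s n x - l x)\<^sup>2) = liminf (\<lambda>k. ennreal ((s n x - s (r k) x)\<^sup>2))"
      by eventually_elim (metis lim_imp_Liminf sequentially_bot)
    then have "(\<integral>\<^sup>+x. ennreal ((s n x - l x)\<^sup>2) \<partial>M)
        = (\<integral>\<^sup>+x. liminf (\<lambda>k. ennreal ((s n x - s (r k) x)\<^sup>2)) \<partial>M)" by (rule nn_integral_cong_AE)
    also have "\<dots> \<le> liminf (\<lambda>k. \<integral>\<^sup>+x. ennreal ((s n x - s (r k) x)\<^sup>2) \<partial>M)"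
      by (intro nn_integral_liminf) simp
    also have "\<dots> = liminf (\<lambda>k. ennreal (\<integral>x. (s n x - s (r k) x)\<^sup>2 \<partial>M))"
      using intd by (simp add: nn_integral_eq_integral)
    also have "\<dots> \<le> limsup (\<lambda>k. ennreal (\<integral>x. (s n x - s (r k) x)\<^sup>2 \<partial>M))"
      by (intro Liminf_le_Limsup) simp
    also have "\<dots> \<le> ennreal \<epsilon>"
    proof (rule Limsup_bounded, rule eventually_sequentiallyI)
      fix k assume "K \<le> k"
      then have "K \<le> r k" using r_ge(2)[of k] by simp
      then show "ennreal (\<integral>x. (s n x - s (r k) x)\<^sup>2 \<partial>M) \<le> ennreal \<epsilon>"
        using n by (intro ennreal_leI less_imp_le) simp
    qed
    finally show ?thesis .
  qed
  have diff: "integrable M (\<lambda>x. (s n x - l x)\<^sup>2)" if "N 0 \<le> n" for n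
    using close[of "N 0" 1 n] N[of 0] that
    by (intro integrableI_bounded) (auto simp: ennreal_one_less_top intro: le_less_trans)
  have "integrable M (\<lambda>x. (1 * s (N 0) x + (-1) * (s (N 0) x - l x))\<^sup>2)"
    using int diff by (intro square_integrable_lin) auto
  then have l2: "integrable M (\<lambda>x. (l x)\<^sup>2)" by simp
  have dif: "integrable M (\<lambda>x. (s n x - l x)\<^sup>2)" for n
    using square_integrable_lin[of "s n" M l 1 "-1"] int l2 by simp
  have "(\<lambda>n. \<integral>x. (s n x - l x)\<^sup>2 \<partial>M) \<longlonglongrightarrow> 0"
  proof (rule LIMSEQ_I)
    fix \<epsilon> :: real assume "0 < \<epsilon>"
    then obtain K where K: "\<forall>m\<ge>K. \<forall>n\<ge>K. (\<integral>x. (s m x - s n x)\<^sup>2 \<partial>M) < \<epsilon> / 2"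
      using Cauchy[of "\<epsilon> / 2"] by auto
    have "norm ((\<integral>x. (s n x - l x)\<^sup>2 \<partial>M) - 0) < \<epsilon>" if "K \<le> n" for n
      using close[OF K that] \<open>0 < \<epsilon>\<close> dif[of n]
      by (simp add: nn_integral_eq_integral)
    then show "\<exists>K. \<forall>n\<ge>K. norm ((\<integral>x. (s n x - l x)\<^sup>2 \<partial>M) - 0) < \<epsilon>" by blast
  qed
  with that[of l] l2 show thesis by simp
qed

section \<open>The space L2\<close>

definition L2ip :: "'a::euclidean_space set \<Rightarrow> ('a \<Rightarrow> real) \<Rightarrow> ('a \<Rightarrow> real) \<Rightarrow> real" where
  "L2ip S u v = (\<integral>x. u x * v x \<partial>lebesgue_on S)"

abbreviation L2_dist_sq :: "'a::euclidean_space set \<Rightarrow> ('a \<Rightarrow> real) \<Rightarrow> ('a \<Rightarrow> real) \<Rightarrow> real" where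
  "L2_dist_sq S u v \<equiv> L2ip S (\<lambda>x. u x - v x) (\<lambda>x. u x - v x)"

lemma L2_iff: "(u :: 'a::euclidean_space \<Rightarrow> real) \<in> L2 S \<longleftrightarrow>
    u \<in> borel_measurable (lebesgue_on S) \<and> integrable (lebesgue_on S) (\<lambda>x. (u x)\<^sup>2)"
  by (simp add: L2_def)

lemma L2norm_eq: "L2norm S (u :: 'a::euclidean_space \<Rightarrow> real) = sqrt (L2ip S u u)"
  by (simp add: L2norm_def L2ip_def power2_eq_square)

lemma L2_mult_integrable: "u \<in> L2 S \<Longrightarrow> v \<in> L2 S \<Longrightarrow> integrable (lebesgue_on S) (\<lambda>x. u x * v x :: real)"
  by (simp add: L2_iff square_integrable_mult)

lemma semi_hilbert_L2: "semi_hilbert (L2 S :: ('a::euclidean_space \<Rightarrow> real) set) (L2ip S)"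
proof
  have "(\<lambda>_. 0) \<in> (L2 S :: ('a \<Rightarrow> real) set)" by (simp add: L2_iff)
  then show "L2 S \<noteq> ({} :: ('a \<Rightarrow> real) set)" by blast
  show lin: "(\<lambda>x. a * u x + b * v x) \<in> L2 S" if "u \<in> L2 S" "v \<in> L2 S" for u v :: "'a \<Rightarrow> real" and a b
    using that unfolding L2_iff by (intro conjI square_integrable_lin) auto
  show "L2ip S (\<lambda>x. a * u x + b * v x) w = a * L2ip S u w + b * L2ip S v w"
    if "u \<in> L2 S" "v \<in> L2 S" "w \<in> L2 S" for u v w :: "'a \<Rightarrow> real" and a b
  proof -
    have "(\<lambda>x. (a * u x + b * v x) * w x) = (\<lambda>x. a * (u x * w x) + b * (v x * w x))"
      by (simp add: algebra_simps)
    then show ?thesis using that by (simp add: L2ip_def L2_mult_integrable)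
  qed
  show "L2ip S u v = L2ip S v u" for u v by (simp add: L2ip_def mult.commute)
  show "0 \<le> L2ip S u u" for u by (simp add: L2ip_def)
  fix s :: "nat \<Rightarrow> 'a \<Rightarrow> real" assume s: "\<And>n. s n \<in> L2 S"
    and "\<And>\<epsilon>. 0 < \<epsilon> \<Longrightarrow> \<exists>N. \<forall>m\<ge>N. \<forall>n\<ge>N. L2_dist_sq S (s m) (s n) < \<epsilon>"
  then have Cauchy: "\<exists>N. \<forall>m\<ge>N. \<forall>n\<ge>N. (\<integral>x. (s m x - s n x)\<^sup>2 \<partial>lebesgue_on S) < \<epsilon>" if "0 < \<epsilon>" for \<epsilon>
    using that by (simp add: L2ip_def power2_eq_square)
  have "s n \<in> borel_measurable (lebesgue_on S)" "integrable (lebesgue_on S) (\<lambda>x. (s n x)\<^sup>2)" for n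
    using s[of n] by (simp_all add: L2_iff)
  from L2_complete[OF this Cauchy] obtain l where
    "l \<in> borel_measurable (lebesgue_on S)" "integrable (lebesgue_on S) (\<lambda>x. (l x)\<^sup>2)"
    "(\<lambda>n. \<integral>x. (s n x - l x)\<^sup>2 \<partial>lebesgue_on S) \<longlonglongrightarrow> 0"
    by blast
  then show "\<exists>l\<in>L2 S. (\<lambda>n. L2_dist_sq S (s n) l) \<longlonglongrightarrow> 0"
    by (intro bexI[of _ l]) (auto simp: L2ip_def power2_eq_square L2_iff)
qed

section \<open>Borel representatives\<close>

text \<open>Unlike Lebesgue measurable functions, Borel functions can be composed with the maps that occur
  below. The representative is extended by zero, which turns all integrals into integrals over the
  whole space, where translations and Fubini's theorem are available.\<close>

definition borel_rep :: "'a::euclidean_space set \<Rightarrow> ('a \<Rightarrow> real) \<Rightarrow> ('a \<Rightarrow> real) \<Rightarrow> bool" where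
  "borel_rep S f F \<longleftrightarrow> F \<in> borel_measurable borel \<and> (\<forall>x. x \<notin> S \<longrightarrow> F x = 0) \<and>
     (AE x in lborel. x \<in> S \<longrightarrow> f x = F x)"

lemma AE_lebesgue_on_iff:
  "S \<in> sets borel \<Longrightarrow> (AE x in lebesgue_on S. P x) \<longleftrightarrow> (AE x in lborel. x \<in> S \<longrightarrow> P x)"
  by (simp add: AE_restrict_space_iff AE_completion_iff)

lemma borel_rep_exists:
  assumes S: "S \<in> sets borel" and f: "f \<in> borel_measurable (lebesgue_on S)"
  obtains F where "borel_rep S f F"
proof -
  have "(\<lambda>x. f x * indicator S x) \<in> borel_measurable lebesgue"
    using f S by (simp add: borel_measurable_restrict_space_iff mult.commute)
  then obtain G where G: "G \<in> borel_measurable lborel" "AE x in lborel. f x * indicator S x = G x"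
    using completion_ex_borel_measurable_real by blast
  have "borel_rep S f (\<lambda>x. indicator S x * G x)"
    unfolding borel_rep_def
  proof (intro conjI)
    show "(\<lambda>x. indicator S x * G x) \<in> borel_measurable borel" using S G(1) by simp
    show "AE x in lborel. x \<in> S \<longrightarrow> f x = indicator S x * G x" using G(2) by eventually_elim auto
  qed simp
  with that show thesis by blast
qed

lemma borel_rep_measurable:
  assumes S: "S \<in> sets borel" and rep: "borel_rep S f F"
  shows "f \<in> borel_measurable (lebesgue_on S)"
proof -
  have F: "F \<in> borel_measurable lebesgue" using rep by (simp add: borel_rep_def measurable_completion)
  have "AE x in lebesgue. f x * indicator S x = F x"
    using rep unfolding borel_rep_def AE_completion_iff by (auto elim!: eventually_mono simp: indicator_def)
  then have "(\<lambda>x. f x * indicator S x) \<in> borel_measurable lebesgue"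
    using F by (auto intro!: borel_measurable_AE[OF F] elim!: eventually_mono)
  then show ?thesis using S by (simp add: borel_measurable_restrict_space_iff mult.commute)
qed

lemma borel_rep_lin:
  "borel_rep S f F \<Longrightarrow> borel_rep S g G \<Longrightarrow> borel_rep S (\<lambda>x. a * f x + b * g x) (\<lambda>x. a * F x + b * G x)"
  unfolding borel_rep_def by (auto elim: eventually_elim2)

lemma borel_rep_mult:
  "borel_rep S f F \<Longrightarrow> borel_rep S g G \<Longrightarrow> borel_rep S (\<lambda>x. f x * g x) (\<lambda>x. F x * G x)"
  unfolding borel_rep_def by (auto elim: eventually_elim2)

lemma borel_rep_integral:
  assumes S: "S \<in> sets borel" and rep: "borel_rep S f F"
  shows borel_rep_integrable_iff: "integrable (lebesgue_on S) f \<longleftrightarrow> integrable lborel F"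
    and borel_rep_integral_eq: "(\<integral>x. f x \<partial>lebesgue_on S) = (LBINT x. F x)"
proof -
  have [measurable]: "F \<in> borel_measurable borel" using rep by (simp add: borel_rep_def)
  have f: "f \<in> borel_measurable (lebesgue_on S)" using borel_rep_measurable[OF S rep] .
  have F: "F \<in> borel_measurable (lebesgue_on S)" by (simp add: measurable_completion measurable_restrict_space1)
  have eq: "AE x in lebesgue_on S. f x = F x"
    using rep S by (simp add: AE_lebesgue_on_iff borel_rep_def)
  have ind: "(\<lambda>x. indicator S x * F x) = F" using rep by (fastforce simp: borel_rep_def indicator_def)
  have "integrable (lebesgue_on S) f \<longleftrightarrow> integrable (lebesgue_on S) F"
    using f F eq by (intro integrable_cong_AE)
  also have "\<dots> \<longleftrightarrow> integrable lebesgue F"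
    using S by (subst integrable_restrict_space) (simp_all add: ind)
  also have "\<dots> \<longleftrightarrow> integrable lborel F" by (rule integrable_completion) simp
  finally show "integrable (lebesgue_on S) f \<longleftrightarrow> integrable lborel F" .
  have "(\<integral>x. f x \<partial>lebesgue_on S) = (\<integral>x. F x \<partial>lebesgue_on S)"
    using f F eq by (intro integral_cong_AE)
  also have "\<dots> = (\<integral>x. F x \<partial>lebesgue)"
    using S by (subst integral_restrict_space) (simp_all add: ind)
  also have "\<dots> = (LBINT x. F x)" by (rule integral_completion) simp
  finally show "(\<integral>x. f x \<partial>lebesgue_on S) = (LBINT x. F x)" .
qed

lemma borel_rep_L2_iff:
  assumes S: "S \<in> sets borel" and rep: "borel_rep S f F"
  shows "f \<in> L2 S \<longleftrightarrow> integrable lborel (\<lambda>x. (F x)\<^sup>2)"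
  using borel_rep_measurable[OF assms] borel_rep_integrable_iff[OF S borel_rep_mult[OF rep rep]]
  by (simp add: L2_iff power2_eq_square)

lemma borel_rep_L2ip:
  assumes S: "S \<in> sets borel" and "borel_rep S f F" "borel_rep S g G"
  shows "L2ip S f g = (LBINT x. F x * G x)"
  unfolding L2ip_def using assms by (intro borel_rep_integral_eq borel_rep_mult)

lemma borel_rep_self:
  "F \<in> borel_measurable borel \<Longrightarrow> (\<And>x. x \<notin> S \<Longrightarrow> F x = 0) \<Longrightarrow> borel_rep S F F"
  by (simp add: borel_rep_def)

lemma L2_rep:
  assumes S: "S \<in> sets borel" and f: "f \<in> L2 S"
  obtains F where "borel_rep S f F" "F \<in> borel_measurable borel" "\<And>x. x \<notin> S \<Longrightarrow> F x = 0"
    "integrable lborel (\<lambda>x. (F x)\<^sup>2)"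
proof -
  obtain F where "borel_rep S f F" using borel_rep_exists[OF S] f by (auto simp: L2_iff)
  with that show thesis using borel_rep_L2_iff[OF S] f by (auto simp: borel_rep_def)
qed

lemma L2_finite_measure_integrable:
  fixes u :: "'a::euclidean_space \<Rightarrow> real"
  assumes "emeasure lborel S < \<infinity>" "S \<in> sets borel" "u \<in> L2 S"
  shows "integrable (lebesgue_on S) u"
proof -
  have "(\<lambda>_. 1 :: real) \<in> L2 S"
    using assms by (auto simp: L2_iff emeasure_restrict_space intro!: finite_measure.integrable_const finite_measureI)
  from L2_mult_integrable[OF this assms(3)] show ?thesis by simp
qed

section \<open>Iterated differentiability\<close>

lemma partial_eqI: "(f has_derivative D) (at x) \<Longrightarrow> partial h f x = D h"
  using frechet_derivative_at by metis

lemma C_k_const: "C_k k (\<lambda>x :: 'a::euclidean_space. c)"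
proof (induction k arbitrary: c)
  case (Suc k)
  have "frechet_derivative (\<lambda>x :: 'a. c) (at x) b = 0" for x b
    by (simp add: frechet_derivative_const)
  then show ?case using Suc by simp
qed simp

lemma C_k_lin:
  fixes f g :: "'a::euclidean_space \<Rightarrow> real"
  assumes "C_k k f" "C_k k g"
  shows "C_k k (\<lambda>x. a * f x + b * g x)"
  using assms
proof (induction k arbitrary: f g)
  case 0
  then show ?case by (auto intro!: continuous_intros)
next
  case (Suc k)
  have "((\<lambda>x. a * f x + b * g x) has_derivative
      (\<lambda>h. a * frechet_derivative f (at x) h + b * frechet_derivative g (at x) h)) (at x)" for x
    using Suc.prems frechet_derivative_works[of f "at x"] frechet_derivative_works[of g "at x"]
    by (auto intro!: derivative_eq_intros)
  then have "frechet_derivative (\<lambda>x. a * f x + b * g x) (at x) h =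
      a * frechet_derivative f (at x) h + b * frechet_derivative g (at x) h"
    "(\<lambda>x. a * f x + b * g x) differentiable at x" for x h
    by (auto intro!: partial_eqI simp: differentiable_def)
  then show ?case using Suc by simp
qed

lemma C_k_Suc_imp: "C_k (Suc k) f \<Longrightarrow> C_k k f"
proof (induction k arbitrary: f)
  case 0
  then show ?case by (auto intro!: continuous_at_imp_continuous_on differentiable_imp_continuous_within)
next
  case (Suc k)
  then show ?case by (metis C_k.simps(2))
qed

lemma C_k_mult:
  fixes f g :: "'a::euclidean_space \<Rightarrow> real"
  assumes "C_k k f" "C_k k g"
  shows "C_k k (\<lambda>x. f x * g x)"
  using assms
proof (induction k arbitrary: f g)
  case 0
  then show ?case by (auto intro!: continuous_intros)
next
  case (Suc k)
  have "((\<lambda>x. f x * g x) has_derivative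
      (\<lambda>h. f x * frechet_derivative g (at x) h + frechet_derivative f (at x) h * g x)) (at x)" for x
    using Suc.prems frechet_derivative_works[of f "at x"] frechet_derivative_works[of g "at x"]
    by (auto intro!: derivative_eq_intros)
  then have *: "frechet_derivative (\<lambda>x. f x * g x) (at x) h =
      1 * (f x * frechet_derivative g (at x) h) + 1 * (frechet_derivative f (at x) h * g x)"
    "(\<lambda>x. f x * g x) differentiable at x" for x h
    by (auto simp: differentiable_def intro: partial_eqI[THEN trans])
  have "C_k k (\<lambda>x. 1 * (f x * partial b g x) + 1 * (partial b f x * g x))" if "b \<in> Basis" for b
    using Suc.prems that C_k_Suc_imp[OF Suc.prems(1)] C_k_Suc_imp[OF Suc.prems(2)]
    by (intro C_k_lin Suc.IH) auto
  then show ?case using * by simp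
qed

lemma C_k_prod:
  fixes f :: "'i \<Rightarrow> 'a::euclidean_space \<Rightarrow> real"
  assumes "finite I" "\<And>i. i \<in> I \<Longrightarrow> C_k k (f i)"
  shows "C_k k (\<lambda>x. \<Prod>i\<in>I. f i x)"
  using assms by (induction rule: finite_induct) (auto intro: C_k_const C_k_mult)

lemma C_k_translate: "C_k k f \<Longrightarrow> C_k k (\<lambda>x. f (x + c))"
proof (induction k arbitrary: f)
  case 0
  then show ?case by (auto intro!: continuous_intros continuous_on_compose2[of UNIV f])
next
  case (Suc k)
  have "((\<lambda>x. f (x + c)) has_derivative frechet_derivative f (at (x + c))) (at x)" for x
  proof -
    have "(f has_derivative frechet_derivative f (at (x + c))) (at (x + c))"
      using Suc.prems by (simp flip: frechet_derivative_works)
    moreover have "((\<lambda>x. x + c) has_derivative (\<lambda>h. h)) (at x)"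
      by (auto intro!: derivative_eq_intros)
    ultimately show ?thesis by (rule has_derivative_compose[rotated])
  qed
  then have "frechet_derivative (\<lambda>x. f (x + c)) (at x) = frechet_derivative f (at (x + c))"
    "(\<lambda>x. f (x + c)) differentiable at x" for x
    by (auto simp: frechet_derivative_at[symmetric] differentiable_def)
  moreover have "C_k k (\<lambda>x. partial b f (x + c))" if "b \<in> Basis" for b
    using Suc.prems that by (intro Suc.IH) simp
  ultimately show ?case by simp
qed

text \<open>The sequence \<open>D\<close> lists the successive derivatives of a function of one variable.\<close>

lemma C_k_ridge:
  fixes D :: "nat \<Rightarrow> real \<Rightarrow> real" and c :: "'a::euclidean_space"
  assumes D: "\<And>j t. (D j has_real_derivative D (Suc j) t) (at t)"
  shows "C_k k (\<lambda>x. D j (x \<bullet> c + d))"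
proof (induction k arbitrary: j)
  case 0
  have "isCont (D j) t" for t using D DERIV_isCont by blast
  then have "continuous_on UNIV (D j)" by (simp add: continuous_at_imp_continuous_on)
  then show ?case by (auto intro!: continuous_on_compose2[of UNIV "D j"] continuous_intros)
next
  case (Suc k)
  have "((\<lambda>x. D j (x \<bullet> c + d)) has_derivative (\<lambda>h. D (Suc j) (x \<bullet> c + d) * (h \<bullet> c))) (at x)" for x
  proof -
    have "((\<lambda>x. x \<bullet> c + d) has_derivative (\<lambda>h. h \<bullet> c)) (at x)"
      by (auto intro!: derivative_eq_intros)
    moreover have "(D j has_derivative (\<lambda>h. D (Suc j) (x \<bullet> c + d) * h)) (at (x \<bullet> c + d))"
      using D[of j] by (simp add: has_field_derivative_def)
    ultimately show ?thesis by (rule has_derivative_compose)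
  qed
  then have *: "frechet_derivative (\<lambda>x. D j (x \<bullet> c + d)) (at x) h
      = (h \<bullet> c) * D (Suc j) (x \<bullet> c + d) + 0 * D (Suc j) (x \<bullet> c + d)"
    "(\<lambda>x. D j (x \<bullet> c + d)) differentiable at x" for x h
    by (auto simp: differentiable_def mult.commute intro: partial_eqI[THEN trans])
  have "C_k k (\<lambda>x. (h \<bullet> c) * D (Suc j) (x \<bullet> c + d) + 0 * D (Suc j) (x \<bullet> c + d))" for h
    by (rule C_k_lin[OF Suc Suc])
  then show ?case unfolding C_k.simps * using *(2) by blast
qed

section \<open>A flat function\<close>

text \<open>For \<open>p = 1\<close> this is the classical smooth function \<open>exp (-1/t)\<close>. The polynomial is a parameter
  because the derivatives have the same form with other polynomials.\<close>

definition flat :: "real poly \<Rightarrow> real \<Rightarrow> real" where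
  "flat p t = (if t \<le> 0 then 0 else poly p (1 / t) * exp (- (1 / t)))"

text \<open>This decides differentiability of \<open>flat\<close> at the origin, with \<open>y = 1 / t\<close>.\<close>

lemma poly_times_exp_neg_tendsto_0: "((\<lambda>y. poly p y * exp (- y)) \<longlongrightarrow> 0) at_top"
  for p :: "real poly"
proof -
  have "((\<lambda>y. \<Sum>i\<le>degree p. coeff p i * (y ^ i / exp y)) \<longlongrightarrow> (\<Sum>i\<le>degree p. coeff p i * 0)) at_top"
    by (intro tendsto_intros tendsto_power_div_exp_0)
  then show ?thesis
    by (simp add: poly_altdef exp_minus divide_inverse sum_distrib_right mult.assoc)
qed

lemma flat_has_derivative:
  "(flat p has_real_derivative flat ([:0, 0, 1:] * (p - pderiv p)) t) (at t)"
proof -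
  consider "t < 0" | "t = 0" | "0 < t" by linarith
  then show ?thesis
  proof cases
    case 1
    have "((\<lambda>_. 0) has_real_derivative 0) (at t)" by simp
    then have "(flat p has_real_derivative 0) (at t)"
      by (rule has_field_derivative_transform_within_open[where S="{..<0}"])
        (use 1 in \<open>auto simp: flat_def\<close>)
    with 1 show ?thesis by (simp add: flat_def)
  next
    case 2
    have "((\<lambda>h. flat p h / h) \<longlongrightarrow> 0) (at_right 0)"
    proof -
      have "((\<lambda>h. poly (pCons 0 p) (1 / h) * exp (- (1 / h))) \<longlongrightarrow> 0) (at_right 0)"
        using poly_times_exp_neg_tendsto_0[of "pCons 0 p"] filterlim_inverse_at_top_right
        by (auto intro: filterlim_compose simp: inverse_eq_divide[symmetric] simp del: poly_pCons)
      then show ?thesis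
        by (rule Lim_transform_eventually)
          (auto simp: flat_def eventually_at_right_less intro!: eventually_mono[OF eventually_at_right_less[of 0]])
    qed
    moreover have "((\<lambda>h. flat p h / h) \<longlongrightarrow> 0) (at_left 0)"
      by (rule Lim_transform_eventually[OF tendsto_const])
        (auto simp: flat_def eventually_at_filter)
    ultimately have "((\<lambda>h. flat p h / h) \<longlongrightarrow> 0) (at 0)" by (rule filterlim_split_at_real[rotated])
    then show ?thesis using 2 by (simp add: has_field_derivative_iff flat_def)
  next
    case 3
    have "((\<lambda>t. poly p (1 / t) * exp (- (1 / t))) has_real_derivative
       flat ([:0, 0, 1:] * (p - pderiv p)) t) (at t)"
      using 3 by (auto intro!: derivative_eq_intros poly_DERIV[THEN DERIV_chain2]
          simp: flat_def field_simps power2_eq_square)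
    then show ?thesis
      by (rule has_field_derivative_transform_within_open[where S="{0<..}"])
        (use 3 in \<open>auto simp: flat_def\<close>)
  qed
qed

definition flat_poly :: "nat \<Rightarrow> real poly" where
  "flat_poly j = ((\<lambda>p. [:0, 0, 1:] * (p - pderiv p)) ^^ j) 1"

abbreviation exp_step :: "real \<Rightarrow> real" where "exp_step \<equiv> flat 1"

lemma C_k_flat: "C_k k (\<lambda>x :: 'a::euclidean_space. exp_step (x \<bullet> c + d))"
  using C_k_ridge[of "\<lambda>j. flat (flat_poly j)" k 0] flat_has_derivative
  by (simp add: flat_poly_def)

lemma exp_step_bounds: "0 \<le> exp_step t" "exp_step t \<le> 1" "exp_step t = 0 \<longleftrightarrow> t \<le> 0"
  by (auto simp: flat_def)

text \<open>The factor \<open>n\<close> steepens the function: \<open>exp (-1/(n s))\<close> tends to \<open>1\<close> for every \<open>s > 0\<close>.\<close>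

lemma exp_step_limit: "(\<lambda>n. exp_step (real n * s)) \<longlonglongrightarrow> (if 0 < s then 1 else 0)"
proof (cases "0 < s")
  case True
  have "(\<lambda>n. exp (- (1 / (real n * s)))) \<longlonglongrightarrow> exp (- 0)"
  proof (intro tendsto_exp tendsto_minus)
    have "(\<lambda>n. (1 / real n) * (1 / s)) \<longlonglongrightarrow> 0 * (1 / s)" by (intro tendsto_intros lim_1_over_n)
    then show "(\<lambda>n. 1 / (real n * s)) \<longlonglongrightarrow> 0" by simp
  qed
  then have "(\<lambda>n. exp_step (real n * s)) \<longlonglongrightarrow> exp (- 0)"
    by (rule Lim_transform_eventually)
      (use True in \<open>auto simp: flat_def mult_le_0_iff intro!: eventually_sequentiallyI[of 1]\<close>)
  with True show ?thesis by simp
next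
  case False
  then have "exp_step (real n * s) = 0" for n by (simp add: flat_def mult_nonneg_nonpos)
  with False show ?thesis by simp
qed

text \<open>Smooth functions which vanish outside of an open box and increase with \<open>n\<close> to its indicator.\<close>

definition box_bump :: "'a::euclidean_space \<Rightarrow> 'a \<Rightarrow> nat \<Rightarrow> 'a \<Rightarrow> real" where
  "box_bump a c n x = (\<Prod>b\<in>Basis. exp_step (real n * ((x - a) \<bullet> b)) * exp_step (real n * ((c - x) \<bullet> b)))"

lemma C_k_box_bump: "C_k k (box_bump a c n)"
proof -
  have "C_k k (\<lambda>x. exp_step (x \<bullet> (real n *\<^sub>R b) + - (real n * (a \<bullet> b)))
      * exp_step (x \<bullet> (- real n *\<^sub>R b) + real n * (c \<bullet> b)))" for b
    by (intro C_k_mult C_k_flat)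
  then have "C_k k (\<lambda>x. exp_step (real n * ((x - a) \<bullet> b)) * exp_step (real n * ((c - x) \<bullet> b)))" for b
    by (simp add: inner_diff_left algebra_simps)
  then show ?thesis unfolding box_bump_def[abs_def] by (intro C_k_prod) auto
qed

lemma box_bump_bounds: "0 \<le> box_bump a c n x" "box_bump a c n x \<le> 1"
  unfolding box_bump_def
  by (auto intro!: prod_nonneg prod_le_1 mult_nonneg_nonneg mult_le_one exp_step_bounds)

lemma box_bump_eq_0: "x \<notin> box a c \<Longrightarrow> box_bump a c n x = 0"
  by (force simp: box_bump_def mem_box inner_diff_left exp_step_bounds not_less mult_nonneg_nonpos)

lemma box_bump_limit: "(\<lambda>n. box_bump a c n x) \<longlonglongrightarrow> indicator (box a c) x"
proof -
  have "(\<lambda>n. box_bump a c n x) \<longlonglongrightarrow> (\<Prod>b\<in>Basis. (if 0 < (x - a) \<bullet> b then 1 else 0) * (if 0 < (c - x) \<bullet> b then 1 else 0))"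
    unfolding box_bump_def by (intro tendsto_intros exp_step_limit)
  also have "(\<Prod>b\<in>Basis. (if 0 < (x - a) \<bullet> b then 1 else 0) * (if 0 < (c - x) \<bullet> b then 1 else 0))
      = (indicator (box a c) x :: real)"
    by (auto simp: indicator_def mem_box inner_diff_left prod_eq_1_iff)
  finally show ?thesis .
qed

lemma box_bump_test_function: "cbox a c \<subseteq> S \<Longrightarrow> box_bump a c n \<in> test_functions S"
proof -
  assume S: "cbox a c \<subseteq> S"
  have "{x. box_bump a c n x \<noteq> 0} \<subseteq> cbox a c"
    using box_bump_eq_0 box_subset_cbox by blast
  then have "closure {x. box_bump a c n x \<noteq> 0} \<subseteq> cbox a c"
    by (rule closure_minimal) (rule closed_cbox)
  moreover from this have "compact (closure {x. box_bump a c n x \<noteq> 0})"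
    by (meson bounded_cbox bounded_subset closed_closure compact_eq_bounded_closed)
  ultimately show ?thesis using S C_k_box_bump by (auto simp: test_functions_def)
qed

section \<open>Test functions\<close>

lemma test_function_continuous: "\<phi> \<in> test_functions S \<Longrightarrow> continuous_on UNIV \<phi>"
  unfolding test_functions_def using C_k.simps(1) by blast

lemma test_function_borel [measurable_dest]: "\<phi> \<in> test_functions S \<Longrightarrow> \<phi> \<in> borel_measurable borel"
  by (intro borel_measurable_continuous_onI test_function_continuous)

lemma test_function_has_derivative:
  "\<phi> \<in> test_functions S \<Longrightarrow> (\<phi> has_derivative frechet_derivative \<phi> (at x)) (at x)"
  unfolding test_functions_def using C_k.simps(2)[of 0 \<phi>] by (auto simp flip: frechet_derivative_works)

lemma test_function_eq_0: "\<phi> \<in> test_functions S \<Longrightarrow> x \<notin> S \<Longrightarrow> \<phi> x = 0"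
  using closure_subset[of "{x. \<phi> x \<noteq> 0}"] by (auto simp: test_functions_def)

lemma test_functions_lin:
  assumes "\<phi> \<in> test_functions S" "\<psi> \<in> test_functions S"
  shows "(\<lambda>x. a * \<phi> x + b * \<psi> x) \<in> test_functions S"
proof -
  let ?A = "closure {x. \<phi> x \<noteq> 0}" and ?B = "closure {x. \<psi> x \<noteq> 0}" and ?C = "closure {x. a * \<phi> x + b * \<psi> x \<noteq> 0}"
  have AB: "compact (?A \<union> ?B)" "?A \<union> ?B \<subseteq> S" using assms by (auto simp: test_functions_def)
  have "{x. a * \<phi> x + b * \<psi> x \<noteq> 0} \<subseteq> ?A \<union> ?B"
    using closure_subset[of "{x. \<phi> x \<noteq> 0}"] closure_subset[of "{x. \<psi> x \<noteq> 0}"] by fastforce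
  then have C: "?C \<subseteq> ?A \<union> ?B" by (rule closure_minimal) (intro closed_Un closed_closure)
  then have "compact ?C" using AB(1)
    by (meson bounded_subset closed_closure compact_eq_bounded_closed)
  moreover have "C_k k (\<lambda>x. a * \<phi> x + b * \<psi> x)" for k
    using assms by (intro C_k_lin) (auto simp: test_functions_def)
  ultimately show ?thesis using AB(2) C by (simp add: test_functions_def subset_trans[of ?C])
qed

lemma zero_test_function: "(\<lambda>_. 0) \<in> test_functions S"
  by (auto simp: test_functions_def C_k_const)

lemma test_function_bounded:
  assumes "\<phi> \<in> test_functions S"
  obtains M where "\<And>x. \<bar>\<phi> x\<bar> \<le> M"
proof -
  let ?A = "closure {x. \<phi> x \<noteq> 0}"
  have "compact (\<phi> ` ?A)"
    using assms test_function_continuous[OF assms]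
    by (intro compact_continuous_image) (auto simp: test_functions_def intro: continuous_on_subset)
  then obtain M where M: "\<And>y. y \<in> \<phi> ` ?A \<Longrightarrow> \<bar>y\<bar> \<le> M"
    using compact_imp_bounded bounded_real by metis
  have "\<bar>\<phi> x\<bar> \<le> max M 0" for x
  proof (cases "\<phi> x = 0")
    case False
    then have "x \<in> ?A" using closure_subset by fastforce
    then show ?thesis using M[of "\<phi> x"] by auto
  qed simp
  with that show thesis by blast
qed

lemma test_function_square_integrable:
  assumes "\<phi> \<in> test_functions S"
  shows "integrable lborel (\<lambda>x. (\<phi> x)\<^sup>2)"
proof -
  let ?A = "closure {x. \<phi> x \<noteq> 0}"
  have A: "compact ?A" using assms by (simp add: test_functions_def)
  obtain M where M: "\<And>x. \<bar>\<phi> x\<bar> \<le> M" using test_function_bounded[OF assms] by blast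
  have [measurable]: "\<phi> \<in> borel_measurable borel" using test_function_borel[OF assms] .
  show ?thesis
  proof (rule Bochner_Integration.integrable_bound)
    show "integrable lborel (\<lambda>x. M\<^sup>2 * indicator ?A x)"
      using A emeasure_compact_finite[OF A] by (intro integrable_mult_right) (auto simp: compact_imp_closed)
    show "AE x in lborel. norm ((\<phi> x)\<^sup>2) \<le> norm (M\<^sup>2 * indicator ?A x)"
    proof (rule AE_I2)
      fix x
      have "x \<in> ?A" if "\<phi> x \<noteq> 0" using that closure_subset by fastforce
      moreover have "(\<phi> x)\<^sup>2 \<le> M\<^sup>2" using power_mono[OF M[of x], of 2] by simp
      ultimately show "norm ((\<phi> x)\<^sup>2) \<le> norm (M\<^sup>2 * indicator ?A x)"
        by (cases "\<phi> x = 0") (auto simp: indicator_def)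
    qed
  qed simp
qed

section \<open>The fundamental lemma\<close>

text \<open>The measures with densities \<open>max 0 V\<close> and \<open>max 0 (- V)\<close> agree on boxes, which generate the Borel
  sets, so the densities agree as well.\<close>

lemma AE_0_if_box_integrals_0:
  fixes V :: "'a::euclidean_space \<Rightarrow> real"
  assumes V: "integrable lborel V"
    and 0: "\<And>a c. (LBINT x. indicator (box a c) x * V x) = 0"
  shows "AE x in lborel. V x = 0"
proof -
  have [measurable]: "V \<in> borel_measurable borel" using V by auto
  define M where "M \<sigma> = density lborel (\<lambda>x. ennreal (\<sigma> * V x))" for \<sigma> :: real
  have em: "emeasure (M \<sigma>) A = ennreal (LBINT x. indicator A x * max 0 (\<sigma> * V x))"
    if [measurable]: "A \<in> sets borel" for A \<sigma>
  proof -
    have "emeasure (M \<sigma>) A = (\<integral>\<^sup>+x. ennreal (indicator A x * max 0 (\<sigma> * V x)) \<partial>lborel)"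
      unfolding M_def by (subst emeasure_density) (auto intro!: nn_integral_cong simp: indicator_def max_def ennreal_neg)
    also have "\<dots> = ennreal (LBINT x. indicator A x * max 0 (\<sigma> * V x))"
      using V by (intro nn_integral_eq_integral)
        (auto intro!: integrable_mult_indicator[where 'b=real, simplified] integrable_max)
    finally show ?thesis .
  qed
  have eq: "emeasure (M 1) (box a c) = emeasure (M (- 1)) (box a c)" for a c
  proof -
    have int: "integrable lborel (\<lambda>x. indicator (box a c) x * max 0 (\<sigma> * V x))" for \<sigma>
      using V by (auto intro!: integrable_mult_indicator[where 'b=real, simplified] integrable_max)
    have "(LBINT x. indicator (box a c) x * max 0 (1 * V x)) - (LBINT x. indicator (box a c) x * max 0 (-1 * V x))
      = (LBINT x. indicator (box a c) x * V x)"
      unfolding Bochner_Integration.integral_diff[OF int int, symmetric]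
      by (intro Bochner_Integration.integral_cong) (auto simp: max_def algebra_simps)
    with 0 show ?thesis by (simp add: em)
  qed
  have "M 1 = M (- 1)"
  proof (rule measure_eqI_generator_eq[where \<Omega>=UNIV and E="range (\<lambda>(a, c). box a c)"
        and A="\<lambda>n. box (- real n *\<^sub>R One) (real n *\<^sub>R One)"])
    show "Int_stable (range (\<lambda>(a, c). box a c :: 'a set))"
      by (auto simp: Int_stable_def box_Int_box)
    show "sets (M 1) = sigma_sets UNIV (range (\<lambda>(a, c). box a c))"
      "sets (M (- 1)) = sigma_sets UNIV (range (\<lambda>(a, c). box a c))"
      by (simp_all add: M_def borel_eq_box)
    show "emeasure (M 1) X = emeasure (M (- 1)) X" if "X \<in> range (\<lambda>(a, c). box a c)" for X
      using that eq by auto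
    show "(\<Union>n. box (- real n *\<^sub>R One) (real n *\<^sub>R One :: 'a)) = UNIV"
      using UN_box_eq_UNIV by simp
  qed (auto simp: em)
  then have "AE x in lborel. ennreal (1 * V x) = ennreal (- 1 * V x)"
    unfolding M_def by (intro sigma_finite_measure.density_unique[OF sigma_finite_lborel]) auto
  then show ?thesis
  proof eventually_elim
    case (elim x)
    then show ?case by (cases "0 \<le> V x") (simp_all add: ennreal_neg)
  qed
qed

lemma indicator_mult_integrable:
  fixes W :: "'a::euclidean_space \<Rightarrow> real"
  assumes [measurable]: "W \<in> borel_measurable borel" "A \<in> sets borel"
    and W2: "integrable lborel (\<lambda>x. (W x)\<^sup>2)" and fin: "emeasure lborel A < \<infinity>"
  shows "integrable lborel (\<lambda>x. indicator A x * W x)"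
proof (rule square_integrable_mult)
  show "integrable lborel (\<lambda>x. (indicator A x :: real)\<^sup>2)"
    using fin by (simp add: power2_eq_square flip: indicator_inter_arith)
qed (use W2 in auto)

text \<open>Dominated convergence along the bumps of a box shows that \<open>W\<close> has integral zero over every box whose
  closure lies in \<open>S\<close>. Since boxes are closed under intersection, \<open>W\<close> vanishes almost everywhere on
  each such box, and countably many of them cover \<open>S\<close>.\<close>

theorem fundamental_lemma:
  fixes W :: "'a::euclidean_space \<Rightarrow> real"
  assumes S: "open S" and W [measurable]: "W \<in> borel_measurable borel"
    and W2: "integrable lborel (\<lambda>x. (W x)\<^sup>2)"
    and 0: "\<And>\<phi>. \<phi> \<in> test_functions S \<Longrightarrow> (LBINT x. W x * \<phi> x) = 0"
  shows "AE x in lborel. x \<in> S \<longrightarrow> W x = 0"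
proof -
  have int: "integrable lborel (\<lambda>x. indicator (box a c) x * W x)" for a c
    by (rule indicator_mult_integrable[OF W _ W2]) (auto simp flip: infinity_ennreal_def intro: emeasure_lborel_box_finite)
  have box0: "(LBINT x. indicator (box a c) x * W x) = 0" if "cbox a c \<subseteq> S" for a c
  proof -
    have "(\<lambda>n. LBINT x. W x * box_bump a c n x) \<longlonglongrightarrow> (LBINT x. indicator (box a c) x * W x)"
    proof (rule integral_dominated_convergence)
      show "integrable lborel (\<lambda>x. \<bar>indicator (box a c) x * W x\<bar>)" using int by (rule integrable_abs)
      show "AE x in lborel. (\<lambda>n. W x * box_bump a c n x) \<longlonglongrightarrow> indicator (box a c) x * W x"
        using box_bump_limit[of a c] by (auto intro!: tendsto_mult simp: mult.commute[of "indicator _ _"])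
      show "AE x in lborel. norm (W x * box_bump a c n x) \<le> \<bar>indicator (box a c) x * W x\<bar>" for n
      proof (rule AE_I2)
        fix x show "norm (W x * box_bump a c n x) \<le> \<bar>indicator (box a c) x * W x\<bar>"
          using box_bump_bounds[of a c n x] box_bump_eq_0[of x a c n]
          by (cases "x \<in> box a c") (auto simp: abs_mult intro: mult_left_le)
      qed
      show "(\<lambda>x. W x * box_bump a c n x) \<in> borel_measurable lborel" for n
        using test_function_borel[OF box_bump_test_function[OF that]] by simp
    qed simp
    moreover have "(LBINT x. W x * box_bump a c n x) = 0" for n
      using 0 box_bump_test_function[OF that] by blast
    ultimately show ?thesis by (simp add: LIMSEQ_const_iff)
  qed
  have AE_cbox: "AE x in lborel. x \<in> cbox p q \<longrightarrow> W x = 0" if pq: "cbox p q \<subseteq> S" for p q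
  proof -
    have "AE x in lborel. indicator (box p q) x * W x = 0"
    proof (rule AE_0_if_box_integrals_0[OF int])
      fix a c
      obtain a' c' where ac: "box a c \<inter> box p q = box a' c'" "cbox a' c' \<subseteq> cbox p q"
        by (rule that[of "\<Sum>i\<in>Basis. max (a \<bullet> i) (p \<bullet> i) *\<^sub>R i" "\<Sum>i\<in>Basis. min (c \<bullet> i) (q \<bullet> i) *\<^sub>R i"])
          (auto simp: box_Int_box mem_box)
      have "(LBINT x. indicator (box a c) x * (indicator (box p q) x * W x)) = (LBINT x. indicator (box a' c') x * W x)"
        unfolding ac(1)[symmetric] by (simp add: indicator_inter_arith mult.assoc)
      also have "\<dots> = 0" using ac(2) pq by (intro box0) auto
      finally show "(LBINT x. indicator (box a c) x * (indicator (box p q) x * W x)) = 0" .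
    qed
    moreover have "AE x in lborel. x \<notin> cbox p q - box p q"
    proof -
      have "cbox p q - box p q \<in> null_sets lebesgue"
        using negligible_frontier_interval[of p q] by (simp add: negligible_iff_null_sets)
      then show ?thesis using AE_not_in AE_completion_iff by blast
    qed
    ultimately show ?thesis by eventually_elim (auto simp: indicator_def split: if_splits)
  qed
  obtain \<D> where \<D>: "countable \<D>" "\<D> \<subseteq> Pow S" "\<And>X. X \<in> \<D> \<Longrightarrow> \<exists>a b. X = cbox a b" "\<Union>\<D> = S"
    using open_countable_Union_open_cbox[OF S] by metis
  have "AE x in lborel. \<forall>X\<in>\<D>. x \<in> X \<longrightarrow> W x = 0"
    using \<D> AE_cbox by (subst AE_ball_countable) (auto, metis PowD subsetD)
  then show ?thesis by eventually_elim (use \<D>(4) in blast)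
qed

lemma test_function_rep: "S \<in> sets borel \<Longrightarrow> \<phi> \<in> test_functions S \<Longrightarrow> borel_rep S \<phi> \<phi>"
  by (intro borel_rep_self test_function_borel test_function_eq_0)

lemma test_functions_subset_L2: "open S \<Longrightarrow> test_functions S \<subseteq> L2 S"
  by (metis borel_open borel_rep_L2_iff subsetI test_function_rep test_function_square_integrable)

text \<open>The fundamental lemma says that only null functions are orthogonal to all test functions.\<close>

theorem test_functions_dense_L2:
  assumes S: "open S" and u: "u \<in> L2 S" and \<epsilon>: "0 < \<epsilon>"
  obtains \<phi> where "\<phi> \<in> test_functions S" "L2_dist_sq S u \<phi> < \<epsilon>"
proof -
  interpret semi_hilbert "L2 S" "L2ip S" by (rule semi_hilbert_L2)
  have S': "S \<in> sets borel" using S by simp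
  show thesis
  proof (rule dense_if_orthogonal_trivial[OF _ _ _ _ u \<epsilon>])
    show "test_functions S \<subseteq> L2 S" using test_functions_subset_L2[OF S] .
    show "test_functions S \<noteq> {}" using zero_test_function by blast
    show "(\<lambda>x. a * v x + b * w x) \<in> test_functions S"
      if "v \<in> test_functions S" "w \<in> test_functions S" for v w a b
      using test_functions_lin that by blast
  next
    fix w assume w: "w \<in> L2 S" and orth: "\<And>\<phi>. \<phi> \<in> test_functions S \<Longrightarrow> L2ip S w \<phi> = 0"
    obtain W where W: "borel_rep S w W" "W \<in> borel_measurable borel" "\<And>x. x \<notin> S \<Longrightarrow> W x = 0"
      "integrable lborel (\<lambda>x. (W x)\<^sup>2)" using L2_rep[OF S' w] by blast
    have "AE x in lborel. x \<in> S \<longrightarrow> W x = 0"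
      using orth borel_rep_L2ip[OF S' W(1) test_function_rep[OF S']]
      by (intro fundamental_lemma[OF S W(2,4)]) auto
    then have "AE x in lborel. W x * W x = 0" by eventually_elim (use W(3) in auto)
    then show "L2ip S w w = 0"
      using borel_rep_L2ip[OF S' W(1) W(1)] by (simp add: integral_eq_zero_AE)
  qed (use that in blast)
qed

section \<open>Partial derivatives of test functions\<close>

lemma partial_eq_sum:
  assumes "\<phi> \<in> test_functions S"
  shows "partial t \<phi> x = (\<Sum>b\<in>Basis. (t \<bullet> b) * partial b \<phi> x)"
proof -
  have lin: "linear (frechet_derivative \<phi> (at x))"
    using test_function_has_derivative[OF assms] has_derivative_linear by blast
  have "partial t \<phi> x = frechet_derivative \<phi> (at x) (\<Sum>b\<in>Basis. (t \<bullet> b) *\<^sub>R b)"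
    by (simp add: euclidean_representation)
  also have "\<dots> = (\<Sum>b\<in>Basis. (t \<bullet> b) *\<^sub>R partial b \<phi> x)"
    by (simp add: linear_sum[OF lin] linear_cmul[OF lin])
  finally show ?thesis by simp
qed

lemma test_functions_sum:
  assumes "finite I" "\<And>i. i \<in> I \<Longrightarrow> f i \<in> test_functions S"
  shows "(\<lambda>x. \<Sum>i\<in>I. c i * f i x) \<in> test_functions S"
  using assms
proof (induction rule: finite_induct)
  case empty
  then show ?case using zero_test_function by simp
next
  case (insert i I)
  then show ?case using test_functions_lin[of "f i" S "\<lambda>x. \<Sum>i\<in>I. c i * f i x" "c i" 1] by simp
qed

lemma partial_test_function:
  assumes \<phi>: "\<phi> \<in> test_functions S"
  shows "partial t \<phi> \<in> test_functions S"
proof -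
  have "partial b \<phi> \<in> test_functions S" if b: "b \<in> Basis" for b
  proof -
    let ?A = "closure {x. \<phi> x \<noteq> 0}"
    have "partial b \<phi> x = 0" if "x \<notin> ?A" for x
    proof -
      have "(\<phi> has_derivative (\<lambda>h. 0)) (at x)"
      proof (rule has_derivative_transform_within_open[where f="\<lambda>_. 0" and s="- ?A"])
        show "\<And>y. y \<in> - ?A \<Longrightarrow> 0 = \<phi> y" using closure_subset[of "{x. \<phi> x \<noteq> 0}"] by auto
      qed (use that in auto)
      then show ?thesis by (rule partial_eqI)
    qed
    then have "closure {x. partial b \<phi> x \<noteq> 0} \<subseteq> ?A" by (intro closure_minimal) auto
    moreover from this have "compact (closure {x. partial b \<phi> x \<noteq> 0})"
      using \<phi> by (metis (mono_tags, lifting) bounded_subset closed_closure compact_eq_bounded_closed mem_Collect_eq test_functions_def)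
    moreover have "C_k k (partial b \<phi>)" for k
      using \<phi> b C_k.simps(2)[of k \<phi>] unfolding test_functions_def by blast
    ultimately show ?thesis using \<phi> by (auto simp: test_functions_def)
  qed
  then have "(\<lambda>x. \<Sum>b\<in>Basis. (t \<bullet> b) * partial b \<phi> x) \<in> test_functions S"
    by (intro test_functions_sum) auto
  moreover have "partial t \<phi> = (\<lambda>x. \<Sum>b\<in>Basis. (t \<bullet> b) * partial b \<phi> x)"
    by (rule ext) (rule partial_eq_sum[OF \<phi>])
  ultimately show ?thesis by (simp only:)
qed

section \<open>Weak derivatives of square integrable functions\<close>

lemma L2_imp_L1_loc:
  fixes u :: "'a::euclidean_space \<Rightarrow> real"
  assumes S: "open S" and u: "u \<in> L2 S"
  shows "u \<in> L1_loc S"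
  unfolding L1_loc_def
proof (intro CollectI allI impI)
  fix K assume K: "compact K \<and> K \<subseteq> S"
  then have KS: "K \<in> sets borel" by (simp add: compact_imp_closed)
  obtain U where U: "borel_rep S u U" "U \<in> borel_measurable borel"
    "\<And>x. x \<notin> S \<Longrightarrow> U x = 0" "integrable lborel (\<lambda>x. (U x)\<^sup>2)"
    by (rule L2_rep[OF borel_open[OF S] u]) (rule that)
  have "borel_rep K u (\<lambda>x. indicator K x * U x)"
    unfolding borel_rep_def
  proof (intro conjI)
    show "(\<lambda>x. indicator K x * U x) \<in> borel_measurable borel" using U(2) KS by simp
    have "AE x in lborel. x \<in> S \<longrightarrow> u x = U x" using U(1) by (simp add: borel_rep_def)
    then show "AE x in lborel. x \<in> K \<longrightarrow> u x = indicator K x * U x"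
      by eventually_elim (use K in auto)
  qed simp
  moreover have "integrable lborel (\<lambda>x. indicator K x * U x)"
    using K emeasure_compact_finite[of K] by (intro indicator_mult_integrable U KS) auto
  ultimately show "integrable (lebesgue_on K) u" using borel_rep_integrable_iff[OF KS] by blast
qed

lemma weak_partial_L2_iff:
  assumes "open S" "u \<in> L2 S" "g \<in> L2 S"
  shows "weak_partial S b u g \<longleftrightarrow>
    (\<forall>\<phi>\<in>test_functions S. L2ip S u (partial b \<phi>) = - L2ip S g \<phi>)"
  using L2_imp_L1_loc[OF assms(1,2)] L2_imp_L1_loc[OF assms(1,3)] by (simp add: weak_partial_def L2ip_def)

lemma weak_partial_lin:
  assumes S: "open S" and L2: "u \<in> L2 S" "v \<in> L2 S" "g \<in> L2 S" "k \<in> L2 S"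
    and "weak_partial S b u g" "weak_partial S b v k"
  shows "weak_partial S b (\<lambda>x. \<alpha> * u x + \<beta> * v x) (\<lambda>x. \<alpha> * g x + \<beta> * k x)"
proof -
  interpret semi_hilbert "L2 S" "L2ip S" by (rule semi_hilbert_L2)
  have test: "\<phi> \<in> L2 S" if "\<phi> \<in> test_functions S" for \<phi> using that test_functions_subset_L2[OF S] by blast
  have "L2ip S (\<lambda>x. \<alpha> * u x + \<beta> * v x) (partial b \<phi>) = - L2ip S (\<lambda>x. \<alpha> * g x + \<beta> * k x) \<phi>"
    if \<phi>: "\<phi> \<in> test_functions S" for \<phi>
  proof -
    have "L2ip S u (partial b \<phi>) = - L2ip S g \<phi>" "L2ip S v (partial b \<phi>) = - L2ip S k \<phi>"
      using assms \<phi> by (simp_all add: weak_partial_L2_iff)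
    then show ?thesis
      using ip_lin[OF L2(1,2) test[OF partial_test_function[OF \<phi>]]] ip_lin[OF L2(3,4) test[OF \<phi>]] by simp
  qed
  then show ?thesis using weak_partial_L2_iff[OF S lin[OF L2(1,2)] lin[OF L2(3,4)]] by simp
qed

text \<open>The difference of two weak derivatives pairs to zero with all test functions, which are dense.\<close>

lemma weak_partial_unique:
  assumes S: "open S" and L2: "u \<in> L2 S" "g \<in> L2 S" "k \<in> L2 S"
    and "weak_partial S b u g" "weak_partial S b u k"
  shows "L2_dist_sq S g k = 0"
proof -
  interpret semi_hilbert "L2 S" "L2ip S" by (rule semi_hilbert_L2)
  have test: "\<phi> \<in> L2 S" if "\<phi> \<in> test_functions S" for \<phi> using that test_functions_subset_L2[OF S] by blast
  have "L2ip S g \<phi> = L2ip S k \<phi>" if "\<phi> \<in> test_functions S" for \<phi>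
    using assms that by (simp add: weak_partial_L2_iff)
  then have "L2ip S (\<lambda>x. g x - k x) \<phi> \<le> 0 * sqrt (L2ip S \<phi> \<phi>)" if "\<phi> \<in> test_functions S" for \<phi>
    using ip_diff_left[OF L2(2,3) test[OF that]] that by simp
  then have "L2_dist_sq S g k \<le> 0\<^sup>2"
    using test_functions_dense_L2[OF S diff_in[OF L2(2,3)]]
    by (intro dual_norm_bound[OF diff_in[OF L2(2,3)] test_functions_subset_L2[OF S]]) (metis, auto)
  then show ?thesis using ip_ge0[OF diff_in[OF L2(2,3)]] by simp
qed

text \<open>Both sides of the defining identity are continuous in \<open>L\<^sup>2\<close>, for each test function separately.\<close>

lemma weak_partial_closed:
  assumes S: "open S" and L2: "\<And>n. u n \<in> L2 S" "\<And>n. g n \<in> L2 S" "v \<in> L2 S" "k \<in> L2 S"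
    and wp: "\<And>n. weak_partial S b (u n) (g n)"
    and lim: "(\<lambda>n. L2_dist_sq S (u n) v) \<longlonglongrightarrow> 0"
      "(\<lambda>n. L2_dist_sq S (g n) k) \<longlonglongrightarrow> 0"
  shows "weak_partial S b v k"
proof -
  interpret semi_hilbert "L2 S" "L2ip S" by (rule semi_hilbert_L2)
  have "L2ip S v (partial b \<phi>) = - L2ip S k \<phi>" if \<phi>: "\<phi> \<in> test_functions S" for \<phi>
  proof -
    have test: "\<phi> \<in> L2 S" "partial b \<phi> \<in> L2 S"
      using \<phi> partial_test_function[OF \<phi>] test_functions_subset_L2[OF S] by blast+
    have eq: "L2ip S (u n) (partial b \<phi>) = - L2ip S (g n) \<phi>" for n
      using wp[of n] \<phi> weak_partial_L2_iff[OF S L2(1)[of n] L2(2)[of n]] by simp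
    show ?thesis
      using tendsto_ip_left[OF L2(1,3) test(2) lim(1)] tendsto_minus[OF tendsto_ip_left[OF L2(2,4) test(1) lim(2)]]
      unfolding eq by (rule LIMSEQ_unique)
  qed
  then show ?thesis using weak_partial_L2_iff[OF S L2(3,4)] by simp
qed

section \<open>The space H1\<close>

lemma H1_imp_L2: "u \<in> H1 S \<Longrightarrow> u \<in> L2 S" by (simp add: H1_def)

lemma H1_wpartial:
  assumes "u \<in> H1 S" "b \<in> Basis"
  shows "wpartial S b u \<in> L2 S" "weak_partial S b u (wpartial S b u)"
proof -
  obtain g where "g \<in> L2 S \<and> weak_partial S b u g" using assms by (auto simp: H1_def)
  then have "wpartial S b u \<in> L2 S \<and> weak_partial S b u (wpartial S b u)"
    unfolding wpartial_def by (rule someI[of "\<lambda>g. g \<in> L2 S \<and> weak_partial S b u g"])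
  then show "wpartial S b u \<in> L2 S" "weak_partial S b u (wpartial S b u)" by auto
qed

lemma H1_lin:
  assumes S: "open S" and uv: "u \<in> H1 S" "v \<in> H1 S"
  shows "(\<lambda>x. \<alpha> * u x + \<beta> * v x) \<in> H1 S"
proof -
  interpret semi_hilbert "L2 S" "L2ip S" by (rule semi_hilbert_L2)
  have "\<exists>g\<in>L2 S. weak_partial S b (\<lambda>x. \<alpha> * u x + \<beta> * v x) g" if "b \<in> Basis" for b
    using weak_partial_lin[OF S H1_imp_L2[OF uv(1)] H1_imp_L2[OF uv(2)]
        H1_wpartial(1)[OF uv(1) that] H1_wpartial(1)[OF uv(2) that]
        H1_wpartial(2)[OF uv(1) that] H1_wpartial(2)[OF uv(2) that]]
      lin[OF H1_wpartial(1)[OF uv(1) that] H1_wpartial(1)[OF uv(2) that]] by blast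
  then show ?thesis using lin[OF H1_imp_L2[OF uv(1)] H1_imp_L2[OF uv(2)]] by (simp add: H1_def)
qed

definition H1ip :: "'a::euclidean_space set \<Rightarrow> ('a \<Rightarrow> real) \<Rightarrow> ('a \<Rightarrow> real) \<Rightarrow> real" where
  "H1ip S u v = L2ip S u v + (\<Sum>b\<in>Basis. L2ip S (wpartial S b u) (wpartial S b v))"

abbreviation H1_dist_sq :: "'a::euclidean_space set \<Rightarrow> ('a \<Rightarrow> real) \<Rightarrow> ('a \<Rightarrow> real) \<Rightarrow> real" where
  "H1_dist_sq S u v \<equiv> H1ip S (\<lambda>x. u x - v x) (\<lambda>x. u x - v x)"

lemma L2ip_self_ge0: "0 \<le> L2ip S u u" by (simp add: L2ip_def)

lemma H1norm_eq: "H1norm S u = sqrt (H1ip S u u)"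
  by (simp add: H1norm_def H1ip_def L2norm_eq L2ip_self_ge0)

lemma wpartial_unique:
  assumes "open S" "u \<in> H1 S" "b \<in> Basis" "g \<in> L2 S" "weak_partial S b u g"
  shows "L2_dist_sq S (wpartial S b u) g = 0"
  using assms H1_wpartial[OF assms(2,3)] H1_imp_L2[OF assms(2)] by (intro weak_partial_unique) auto

text \<open>The chosen representative of a weak derivative depends on the function in an arbitrary way, so
  linearity holds only after pairing.\<close>

lemma L2ip_wpartial_lin:
  assumes S: "open S" and uv: "u \<in> H1 S" "v \<in> H1 S" and b: "b \<in> Basis" and w: "w \<in> L2 S"
  shows "L2ip S (wpartial S b (\<lambda>x. \<alpha> * u x + \<beta> * v x)) w
    = \<alpha> * L2ip S (wpartial S b u) w + \<beta> * L2ip S (wpartial S b v) w"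
proof -
  interpret semi_hilbert "L2 S" "L2ip S" by (rule semi_hilbert_L2)
  note wp = H1_wpartial[OF uv(1) b] H1_wpartial[OF uv(2) b]
  have "L2ip S (wpartial S b (\<lambda>x. \<alpha> * u x + \<beta> * v x)) w
      = L2ip S (\<lambda>x. \<alpha> * wpartial S b u x + \<beta> * wpartial S b v x) w"
    by (intro ip_cong_null H1_wpartial(1)[OF H1_lin[OF S uv] b] lin[OF wp(1,3)] w
        wpartial_unique[OF S H1_lin[OF S uv] b] weak_partial_lin[OF S _ _ wp(1,3,2,4)] H1_imp_L2 uv)
  then show ?thesis using ip_lin[OF wp(1,3) w] by simp
qed

lemma L2ip_wpartial_diff_self:
  assumes S: "open S" and uv: "u \<in> H1 S" "v \<in> H1 S" and b: "b \<in> Basis"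
  shows "L2ip S (wpartial S b (\<lambda>x. u x - v x)) (wpartial S b (\<lambda>x. u x - v x))
    = L2_dist_sq S (wpartial S b u) (wpartial S b v)"
proof -
  interpret semi_hilbert "L2 S" "L2ip S" by (rule semi_hilbert_L2)
  note wp = H1_wpartial(1)[OF uv(1) b] H1_wpartial(1)[OF uv(2) b]
  let ?d = "wpartial S b (\<lambda>x. u x - v x)" and ?e = "\<lambda>x. wpartial S b u x - wpartial S b v x"
  have H: "(\<lambda>x. u x - v x) \<in> H1 S" using H1_lin[OF S uv, of 1 "-1"] by simp
  have d: "?d \<in> L2 S" using H1_wpartial(1)[OF H b] .
  have e: "?e \<in> L2 S" using diff_in[OF wp] .
  have "L2ip S ?d w = L2ip S ?e w" if "w \<in> L2 S" for w
    using L2ip_wpartial_lin[OF S uv b that, of 1 "-1"] ip_diff_left[OF wp that] by simp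
  from this[OF d] this[OF e] show ?thesis using ip_sym[OF d e] by simp
qed

text \<open>A Cauchy sequence and its weak derivatives converge in \<open>L\<^sup>2\<close>, and weak differentiation is a closed
  operation.\<close>

theorem semi_hilbert_H1:
  fixes S :: "'a::euclidean_space set"
  assumes S: "open S"
  shows "semi_hilbert (H1 S) (H1ip S)"
proof -
  interpret L2: semi_hilbert "L2 S" "L2ip S" by (rule semi_hilbert_L2)
  show ?thesis
  proof
    have "(\<lambda>_. 0) \<in> H1 S"
    proof -
      have 0: "(\<lambda>_. 0 :: real) \<in> L2 S" by (simp add: L2_iff)
      have "weak_partial S b (\<lambda>_. 0) (\<lambda>_. 0)" for b
        by (simp add: weak_partial_L2_iff[OF S 0 0] L2ip_def)
      with 0 show ?thesis by (auto simp: H1_def)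
    qed
    then show "H1 S \<noteq> {}" by blast
    show "(\<lambda>x. a * u x + b * v x) \<in> H1 S" if "u \<in> H1 S" "v \<in> H1 S" for u v a b
      using H1_lin[OF S that] .
    show "H1ip S (\<lambda>x. a * u x + b * v x) w = a * H1ip S u w + b * H1ip S v w"
      if "u \<in> H1 S" "v \<in> H1 S" "w \<in> H1 S" for u v w a b
    proof -
      have "L2ip S (wpartial S c (\<lambda>x. a * u x + b * v x)) (wpartial S c w)
        = a * L2ip S (wpartial S c u) (wpartial S c w) + b * L2ip S (wpartial S c v) (wpartial S c w)"
        if "c \<in> Basis" for c
        using L2ip_wpartial_lin[OF S \<open>u \<in> H1 S\<close> \<open>v \<in> H1 S\<close> that H1_wpartial(1)[OF \<open>w \<in> H1 S\<close> that]] .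
      then show ?thesis
        using L2.ip_lin[OF that[THEN H1_imp_L2]]
        by (simp add: H1ip_def sum.distrib sum_distrib_left algebra_simps)
    qed
    show "H1ip S u v = H1ip S v u" if "u \<in> H1 S" "v \<in> H1 S" for u v
      by (simp add: H1ip_def L2ip_def mult.commute)
    show "0 \<le> H1ip S u u" for u
      by (simp add: H1ip_def L2ip_self_ge0 sum_nonneg add_nonneg_nonneg)
  next
    fix s :: "nat \<Rightarrow> 'a \<Rightarrow> real"
    assume s: "\<And>n. s n \<in> H1 S" and Cauchy: "\<And>\<epsilon>. 0 < \<epsilon> \<Longrightarrow> \<exists>N. \<forall>m\<ge>N. \<forall>n\<ge>N.
      H1_dist_sq S (s m) (s n) < \<epsilon>"
    have le: "L2_dist_sq S (s m) (s n) \<le> H1_dist_sq S (s m) (s n)" for m n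
      by (simp add: H1ip_def sum_nonneg L2ip_self_ge0)
    have leb: "L2_dist_sq S (wpartial S b (s m)) (wpartial S b (s n))
        \<le> H1_dist_sq S (s m) (s n)" if b: "b \<in> Basis" for b m n
    proof -
      have "L2ip S (wpartial S b (\<lambda>x. s m x - s n x)) (wpartial S b (\<lambda>x. s m x - s n x))
          \<le> (\<Sum>b\<in>Basis. L2ip S (wpartial S b (\<lambda>x. s m x - s n x)) (wpartial S b (\<lambda>x. s m x - s n x)))"
        by (rule member_le_sum) (use b in \<open>auto simp: L2ip_self_ge0\<close>)
      also have "\<dots> \<le> H1_dist_sq S (s m) (s n)"
        by (simp add: H1ip_def L2ip_self_ge0)
      finally show ?thesis unfolding L2ip_wpartial_diff_self[OF S s s b] .
    qed
    have "\<exists>N. \<forall>m\<ge>N. \<forall>n\<ge>N. L2_dist_sq S (s m) (s n) < \<epsilon>" if "0 < \<epsilon>" for \<epsilon>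
      using Cauchy[OF that] le by (meson le_less_trans)
    then obtain l where l: "l \<in> L2 S" and llim: "(\<lambda>n. L2_dist_sq S (s n) l) \<longlonglongrightarrow> 0"
      using L2.complete[of s] H1_imp_L2[OF s] by blast
    define P where "P b k \<longleftrightarrow> k \<in> L2 S \<and>
        (\<lambda>n. L2_dist_sq S (wpartial S b (s n)) k) \<longlonglongrightarrow> 0" for b k
    have "\<exists>k. P b k" if b: "b \<in> Basis" for b
    proof -
      have "\<exists>N. \<forall>m\<ge>N. \<forall>n\<ge>N. L2_dist_sq S (wpartial S b (s m)) (wpartial S b (s n)) < \<epsilon>" if "0 < \<epsilon>" for \<epsilon>
        using Cauchy[OF that] leb[OF b] by (meson le_less_trans)
      from L2.complete[OF H1_wpartial(1)[OF s b] this] show ?thesis by (auto simp: P_def)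
    qed
    then obtain k where Pk: "\<And>b. b \<in> Basis \<Longrightarrow> P b (k b)" by metis
    then have k: "\<And>b. b \<in> Basis \<Longrightarrow> k b \<in> L2 S"
      and klim: "\<And>b. b \<in> Basis \<Longrightarrow> (\<lambda>n. L2_dist_sq S (wpartial S b (s n)) (k b)) \<longlonglongrightarrow> 0"
      by (simp_all add: P_def)
    have wp: "weak_partial S b l (k b)" if b: "b \<in> Basis" for b
      using weak_partial_closed[OF S H1_imp_L2[OF s] H1_wpartial(1)[OF s b] l k[OF b] H1_wpartial(2)[OF s b] llim klim[OF b]] .
    then have lH: "l \<in> H1 S" using l k by (auto simp: H1_def)
    have "L2ip S (wpartial S b (\<lambda>x. s n x - l x)) (wpartial S b (\<lambda>x. s n x - l x))
       = L2_dist_sq S (wpartial S b (s n)) (k b)" if b: "b \<in> Basis" for b n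
    proof -
      have eq: "L2ip S (wpartial S b l) w = L2ip S (k b) w" if "w \<in> L2 S" for w
        using L2.ip_cong_null[OF H1_wpartial(1)[OF lH b] k[OF b] that wpartial_unique[OF S lH b k[OF b] wp[OF b]]] .
      note wl = H1_wpartial(1)[OF lH b] and ws = H1_wpartial(1)[OF s[of n] b]
      show ?thesis
        unfolding L2ip_wpartial_diff_self[OF S s lH b] L2.ip_diff_self[OF ws wl] L2.ip_diff_self[OF ws k[OF b]]
        using eq[OF ws] eq[OF wl] eq[OF k[OF b]] L2.ip_sym[OF ws wl] L2.ip_sym[OF ws k[OF b]] L2.ip_sym[OF wl k[OF b]]
        by simp
    qed
    then have "H1_dist_sq S (s n) l = L2_dist_sq S (s n) l
        + (\<Sum>b\<in>Basis. L2_dist_sq S (wpartial S b (s n)) (k b))" for n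
      by (simp add: H1ip_def)
    moreover have "(\<lambda>n. L2_dist_sq S (s n) l
        + (\<Sum>b\<in>Basis. L2_dist_sq S (wpartial S b (s n)) (k b)))
       \<longlonglongrightarrow> 0 + (\<Sum>b\<in>(Basis :: 'a set). 0)"
      by (intro tendsto_add llim tendsto_sum klim)
    ultimately have "(\<lambda>n. H1_dist_sq S (s n) l) \<longlonglongrightarrow> 0" by simp
    with lH show "\<exists>l\<in>H1 S. (\<lambda>n. H1_dist_sq S (s n) l) \<longlonglongrightarrow> 0" by blast
  qed
qed

section \<open>Translations\<close>

lemma lborel_integral_translate:
  fixes f :: "'a::euclidean_space \<Rightarrow> real"
  shows "(LBINT x. f (x + t)) = (LBINT x. f x)"
    "integrable lborel (\<lambda>x. f (x + t)) \<longleftrightarrow> integrable lborel f"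
proof -
  have *: "(LBINT x. f (x + t)) = (LBINT x. f x) \<and>
      (integrable lborel (\<lambda>x. f (x + t)) \<longleftrightarrow> integrable lborel f)"
    if "f \<in> borel_measurable borel" for f :: "'a \<Rightarrow> real" and t
  proof -
    have "(LBINT x. f x) = (\<integral>x. f x \<partial>distr lborel borel ((+) t))" by (simp add: lborel_distr_plus)
    also have "\<dots> = (LBINT x. f (t + x))" using that by (subst integral_distr) auto
    finally have 1: "(LBINT x. f (x + t)) = (LBINT x. f x)" by (simp add: add.commute)
    have "integrable lborel f \<longleftrightarrow> integrable (distr lborel borel ((+) t)) f" by (simp add: lborel_distr_plus)
    also have "\<dots> \<longleftrightarrow> integrable lborel (\<lambda>x. f (t + x))" using that by (subst integrable_distr_eq) auto
    finally show ?thesis using 1 by (simp add: add.commute)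
  qed
  have meas: "f \<in> borel_measurable borel" if "(\<lambda>x. f (x + t)) \<in> borel_measurable borel"
  proof -
    have "(\<lambda>x. f ((x - t) + t)) \<in> borel_measurable borel"
      using measurable_compose[of "\<lambda>x. x - t" borel borel "\<lambda>x. f (x + t)" borel] that by simp
    then show ?thesis by simp
  qed
  show iff: "integrable lborel (\<lambda>x. f (x + t)) \<longleftrightarrow> integrable lborel f"
  proof (cases "f \<in> borel_measurable borel")
    case False
    have "g \<in> borel_measurable borel" if "integrable lborel g" for g :: "'a \<Rightarrow> real"
      using borel_measurable_integrable[OF that] by simp
    with False meas show ?thesis by blast
  qed (use * in blast)
  show "(LBINT x. f (x + t)) = (LBINT x. f x)"
  proof (cases "integrable lborel f")
    case True
    then have "f \<in> borel_measurable borel" by (auto dest: borel_measurable_integrable)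
    then show ?thesis using * by blast
  qed (use iff in \<open>simp add: not_integrable_integral_eq\<close>)
qed

text \<open>The complement is the sum of the closed set \<open>- S\<close> and a compact segment.\<close>

lemma segment_set_open:
  fixes S :: "'a::euclidean_space set"
  assumes "open S"
  shows "open {x. \<forall>c\<in>{0..1::real}. x + c *\<^sub>R t \<in> S}"
proof -
  have "compact ((\<lambda>c. - (c *\<^sub>R t)) ` {0..1::real})"
    by (intro compact_continuous_image continuous_intros) auto
  then have "closed (\<Union>x\<in>- S. \<Union>y\<in>(\<lambda>c. - (c *\<^sub>R t)) ` {0..1::real}. {x + y})"
    using assms by (intro closed_compact_sums) auto
  moreover have "(\<Union>x\<in>- S. \<Union>y\<in>(\<lambda>c. - (c *\<^sub>R t)) ` {0..1::real}. {x + y}) = - {x. \<forall>c\<in>{0..1}. x + c *\<^sub>R t \<in> S}"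
  proof (intro equalityI subsetI)
    fix z assume "z \<in> - {x. \<forall>c\<in>{0..1}. x + c *\<^sub>R t \<in> S}"
    then obtain c :: real where c: "c \<in> {0..1}" "z + c *\<^sub>R t \<notin> S" by auto
    then have "z \<in> {(z + c *\<^sub>R t) + - (c *\<^sub>R t)}" by simp
    with c show "z \<in> (\<Union>x\<in>- S. \<Union>y\<in>(\<lambda>c. - (c *\<^sub>R t)) ` {0..1::real}. {x + y})" by blast
  next
    fix z assume "z \<in> (\<Union>x\<in>- S. \<Union>y\<in>(\<lambda>c. - (c *\<^sub>R t)) ` {0..1::real}. {x + y})"
    then obtain a and c :: real where "a \<notin> S" "c \<in> {0..1}" "z = a + - (c *\<^sub>R t)" by auto
    then have "\<exists>c\<in>{0..1}. z + c *\<^sub>R t \<notin> S" by (intro bexI[of _ c]) simp_all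
    then show "z \<in> - {x. \<forall>c\<in>{0..1}. x + c *\<^sub>R t \<in> S}" by blast
  qed
  ultimately show ?thesis by (simp add: open_closed)
qed

lemma test_function_translate:
  fixes S :: "'a::euclidean_space set"
  assumes \<phi>: "\<phi> \<in> test_functions A" and A: "\<And>x. x \<in> A \<Longrightarrow> x + t \<in> S"
  shows "(\<lambda>x. \<phi> (x - t)) \<in> test_functions S"
proof -
  let ?A = "closure {x. \<phi> x \<noteq> 0}"
  have cpt: "compact ((+) t ` ?A)" using \<phi> by (simp add: test_functions_def compact_translation)
  have "{x. \<phi> (x - t) \<noteq> 0} \<subseteq> (+) t ` ?A"
  proof
    fix x assume "x \<in> {x. \<phi> (x - t) \<noteq> 0}"
    then have "x - t \<in> ?A" using closure_subset by fastforce
    then show "x \<in> (+) t ` ?A" by (intro image_eqI[of _ _ "x - t"]) auto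
  qed
  then have C: "closure {x. \<phi> (x - t) \<noteq> 0} \<subseteq> (+) t ` ?A"
    by (rule closure_minimal) (rule compact_imp_closed[OF cpt])
  moreover from this have "compact (closure {x. \<phi> (x - t) \<noteq> 0})"
    using cpt by (metis bounded_subset closed_closure compact_eq_bounded_closed)
  moreover have "(+) t ` ?A \<subseteq> S" using \<phi> A by (auto simp: test_functions_def add.commute)
  moreover have "C_k k (\<lambda>x. \<phi> (x + - t))" for k
    using \<phi> by (intro C_k_translate) (simp add: test_functions_def)
  ultimately show ?thesis by (auto simp: test_functions_def)
qed

lemma test_function_line_derivative:
  assumes \<phi>: "\<phi> \<in> test_functions A"
  shows "((\<lambda>s. \<phi> (y - s *\<^sub>R t)) has_real_derivative - partial t \<phi> (y - s *\<^sub>R t)) (at s)"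
proof -
  let ?D = "frechet_derivative \<phi> (at (y - s *\<^sub>R t))"
  have D: "(\<phi> has_derivative ?D) (at (y - s *\<^sub>R t))"
    using test_function_has_derivative[OF \<phi>] .
  have "((\<lambda>s. y - s *\<^sub>R t) has_derivative (\<lambda>h. - (h *\<^sub>R t))) (at s)"
    by (auto intro!: derivative_eq_intros)
  then have "((\<lambda>s. \<phi> (y - s *\<^sub>R t)) has_derivative (\<lambda>h. ?D (- (h *\<^sub>R t)))) (at s)"
    using D by (rule has_derivative_compose)
  moreover have "(\<lambda>h. ?D (- (h *\<^sub>R t))) = (*) (- ?D t)"
    using linear_neg[OF has_derivative_linear[OF D]] linear_cmul[OF has_derivative_linear[OF D]]
    by (intro ext) simp
  ultimately show ?thesis unfolding has_field_derivative_def by (simp only:)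
qed

lemma partial_translate:
  assumes \<phi>: "\<phi> \<in> test_functions A"
  shows "partial t (\<lambda>x. \<phi> (x - c)) y = partial t \<phi> (y - c)"
proof (rule partial_eqI)
  have "((\<lambda>x. x - c) has_derivative (\<lambda>h. h)) (at y)" by (auto intro!: derivative_eq_intros)
  then show "((\<lambda>x. \<phi> (x - c)) has_derivative frechet_derivative \<phi> (at (y - c))) (at y)"
    using test_function_has_derivative[OF \<phi>] by (rule has_derivative_compose)
qed

text \<open>Difference quotients of \<open>\<phi>\<close> along a line are bounded by the supremum of its directional
  derivative, which allows dominated convergence.\<close>

lemma convolution_derivative:
  fixes U :: "'a::euclidean_space \<Rightarrow> real"
  assumes U: "integrable lborel U" and \<phi>: "\<phi> \<in> test_functions A"
  shows "((\<lambda>s. LBINT y. U y * \<phi> (y - s *\<^sub>R t)) has_real_derivative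
     - (LBINT y. U y * partial t \<phi> (y - s *\<^sub>R t))) (at s)"
proof -
  have [measurable]: "U \<in> borel_measurable borel" using U by auto
  have [measurable]: "\<phi> \<in> borel_measurable borel" using test_function_borel[OF \<phi>] .
  have [measurable]: "partial t \<phi> \<in> borel_measurable borel"
    using test_function_borel[OF partial_test_function[OF \<phi>]] .
  obtain M where M: "\<And>x. \<bar>\<phi> x\<bar> \<le> M" using test_function_bounded[OF \<phi>] by blast
  obtain L where L: "\<And>x. \<bar>partial t \<phi> x\<bar> \<le> L"
    using test_function_bounded[OF partial_test_function[OF \<phi>]] by blast
  have lip: "\<bar>\<phi> (y - s' *\<^sub>R t) - \<phi> (y - s *\<^sub>R t)\<bar> \<le> L * \<bar>s' - s\<bar>" for y s' s
    using field_differentiable_bound[of UNIV "\<lambda>s. \<phi> (y - s *\<^sub>R t)" "\<lambda>s. - partial t \<phi> (y - s *\<^sub>R t)" L s' s]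
      test_function_line_derivative[OF \<phi>] L by simp
  have int: "integrable lborel (\<lambda>y. U y * \<phi> (y - s *\<^sub>R t))" for s
  proof (rule Bochner_Integration.integrable_bound)
    show "integrable lborel (\<lambda>y. M * U y)" using U by simp
    have "0 \<le> M" using M[of 0] by linarith
    then show "AE y in lborel. norm (U y * \<phi> (y - s *\<^sub>R t)) \<le> norm (M * U y)"
      using M by (auto simp: abs_mult intro!: AE_I2 mult_right_mono simp: mult.commute[of "\<bar>U _\<bar>"])
  qed simp
  have "((\<lambda>s'. ((LBINT y. U y * \<phi> (y - s' *\<^sub>R t)) - (LBINT y. U y * \<phi> (y - s *\<^sub>R t))) / (s' - s))
      \<longlongrightarrow> (LBINT y. U y * (- partial t \<phi> (y - s *\<^sub>R t)))) (at s)"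
    unfolding tendsto_at_iff_sequentially
  proof (intro allI impI)
    fix X :: "nat \<Rightarrow> real" assume X: "\<forall>i. X i \<in> UNIV - {s}" "X \<longlonglongrightarrow> s"
    have "(\<lambda>i. LBINT y. U y * ((\<phi> (y - X i *\<^sub>R t) - \<phi> (y - s *\<^sub>R t)) / (X i - s)))
       \<longlonglongrightarrow> (LBINT y. U y * (- partial t \<phi> (y - s *\<^sub>R t)))"
    proof (rule integral_dominated_convergence)
      show "integrable lborel (\<lambda>y. L * \<bar>U y\<bar>)" using U by simp
      show "AE y in lborel. (\<lambda>i. U y * ((\<phi> (y - X i *\<^sub>R t) - \<phi> (y - s *\<^sub>R t)) / (X i - s)))
          \<longlonglongrightarrow> U y * (- partial t \<phi> (y - s *\<^sub>R t))"
      proof (intro AE_I2 tendsto_mult tendsto_const)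
        fix y
        have "((\<lambda>s'. (\<phi> (y - s' *\<^sub>R t) - \<phi> (y - s *\<^sub>R t)) / (s' - s)) \<longlongrightarrow> - partial t \<phi> (y - s *\<^sub>R t)) (at s)"
          using test_function_line_derivative[OF \<phi>, of y t s] by (simp add: has_field_derivative_iff)
        then show "(\<lambda>i. (\<phi> (y - X i *\<^sub>R t) - \<phi> (y - s *\<^sub>R t)) / (X i - s)) \<longlonglongrightarrow> - partial t \<phi> (y - s *\<^sub>R t)"
          using X unfolding tendsto_at_iff_sequentially comp_def by blast
      qed
      show "AE y in lborel. norm (U y * ((\<phi> (y - X i *\<^sub>R t) - \<phi> (y - s *\<^sub>R t)) / (X i - s))) \<le> L * \<bar>U y\<bar>" for i
      proof (rule AE_I2)
        fix y
        have "\<bar>X i - s\<bar> > 0" using X(1) by auto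
        then have "\<bar>(\<phi> (y - X i *\<^sub>R t) - \<phi> (y - s *\<^sub>R t)) / (X i - s)\<bar> \<le> L"
          using lip[of y "X i" s] by (simp add: abs_divide divide_le_eq)
        then show "norm (U y * ((\<phi> (y - X i *\<^sub>R t) - \<phi> (y - s *\<^sub>R t)) / (X i - s))) \<le> L * \<bar>U y\<bar>"
          by (simp only: real_norm_def abs_mult mult.commute[of "\<bar>U y\<bar>"] mult_right_mono abs_ge_zero)
      qed
    qed auto
    moreover have "(LBINT y. U y * ((\<phi> (y - X i *\<^sub>R t) - \<phi> (y - s *\<^sub>R t)) / (X i - s)))
       = ((LBINT y. U y * \<phi> (y - X i *\<^sub>R t)) - (LBINT y. U y * \<phi> (y - s *\<^sub>R t))) / (X i - s)" for i
    proof -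
      have "(LBINT y. U y * ((\<phi> (y - X i *\<^sub>R t) - \<phi> (y - s *\<^sub>R t)) / (X i - s)))
        = (LBINT y. (U y * \<phi> (y - X i *\<^sub>R t) - U y * \<phi> (y - s *\<^sub>R t)) / (X i - s))"
        by (simp add: right_diff_distrib)
      also have "\<dots> = (LBINT y. U y * \<phi> (y - X i *\<^sub>R t) - U y * \<phi> (y - s *\<^sub>R t)) / (X i - s)"
        by (rule integral_divide_zero)
      finally show ?thesis by (simp only: Bochner_Integration.integral_diff[OF int int])
    qed
    ultimately show "((\<lambda>s'. ((LBINT y. U y * \<phi> (y - s' *\<^sub>R t)) - (LBINT y. U y * \<phi> (y - s *\<^sub>R t))) / (s' - s)) \<circ> X)
      \<longlonglongrightarrow> (LBINT y. U y * (- partial t \<phi> (y - s *\<^sub>R t)))" by (simp only: comp_def)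
  qed
  then show ?thesis by (simp add: has_field_derivative_iff)
qed

lemma lborel_Cauchy_Schwarz:
  fixes f g :: "'a::euclidean_space \<Rightarrow> real"
  assumes "f \<in> borel_measurable borel" "g \<in> borel_measurable borel"
    and "integrable lborel (\<lambda>x. (f x)\<^sup>2)" "integrable lborel (\<lambda>x. (g x)\<^sup>2)"
  shows "\<bar>LBINT x. f x * g x\<bar> \<le> sqrt (LBINT x. (f x)\<^sup>2) * sqrt (LBINT x. (g x)\<^sup>2)"
proof -
  interpret semi_hilbert "L2 (UNIV :: 'a set)" "L2ip UNIV" by (rule semi_hilbert_L2)
  have rep: "borel_rep UNIV f f" "borel_rep UNIV g g" using assms by (auto simp: borel_rep_def)
  then have "f \<in> L2 UNIV" "g \<in> L2 UNIV" using assms by (auto simp: borel_rep_L2_iff)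
  from Cauchy_Schwarz[OF this] show ?thesis
    using rep by (simp add: borel_rep_L2ip power2_eq_square)
qed

text \<open>The estimate is proved by duality. For a test function \<open>\<phi>\<close> on \<open>A\<close>, the pairing \<open>m s\<close> of \<open>U\<close> with the
  translate of \<open>\<phi>\<close> by \<open>s t\<close> is differentiable in \<open>s\<close>. As long as the translate is supported in \<open>S\<close>, its
  derivative is the pairing with the weak derivative \<open>G\<close>, at most the product of the norms of \<open>G\<close> and
  \<open>\<phi>\<close>; and \<open>m 1 - m 0\<close> is the pairing of \<open>\<phi>\<close> with the difference of \<open>U\<close> and its translate.\<close>

theorem translation_estimate:
  fixes U G :: "'a::euclidean_space \<Rightarrow> real"
  assumes S: "open S" and U: "U \<in> borel_measurable borel" "integrable lborel (\<lambda>x. (U x)\<^sup>2)" "integrable lborel U"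
    and G: "G \<in> borel_measurable borel" "integrable lborel (\<lambda>x. (G x)\<^sup>2)"
    and wd: "\<And>\<phi>. \<phi> \<in> test_functions S \<Longrightarrow>
      (LBINT x. U x * partial t \<phi> x) = - (LBINT x. G x * \<phi> x)"
    and A: "open A" "\<And>x c. x \<in> A \<Longrightarrow> 0 \<le> c \<Longrightarrow> c \<le> 1 \<Longrightarrow> x + c *\<^sub>R t \<in> S"
  shows "(LBINT x. indicator A x * (U (x + t) - U x)\<^sup>2) \<le> (LBINT x. (G x)\<^sup>2)"
proof -
  note [measurable] = U(1) G(1) borel_open[OF A(1)]
  interpret semi_hilbert "L2 A" "L2ip A" by (rule semi_hilbert_L2)
  have A': "A \<in> sets borel" by simp
  have Ut2: "integrable lborel (\<lambda>x. (U (x + t))\<^sup>2)"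
    using lborel_integral_translate(2)[of "\<lambda>x. (U x)\<^sup>2" t] U(2) by simp
  have Ut: "integrable lborel (\<lambda>x. (U (x + t) - U x)\<^sup>2)"
    using square_integrable_lin[of "\<lambda>x. U (x + t)" lborel U 1 "-1"] U(2) Ut2 by simp
  define w where "w x = indicator A x * (U (x + t) - U x)" for x
  have [measurable]: "w \<in> borel_measurable borel" unfolding w_def[abs_def] by simp
  have w2: "integrable lborel (\<lambda>x. (w x)\<^sup>2)"
    unfolding w_def using integrable_mult_indicator[OF _ Ut, of A]
    by (simp add: power_mult_distrib) (simp add: power2_eq_square mult.assoc flip: indicator_inter_arith)
  have rep: "borel_rep A w w" by (intro borel_rep_self) (auto simp: w_def)
  have wL2: "w \<in> L2 A" using borel_rep_L2_iff[OF A' rep] w2 by simp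
  define c where "c = sqrt (LBINT x. (G x)\<^sup>2)"
  have key: "L2ip A w \<phi> \<le> c * sqrt (L2ip A \<phi> \<phi>)" if \<phi>: "\<phi> \<in> test_functions A" for \<phi>
  proof -
    have [measurable]: "\<phi> \<in> borel_measurable borel" using test_function_borel[OF \<phi>] .
    have \<phi>2: "integrable lborel (\<lambda>x. (\<phi> x)\<^sup>2)" using test_function_square_integrable[OF \<phi>] .
    define m where "m s = (LBINT y. U y * \<phi> (y - s *\<^sub>R t))" for s
    have "(m has_real_derivative (LBINT y. G y * \<phi> (y - s *\<^sub>R t))) (at s)" if "0 \<le> s" "s \<le> 1" for s
    proof -
      have test: "(\<lambda>y. \<phi> (y - s *\<^sub>R t)) \<in> test_functions S"
        using A(2) that by (intro test_function_translate[OF \<phi>]) auto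
      show ?thesis
        using convolution_derivative[OF U(3) \<phi>, of t s] wd[OF test]
        unfolding m_def[abs_def] partial_translate[OF \<phi>] by simp
    qed
    from MVT2[of 0 1 m, OF _ this] obtain z where "m 1 - m 0 = (LBINT y. G y * \<phi> (y - z *\<^sub>R t))" by auto
    also have "\<dots> \<le> sqrt (LBINT x. (G x)\<^sup>2) * sqrt (LBINT y. (\<phi> (y + - (z *\<^sub>R t)))\<^sup>2)"
      using lborel_Cauchy_Schwarz[of G "\<lambda>y. \<phi> (y - z *\<^sub>R t)"] G(2) \<phi>2
        lborel_integral_translate(2)[of "\<lambda>x. (\<phi> x)\<^sup>2" "- (z *\<^sub>R t)"] by simp
    also have "\<dots> = c * sqrt (LBINT x. (\<phi> x)\<^sup>2)"
      using lborel_integral_translate(1)[of "\<lambda>x. (\<phi> x)\<^sup>2" "- (z *\<^sub>R t)"] by (simp add: c_def)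
    also have "(LBINT x. (\<phi> x)\<^sup>2) = L2ip A \<phi> \<phi>"
      using borel_rep_L2ip[OF A' test_function_rep[OF A' \<phi>] test_function_rep[OF A' \<phi>]] by (simp add: power2_eq_square)
    also have "m 1 - m 0 = L2ip A w \<phi>"
    proof -
      have "m 1 = (LBINT x. U (x + t) * \<phi> x)"
        using lborel_integral_translate(1)[of "\<lambda>y. U y * \<phi> (y - t)" t] by (simp add: m_def)
      moreover have "integrable lborel (\<lambda>x. U (x + t) * \<phi> x)" "integrable lborel (\<lambda>x. U x * \<phi> x)"
        using Ut2 U(2) \<phi>2 by (auto intro: square_integrable_mult)
      ultimately have "m 1 - m 0 = (LBINT x. (U (x + t) - U x) * \<phi> x)"
        by (simp add: m_def left_diff_distrib)
      also have "\<dots> = (LBINT x. w x * \<phi> x)"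
        using test_function_eq_0[OF \<phi>] by (intro Bochner_Integration.integral_cong) (auto simp: w_def indicator_def)
      also have "\<dots> = L2ip A w \<phi>" using borel_rep_L2ip[OF A' rep test_function_rep[OF A' \<phi>]] by simp
      finally show ?thesis .
    qed
    finally show ?thesis .
  qed
  have "L2ip A w w \<le> c\<^sup>2"
  proof (rule dual_norm_bound[OF wL2 test_functions_subset_L2[OF A(1)] _ _ key])
    show "\<exists>\<phi>\<in>test_functions A. L2_dist_sq A w \<phi> < \<epsilon>" if "0 < \<epsilon>" for \<epsilon>
      using test_functions_dense_L2[OF A(1) wL2 that] by blast
  qed (simp_all add: c_def)
  moreover have "L2ip A w w = (LBINT x. indicator A x * (U (x + t) - U x)\<^sup>2)"
    unfolding borel_rep_L2ip[OF A' rep rep]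
    by (intro Bochner_Integration.integral_cong) (auto simp: w_def power2_eq_square indicator_def)
  ultimately show ?thesis by (simp add: c_def)
qed

section \<open>Interior compactness\<close>

lemma ennreal_integral_le:
  assumes "f \<in> borel_measurable M" "\<And>x. 0 \<le> f x" "(\<integral>\<^sup>+x. ennreal (f x) \<partial>M) \<le> ennreal c" "0 \<le> c"
  shows "integrable M f" "(\<integral>x. f x \<partial>M) \<le> c"
proof -
  show int: "integrable M f"
    using assms by (intro integrableI_bounded) (auto intro: le_less_trans)
  show "(\<integral>x. f x \<partial>M) \<le> c"
    using assms nn_integral_eq_integral[OF int] by simp
qed

lemma square_add_le: "(a + b)\<^sup>2 \<le> 2 * a\<^sup>2 + 2 * b\<^sup>2" for a b :: real
  using zero_le_power2[of "a - b"] by (simp add: power2_sum power2_diff)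

text \<open>The compactness argument uses the weak derivatives only through the translation estimate, which is
  therefore one of the assumptions.\<close>

locale weakly_null_bounded =
  fixes S :: "'a::euclidean_space set" and U :: "nat \<Rightarrow> 'a \<Rightarrow> real" and B :: real
  assumes S_open: "open S" and S_bounded: "bounded S" and B: "0 \<le> B"
    and U_borel [measurable]: "\<And>n. U n \<in> borel_measurable borel"
    and U_0: "\<And>n x. x \<notin> S \<Longrightarrow> U n x = 0"
    and U_sq: "\<And>n. integrable lborel (\<lambda>x. (U n x)\<^sup>2)"
    and U_bound: "\<And>n. (LBINT x. (U n x)\<^sup>2) \<le> B"
    and weakly_null: "\<And>w. w \<in> borel_measurable borel \<Longrightarrow> integrable lborel (\<lambda>x. (w x)\<^sup>2) \<Longrightarrow>
      (\<lambda>n. LBINT x. U n x * w x) \<longlonglongrightarrow> 0"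
    and translate: "\<And>n t A. open A \<Longrightarrow> (\<And>x c. x \<in> A \<Longrightarrow> 0 \<le> c \<Longrightarrow> c \<le> 1 \<Longrightarrow> x + c *\<^sub>R t \<in> S) \<Longrightarrow>
      (LBINT x. indicator A x * (U n (x + t) - U n x)\<^sup>2) \<le> (norm t)\<^sup>2 * B"
begin

abbreviation mass :: "nat \<Rightarrow> 'a set \<Rightarrow> real" where
  "mass n A \<equiv> LBINT x. indicator A x * (U n x)\<^sup>2"

abbreviation shift_mass :: "'a \<Rightarrow> nat \<Rightarrow> 'a set \<Rightarrow> real" where
  "shift_mass t n A \<equiv> LBINT x. indicator A x * (U n (x + t) - U n x)\<^sup>2"

abbreviation ball_int :: "real \<Rightarrow> nat \<Rightarrow> 'a \<Rightarrow> real" where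
  "ball_int r n x \<equiv> LBINT t. indicator (ball 0 r) t * U n (x + t)"

lemma integrable_translate_diff:
  assumes [measurable]: "A \<in> sets borel"
  shows "integrable lborel (\<lambda>x. indicator A x * (U n (x + t) - U n x)\<^sup>2)"
proof -
  have "integrable lborel (\<lambda>x. (1 * U n (x + t) + (-1) * U n x)\<^sup>2)"
    using U_sq[of n] lborel_integral_translate(2)[of "\<lambda>x. (U n x)\<^sup>2" t]
    by (intro square_integrable_lin) auto
  then have "integrable lborel (\<lambda>x. indicator A x *\<^sub>R (U n (x + t) - U n x)\<^sup>2)"
    by (intro integrable_mult_indicator) auto
  then show ?thesis by simp
qed

lemma integrable_indicator_sq:
  assumes [measurable]: "A \<in> sets borel"
  shows "integrable lborel (\<lambda>x. indicator A x * (U n x)\<^sup>2)"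
  using integrable_mult_indicator[OF _ U_sq, of A n] by simp

lemma ball_measure_pos: "0 < r \<Longrightarrow> 0 < measure lborel (ball (x::'a) r)"
  by (simp add: content_ball_pos)

lemma U_sum_measurable [measurable]: "(\<lambda>x. U n (fst x + snd x)) \<in> borel_measurable (borel \<Otimes>\<^sub>M lborel)"
  "(\<lambda>x. U n (fst x + snd x)) \<in> borel_measurable (lborel \<Otimes>\<^sub>M lborel)"
proof -
  have "(\<lambda>x :: 'a \<times> 'a. U n (fst x + snd x)) \<in> borel_measurable (borel \<Otimes>\<^sub>M borel)" by measurable
  moreover have "sets (borel \<Otimes>\<^sub>M lborel :: ('a \<times> 'a) measure) = sets (borel \<Otimes>\<^sub>M borel)"
    "sets (lborel \<Otimes>\<^sub>M lborel :: ('a \<times> 'a) measure) = sets (borel \<Otimes>\<^sub>M borel)"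
    by (auto intro: sets_pair_measure_cong)
  ultimately show "(\<lambda>x. U n (fst x + snd x)) \<in> borel_measurable (borel \<Otimes>\<^sub>M lborel)"
    "(\<lambda>x. U n (fst x + snd x)) \<in> borel_measurable (lborel \<Otimes>\<^sub>M lborel)"
    by (simp_all cong: measurable_cong_sets)
qed

lemma ball_measurable [measurable]: "ball x r \<in> sets borel" for x :: 'a by simp

text \<open>The mean over the ball around a fixed \<open>x\<close> is a pairing with an indicator function, hence tends to
  zero; the means are uniformly bounded by Cauchy-Schwarz.\<close>

lemma averages_tendsto_0:
  assumes K: "compact K" and r: "0 < r"
  shows "(\<lambda>n. LBINT x. indicator K x * (ball_int r n x)\<^sup>2) \<longlonglongrightarrow> 0"
proof -
  have [measurable]: "K \<in> sets borel" using K by (simp add: compact_imp_closed)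
  define c where "c = measure lborel (ball (0::'a) r)"
  define avg where "avg n x = ball_int r n x" for n x
  have c: "emeasure lborel (ball x r) = ennreal c" for x :: 'a
    unfolding c_def using emeasure_eq_ennreal_measure[of lborel "ball x r"] emeasure_bounded_finite[of "ball x r"]
    by (metis bounded_ball content_ball infinity_ennreal_def less_irrefl r less_imp_le)
  have ind_int: "integrable lborel (\<lambda>y. (indicator (ball x r) y :: real)\<^sup>2)" for x :: 'a
    using c[of x] by (simp add: power2_eq_square flip: indicator_inter_arith)
  have ind_val: "(LBINT y. (indicator (ball x r) y :: real)\<^sup>2) = c" for x :: 'a
    using c[of x] by (simp add: power2_eq_square measure_def c_def flip: indicator_inter_arith)
  have avg_eq: "avg n x = (LBINT y. U n y * indicator (ball x r) y)" for n x
  proof -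
    have "avg n x = (LBINT t. U n (t + x) * indicator (ball x r) (t + x))"
      unfolding avg_def by (intro Bochner_Integration.integral_cong) (auto simp: indicator_def dist_norm add.commute)
    then show ?thesis using lborel_integral_translate(1)[of "\<lambda>y. U n y * indicator (ball x r) y" x] by simp
  qed
  have avg_bound: "(avg n x)\<^sup>2 \<le> B * c" for n x
  proof -
    have "\<bar>avg n x\<bar> \<le> sqrt (LBINT y. (U n y)\<^sup>2) * sqrt (LBINT y. (indicator (ball x r) y)\<^sup>2)"
      unfolding avg_eq by (intro lborel_Cauchy_Schwarz U_sq ind_int) auto
    also have "\<dots> \<le> sqrt B * sqrt c"
      unfolding ind_val using U_bound[of n] B by (intro mult_mono) (auto simp: c_def)
    finally have "\<bar>avg n x\<bar>\<^sup>2 \<le> (sqrt B * sqrt c)\<^sup>2" by (intro power_mono) auto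
    then show ?thesis using B by (simp add: power_mult_distrib c_def)
  qed
  have [measurable]: "avg n \<in> borel_measurable borel" for n
    unfolding avg_def[abs_def] by measurable
  have "(\<lambda>n. LBINT x. indicator K x * (avg n x)\<^sup>2) \<longlonglongrightarrow> (\<integral>x. indicator K x * 0\<^sup>2 \<partial>(lborel :: 'a measure))"
  proof (rule integral_dominated_convergence)
    show "integrable lborel (\<lambda>x. B * c * indicator K x)"
      using emeasure_compact_finite[OF K] by (intro integrable_mult_right) auto
    show "AE x in lborel. norm (indicator K x * (avg n x)\<^sup>2) \<le> B * c * indicator K x" for n
      using avg_bound by (auto simp: indicator_def)
    show "AE x in lborel. (\<lambda>n. indicator K x * (avg n x)\<^sup>2) \<longlonglongrightarrow> indicator K x * 0\<^sup>2"
    proof (intro AE_I2 tendsto_intros)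
      fix x show "(\<lambda>n. avg n x) \<longlonglongrightarrow> 0"
        unfolding avg_eq by (intro weakly_null ind_int) auto
    qed
  qed auto
  then show ?thesis by (simp add: avg_def)
qed

text \<open>By Jensen's inequality, the squared difference of \<open>U\<close> and its mean over a ball is at most the mean of
  the squared differences between \<open>U\<close> and its translates by vectors of length below \<open>r\<close>; after exchanging
  the integrals, each of these contributes at most \<open>r\<^sup>2 * B\<close>. The integrals over
  balls are not divided by the measure of the ball, hence its square on both sides.\<close>

lemma average_close:
  assumes r: "0 < r" and K: "compact K" and KS: "\<And>x. x \<in> K \<Longrightarrow> ball x (2 * r) \<subseteq> S"
  shows "(measure lborel (ball (0::'a) r))\<^sup>2 * mass n K
    \<le> 2 * (LBINT x. indicator K x * (ball_int r n x)\<^sup>2)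
      + 2 * (measure lborel (ball (0::'a) r))\<^sup>2 * r\<^sup>2 * B"
proof -
  have [measurable]: "K \<in> sets borel" using K by (simp add: compact_imp_closed)
  define c where "c = measure lborel (ball (0::'a) r)"
  have c: "emeasure lborel (ball 0 r :: 'a set) = ennreal c"
    unfolding c_def using emeasure_eq_ennreal_measure[of lborel "ball 0 r"] emeasure_bounded_finite[of "ball 0 r"]
    by (metis bounded_ball infinity_ennreal_def less_irrefl)
  have c0: "0 \<le> c" by (simp add: c_def)
  define avg where "avg x = ball_int r n x" for x
  define I where "I x = (LBINT t. indicator (ball 0 r) t * (U n (x + t) - U n x)\<^sup>2)" for x
  have [measurable]: "avg \<in> borel_measurable borel" "I \<in> borel_measurable borel"
    unfolding avg_def[abs_def] I_def[abs_def] by measurable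
  have ind_int: "integrable lborel (indicator (ball (0::'a) r) :: 'a \<Rightarrow> real)"
    using c by (intro integrable_real_indicator) auto
  have ind_val: "(LBINT t. indicator (ball (0::'a) r) t) = c"
    using c c0 by (simp add: measure_def)
  have ind_sq: "integrable lborel (\<lambda>t. (indicator (ball (0::'a) r) t :: real)\<^sup>2)"
    using ind_int by (simp add: power2_eq_square flip: indicator_inter_arith)
  have Ut: "integrable lborel (\<lambda>t. (U n (x + t))\<^sup>2)" for x
    using U_sq[of n] lborel_integral_translate(2)[of "\<lambda>x. (U n x)\<^sup>2" x] by (simp add: add.commute)
  have dU: "integrable lborel (\<lambda>t. indicator (ball 0 r) t * (U n (x + t) - U n x)\<^sup>2)" for x
  proof -
    have "integrable lborel (\<lambda>t. indicator (ball 0 r) t *\<^sub>R (U n (x + t))\<^sup>2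
        - 2 * U n x * (indicator (ball 0 r) t * U n (x + t)) + (U n x)\<^sup>2 * indicator (ball 0 r) t)"
      using ind_int square_integrable_mult[OF _ _ ind_sq Ut[of x]] integrable_mult_indicator[OF _ Ut[of x], of "ball 0 r"]
      by (intro Bochner_Integration.integrable_add Bochner_Integration.integrable_diff integrable_mult_right) auto
    then show ?thesis by (simp add: power2_diff algebra_simps)
  qed
  have int1: "integrable lborel (\<lambda>t. indicator (ball 0 r) t * U n (x + t))" for x
    using square_integrable_mult[OF _ _ ind_sq Ut[of x]] by simp
  \<comment> \<open>Jensen's inequality for the mean over a ball.\<close>
  have jensen: "(c * U n x - avg x)\<^sup>2 \<le> c * I x" for x
  proof -
    let ?\<chi> = "indicator (ball (0::'a) r) :: 'a \<Rightarrow> real" and ?d = "\<lambda>t. U n (x + t) - U n x"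
    have "(LBINT t. ?\<chi> t * (?\<chi> t * ?d t)) = (LBINT t. ?\<chi> t * U n (x + t) - U n x * ?\<chi> t)"
      by (intro Bochner_Integration.integral_cong) (auto simp: indicator_def)
    also have "\<dots> = avg x - U n x * c"
      using int1[of x] ind_int ind_val by (simp add: avg_def)
    finally have "(c * U n x - avg x)\<^sup>2 = \<bar>LBINT t. ?\<chi> t * (?\<chi> t * ?d t)\<bar>\<^sup>2"
      by (simp add: power2_commute mult.commute)
    also have "\<dots> \<le> (sqrt (LBINT t. (?\<chi> t)\<^sup>2) * sqrt (LBINT t. (?\<chi> t * ?d t)\<^sup>2))\<^sup>2"
    proof (intro power_mono lborel_Cauchy_Schwarz ind_sq)
      show "integrable lborel (\<lambda>t. (?\<chi> t * ?d t)\<^sup>2)"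
        by (rule Bochner_Integration.integrable_cong[THEN iffD1, OF refl _ dU[of x]]) (simp add: indicator_def)
    qed (auto simp del: borel_measurable_indicator_iff)
    also have "\<dots> = c * I x"
    proof -
      have "(LBINT t. (?\<chi> t)\<^sup>2) = c"
        using ind_val by (simp add: power2_eq_square flip: indicator_inter_arith)
      moreover have "(LBINT t. (?\<chi> t * ?d t)\<^sup>2) = I x"
        unfolding I_def by (intro Bochner_Integration.integral_cong) (auto simp: indicator_def)
      moreover have "0 \<le> I x" by (simp add: I_def)
      ultimately show ?thesis using c0 by (simp add: power_mult_distrib)
    qed
    finally show ?thesis .
  qed
  define A where "A = (\<Union>x\<in>K. ball x r)"
  have slice: "shift_mass t n K \<le> r\<^sup>2 * B" if t: "t \<in> ball 0 r" for t
  proof -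
    have [measurable]: "A \<in> sets borel" unfolding A_def by (intro borel_open open_UN) auto
    have "shift_mass t n K \<le> shift_mass t n A"
    proof (intro integral_mono integrable_translate_diff)
      show "indicator K x * (U n (x + t) - U n x)\<^sup>2 \<le> indicator A x * (U n (x + t) - U n x)\<^sup>2" for x
      proof -
        have "K \<subseteq> A" using r by (force simp: A_def)
        then show ?thesis by (intro mult_right_mono) (auto simp: indicator_def)
      qed
    qed auto
    also have "\<dots> \<le> (norm t)\<^sup>2 * B"
    proof (rule translate)
      fix x and a :: real assume "x \<in> A" and a: "0 \<le> a" "a \<le> 1"
      then obtain y where y: "y \<in> K" "dist y x < r" by (auto simp: A_def)
      have "norm (a *\<^sub>R t) \<le> norm t" using a by (simp add: mult_left_le_one_le)
      then have "dist y (x + a *\<^sub>R t) < 2 * r"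
        using y(2) t dist_triangle[of y "x + a *\<^sub>R t" x] by (simp add: dist_norm norm_minus_commute)
      then show "x + a *\<^sub>R t \<in> S" using KS[OF y(1)] by auto
    qed (auto simp: A_def)
    also have "\<dots> \<le> r\<^sup>2 * B" using t B by (intro mult_right_mono power_mono) auto
    finally show ?thesis .
  qed
  have "(\<integral>\<^sup>+x. ennreal (indicator K x * I x) \<partial>lborel)
     = (\<integral>\<^sup>+x. \<integral>\<^sup>+t. ennreal (indicator K x * (indicator (ball 0 r) t * (U n (x + t) - U n x)\<^sup>2)) \<partial>lborel \<partial>lborel)"
  proof (intro nn_integral_cong)
    fix x
    have "(\<integral>\<^sup>+t. ennreal (indicator K x * (indicator (ball 0 r) t * (U n (x + t) - U n x)\<^sup>2)) \<partial>lborel)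
      = ennreal (LBINT t. indicator K x * (indicator (ball 0 r) t * (U n (x + t) - U n x)\<^sup>2))"
      using dU[of x] by (intro nn_integral_eq_integral integrable_mult_right) auto
    then show "ennreal (indicator K x * I x)
      = (\<integral>\<^sup>+t. ennreal (indicator K x * (indicator (ball 0 r) t * (U n (x + t) - U n x)\<^sup>2)) \<partial>lborel)"
      by (simp add: I_def)
  qed
  also have "\<dots> = (\<integral>\<^sup>+t. \<integral>\<^sup>+x. ennreal (indicator K x * (indicator (ball 0 r) t * (U n (x + t) - U n x)\<^sup>2)) \<partial>lborel \<partial>lborel)"
    by (rule lborel_pair.Fubini'[symmetric]) simp
  also have "\<dots> \<le> (\<integral>\<^sup>+t. ennreal (r\<^sup>2 * B) * indicator (ball 0 r) t \<partial>(lborel :: 'a measure))"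
  proof (intro nn_integral_mono)
    fix t :: 'a
    show "(\<integral>\<^sup>+x. ennreal (indicator K x * (indicator (ball 0 r) t * (U n (x + t) - U n x)\<^sup>2)) \<partial>lborel)
        \<le> ennreal (r\<^sup>2 * B) * indicator (ball 0 r) t"
    proof (cases "t \<in> ball 0 r")
      case True
      then have "(\<integral>\<^sup>+x. ennreal (indicator K x * (indicator (ball 0 r) t * (U n (x + t) - U n x)\<^sup>2)) \<partial>lborel)
        = ennreal (shift_mass t n K)"
        by (simp add: nn_integral_eq_integral integrable_translate_diff)
      with True slice[OF True] show ?thesis by (simp add: ennreal_leI)
    qed simp
  qed
  also have "\<dots> = ennreal (r\<^sup>2 * B * c)"
    using B c0 by (simp add: nn_integral_cmult c ennreal_mult)
  finally have KI: "integrable lborel (\<lambda>x. indicator K x * I x)" "(LBINT x. indicator K x * I x) \<le> r\<^sup>2 * B * c"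
    using B c0 by (auto intro!: ennreal_integral_le simp: I_def)
  have pt: "c\<^sup>2 * (indicator K x * (U n x)\<^sup>2) \<le> 2 * (indicator K x * (avg x)\<^sup>2) + 2 * c * (indicator K x * I x)" for x
  proof -
    have "(c * U n x)\<^sup>2 \<le> 2 * (avg x)\<^sup>2 + 2 * (c * U n x - avg x)\<^sup>2"
      using square_add_le[of "avg x" "c * U n x - avg x"] by simp
    then have "c\<^sup>2 * (U n x)\<^sup>2 \<le> 2 * (avg x)\<^sup>2 + 2 * c * I x"
      using jensen[of x] by (simp add: power_mult_distrib)
    then show ?thesis by (simp add: indicator_def)
  qed
  have avg_sq: "integrable lborel (\<lambda>x. indicator K x * (avg x)\<^sup>2)"
  proof (rule Bochner_Integration.integrable_bound)
    show "integrable lborel (\<lambda>x. 2 * c\<^sup>2 * (indicator K x * (U n x)\<^sup>2) + 2 * c * (indicator K x * I x))"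
      using KI(1) integrable_indicator_sq[of K n] by (intro Bochner_Integration.integrable_add integrable_mult_right) auto
    have "(avg x)\<^sup>2 \<le> 2 * c\<^sup>2 * (U n x)\<^sup>2 + 2 * c * I x" for x
      using square_add_le[of "c * U n x" "avg x - c * U n x"] jensen[of x]
      by (simp add: power_mult_distrib power2_commute)
    then show "AE x in lborel. norm (indicator K x * (avg x)\<^sup>2)
        \<le> norm (2 * c\<^sup>2 * (indicator K x * (U n x)\<^sup>2) + 2 * c * (indicator K x * I x))"
      by (intro AE_I2) (auto simp: indicator_def intro: order_trans abs_ge_self)
  qed simp
  have "c\<^sup>2 * mass n K = (LBINT x. c\<^sup>2 * (indicator K x * (U n x)\<^sup>2))" by simp
  also have "\<dots> \<le> (LBINT x. 2 * (indicator K x * (avg x)\<^sup>2) + 2 * c * (indicator K x * I x))"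
    using avg_sq KI(1) integrable_indicator_sq[of K n] pt
    by (intro integral_mono Bochner_Integration.integrable_add integrable_mult_right) auto
  also have "\<dots> = 2 * (LBINT x. indicator K x * (avg x)\<^sup>2) + 2 * c * (LBINT x. indicator K x * I x)"
    using avg_sq KI(1) by simp
  also have "\<dots> \<le> 2 * (LBINT x. indicator K x * (avg x)\<^sup>2) + 2 * c * (r\<^sup>2 * B * c)"
    using KI(2) c0 by (intro add_left_mono mult_left_mono) auto
  finally show ?thesis by (simp add: avg_def c_def power2_eq_square mult_ac)
qed

text \<open>The radius is fixed such that the distance to the means, uniform in \<open>n\<close>, is small.\<close>

lemma interior_convergence:
  assumes K: "compact K" "K \<subseteq> S"
  shows "(\<lambda>n. mass n K) \<longlonglongrightarrow> 0"
proof (rule LIMSEQ_I)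
  fix \<epsilon> :: real assume \<epsilon>: "0 < \<epsilon>"
  obtain d where d: "0 < d" "\<And>x. x \<in> K \<Longrightarrow> ball x d \<subseteq> S"
  proof -
    obtain d where "0 < d" "\<And>x y. x \<in> K \<Longrightarrow> y \<in> - S \<Longrightarrow> d \<le> dist x y"
      using separate_compact_closed[OF K(1) closed_Compl[OF S_open]] K(2) by blast
    then have "ball x d \<subseteq> S" if "x \<in> K" for x using that by force
    with \<open>0 < d\<close> that show thesis by blast
  qed
  \<comment> \<open>The first bound keeps balls of radius \<open>2 * r\<close> inside \<open>S\<close>, the second makes the error \<open>2 * r\<^sup>2 * B\<close>
    smaller than \<open>\<epsilon>\<close>; the summand \<open>1\<close> covers \<open>B = 0\<close>.\<close>
  define r where "r = min (d / 2) (sqrt (\<epsilon> / (4 * (B + 1))))"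
  have r: "0 < r" using d(1) \<epsilon> B by (simp add: r_def)
  have rB: "2 * r\<^sup>2 * B < \<epsilon>"
  proof -
    have "r\<^sup>2 \<le> (sqrt (\<epsilon> / (4 * (B + 1))))\<^sup>2" using r by (intro power_mono) (auto simp: r_def)
    then have "r\<^sup>2 * (4 * (B + 1)) \<le> \<epsilon>" using \<epsilon> B by (simp add: field_simps)
    moreover have "2 * r\<^sup>2 * B < r\<^sup>2 * (4 * (B + 1))" using r B by (simp add: algebra_simps add_pos_nonneg)
    ultimately show ?thesis by simp
  qed
  have KS: "ball x (2 * r) \<subseteq> S" if "x \<in> K" for x
    using d(2)[OF that] subset_ball[of "2 * r" d x] by (auto simp: r_def)
  define c where "c = (measure lborel (ball (0::'a) r))\<^sup>2"
  have c: "0 < c" using ball_measure_pos[OF r, of 0] by (simp add: c_def)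
  have le: "mass n K
    \<le> 2 / c * (LBINT x. indicator K x * (ball_int r n x)\<^sup>2) + 2 * r\<^sup>2 * B" for n
    using average_close[OF r K(1) KS, of n] c unfolding c_def[symmetric] by (simp add: field_simps)
  have "(\<lambda>n. 2 / c * (LBINT x. indicator K x * (ball_int r n x)\<^sup>2) + 2 * r\<^sup>2 * B)
    \<longlonglongrightarrow> 2 / c * 0 + 2 * r\<^sup>2 * B"
    by (intro tendsto_intros averages_tendsto_0 K r)
  then have "\<forall>\<^sub>F n in sequentially. 2 / c * (LBINT x. indicator K x * (ball_int r n x)\<^sup>2)
      + 2 * r\<^sup>2 * B < \<epsilon>"
    using rB by (intro order_tendstoD(2)) auto
  then have "\<forall>\<^sub>F n in sequentially. norm (mass n K - 0) < \<epsilon>"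
  proof eventually_elim
    case (elim n)
    then show ?case using le[of n] by simp
  qed
  then show "\<exists>N. \<forall>n\<ge>N. norm (mass n K - 0) < \<epsilon>"
    by (simp add: eventually_sequentially)
qed

section \<open>Compactness up to a Lipschitz boundary\<close>

text \<open>Values on \<open>A\<close> are compared with those on the translate of \<open>A\<close>, which lies in a compact subset of
  \<open>S\<close>; the translation estimate bounds the error by the length of \<open>t\<close>.\<close>

lemma pushed_convergence:
  assumes [measurable]: "A \<in> sets borel" and A: "A \<subseteq> S"
    and push: "\<And>\<delta>. 0 < \<delta> \<Longrightarrow> \<exists>t K. norm t < \<delta> \<and> compact K \<and> K \<subseteq> S \<and> (\<forall>x\<in>A. x + t \<in> K) \<and>
      (\<forall>x\<in>A. \<forall>c. 0 \<le> c \<longrightarrow> c \<le> 1 \<longrightarrow> x + c *\<^sub>R t \<in> S)"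
  shows "(\<lambda>n. mass n A) \<longlonglongrightarrow> 0"
proof (rule LIMSEQ_I)
  fix \<epsilon> :: real assume \<epsilon>: "0 < \<epsilon>"
  define \<delta> where "\<delta> = sqrt (\<epsilon> / (4 * (B + 1)))"
  have \<delta>: "0 < \<delta>" "\<delta>\<^sup>2 = \<epsilon> / (4 * (B + 1))" using \<epsilon> B by (simp_all add: \<delta>_def)
  obtain t K where t: "norm t < \<delta>" and K: "compact K" "K \<subseteq> S" "\<And>x. x \<in> A \<Longrightarrow> x + t \<in> K"
    and seg: "\<And>x c. x \<in> A \<Longrightarrow> 0 \<le> c \<Longrightarrow> c \<le> 1 \<Longrightarrow> x + c *\<^sub>R t \<in> S"
    using push[OF \<delta>(1)] by blast
  have [measurable]: "K \<in> sets borel" using K by (simp add: compact_imp_closed)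
  define A' where "A' = {x. \<forall>c\<in>{0..1::real}. x + c *\<^sub>R t \<in> S}"
  have A': "open A'" unfolding A'_def by (rule segment_set_open[OF S_open])
  have [measurable]: "A' \<in> sets borel" using A' by simp
  have AA': "A \<subseteq> A'" using seg by (auto simp: A'_def)
  have tB: "2 * ((norm t)\<^sup>2 * B) < \<epsilon>"
  proof -
    have "(norm t)\<^sup>2 * B \<le> \<delta>\<^sup>2 * B" using t B by (intro mult_right_mono power_mono) auto
    also have "\<dots> = \<epsilon> / 4 * (B / (B + 1))" by (simp add: \<delta>(2))
    also have "\<dots> \<le> \<epsilon> / 4 * 1" using \<epsilon> B by (intro mult_left_mono) auto
    finally show ?thesis using \<epsilon> by simp
  qed
  have Kt: "integrable lborel (\<lambda>x. indicator K (x + t) * (U n (x + t))\<^sup>2)" for n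
    using integrable_indicator_sq[of K n] lborel_integral_translate(2)[of "\<lambda>x. indicator K x * (U n x)\<^sup>2" t] by simp
  have le: "mass n A
      \<le> 2 * mass n K + 2 * ((norm t)\<^sup>2 * B)" for n
  proof -
    have "mass n A \<le> (LBINT x. 2 * (indicator K (x + t) * (U n (x + t))\<^sup>2)
        + 2 * (indicator A' x * (U n (x + t) - U n x)\<^sup>2))"
    proof (intro integral_mono)
      show "indicator A x * (U n x)\<^sup>2 \<le> 2 * (indicator K (x + t) * (U n (x + t))\<^sup>2)
        + 2 * (indicator A' x * (U n (x + t) - U n x)\<^sup>2)" for x
      proof (cases "x \<in> A")
        case True
        then have "x \<in> A'" "x + t \<in> K" using AA' K(3) by auto
        then show ?thesis using True square_add_le[of "U n (x + t)" "U n x - U n (x + t)"]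
          by (simp add: power2_commute)
      qed simp
    qed (use integrable_indicator_sq integrable_translate_diff[of A'] Kt in auto)
    also have "\<dots> = 2 * mass n K + 2 * shift_mass t n A'"
      using Kt integrable_translate_diff[of A'] lborel_integral_translate(1)[of "\<lambda>x. indicator K x * (U n x)\<^sup>2" t] by simp
    also have "\<dots> \<le> 2 * mass n K + 2 * ((norm t)\<^sup>2 * B)"
      using translate[OF A', of t n] by (auto simp: A'_def)
    finally show ?thesis .
  qed
  have "(\<lambda>n. 2 * mass n K + 2 * ((norm t)\<^sup>2 * B)) \<longlonglongrightarrow> 2 * 0 + 2 * ((norm t)\<^sup>2 * B)"
    by (intro tendsto_intros interior_convergence K)
  then have "\<forall>\<^sub>F n in sequentially. 2 * mass n K + 2 * ((norm t)\<^sup>2 * B) < \<epsilon>"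
    using tB by (intro order_tendstoD(2)) auto
  then have "\<forall>\<^sub>F n in sequentially. norm (mass n A - 0) < \<epsilon>"
  proof eventually_elim
    case (elim n)
    then show ?case using le[of n] by simp
  qed
  then show "\<exists>N. \<forall>n\<ge>N. norm (mass n A - 0) < \<epsilon>"
    by (simp add: eventually_sequentially)
qed

text \<open>At a boundary point the translation is along the axis \<open>\<nu>\<close> of the graph: points of the closure of an
  epigraph move into the epigraph, so a compact part of the closure moves onto a compact subset of \<open>S\<close>.\<close>

lemma local_convergence:
  assumes lip: "lipschitz_boundary S" and x0: "x0 \<in> closure S"
  shows "\<exists>r>0. (\<lambda>n. mass n (S \<inter> ball x0 r)) \<longlonglongrightarrow> 0"
proof (cases "x0 \<in> S")
  case True
  then obtain r where r: "0 < r" "cball x0 r \<subseteq> S" using S_open open_contains_cball by blast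
  have "(\<lambda>n. mass n (S \<inter> ball x0 r)) \<longlonglongrightarrow> 0"
  proof (rule pushed_convergence)
    show "\<exists>t K. norm t < \<delta> \<and> compact K \<and> K \<subseteq> S \<and> (\<forall>x\<in>S \<inter> ball x0 r. x + t \<in> K) \<and>
      (\<forall>x\<in>S \<inter> ball x0 r. \<forall>c. 0 \<le> c \<longrightarrow> c \<le> 1 \<longrightarrow> x + c *\<^sub>R t \<in> S)" if "0 < \<delta>" for \<delta>
      using that r by (intro exI[of _ "0 :: 'a"] exI[of _ "cball x0 r"]) auto
  qed (use S_open in auto)
  with r(1) show ?thesis by blast
next
  case False
  then have "x0 \<in> frontier S" using x0 S_open by (simp add: frontier_def interior_open)
  then obtain r \<nu> L \<gamma> where r: "0 < r" and \<nu>: "norm \<nu> = 1" and \<gamma>: "L-lipschitz_on {y. y \<bullet> \<nu> = 0} \<gamma>"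
    and epi: "\<And>x. x \<in> ball x0 r \<Longrightarrow> x \<in> S \<longleftrightarrow> \<gamma> (x - (x \<bullet> \<nu>) *\<^sub>R \<nu>) < x \<bullet> \<nu>"
    using lip unfolding lipschitz_boundary_def by meson
  have \<nu>\<nu>: "\<nu> \<bullet> \<nu> = 1" using \<nu> by (simp add: norm_eq_1)
  define P where "P x = x - (x \<bullet> \<nu>) *\<^sub>R \<nu>" for x
  have P: "P x \<bullet> \<nu> = 0" "P (x + s *\<^sub>R \<nu>) = P x" "(x + s *\<^sub>R \<nu>) \<bullet> \<nu> = x \<bullet> \<nu> + s" for x s
    by (simp_all add: P_def inner_diff_left inner_add_left \<nu>\<nu> algebra_simps)
  have Pcont: "continuous_on UNIV (\<lambda>x. \<gamma> (P x))"
    by (rule continuous_on_compose2[OF lipschitz_on_continuous_on[OF \<gamma>]])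
      (auto simp: P_def[abs_def] inner_diff_left \<nu>\<nu> intro!: continuous_intros)
  have up: "x + s *\<^sub>R \<nu> \<in> S" if "x \<in> closure S" "x \<in> cball x0 (r / 2)" "0 < s" "s < r / 2" for x s
  proof -
    have "\<gamma> (P x) \<le> x \<bullet> \<nu>"
    proof -
      have "x \<in> closure (S \<inter> ball x0 r)"
        using that(1,2) r open_Int_closure_subset[of "ball x0 r" S] by (auto simp: Int_commute)
      moreover have "closure (S \<inter> ball x0 r) \<subseteq> {x. \<gamma> (P x) \<le> x \<bullet> \<nu>}"
      proof (rule closure_minimal)
        show "S \<inter> ball x0 r \<subseteq> {x. \<gamma> (P x) \<le> x \<bullet> \<nu>}" using epi by (auto simp: P_def less_imp_le)
        show "closed {x. \<gamma> (P x) \<le> x \<bullet> \<nu>}"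
          by (intro closed_Collect_le Pcont continuous_intros)
      qed
      ultimately show ?thesis by blast
    qed
    then have "\<gamma> (P (x + s *\<^sub>R \<nu>)) < (x + s *\<^sub>R \<nu>) \<bullet> \<nu>" using that(3) by (simp add: P)
    moreover have "x + s *\<^sub>R \<nu> \<in> ball x0 r"
    proof -
      have "dist x0 (x + s *\<^sub>R \<nu>) \<le> dist x0 x + dist x (x + s *\<^sub>R \<nu>)" by (rule dist_triangle)
      also have "dist x (x + s *\<^sub>R \<nu>) = s" using that(3) \<nu> by (simp add: dist_norm)
      finally show ?thesis using that by simp
    qed
    ultimately show ?thesis using epi by (simp add: P_def)
  qed
  have "(\<lambda>n. mass n (S \<inter> ball x0 (r / 2))) \<longlonglongrightarrow> 0"
  proof (rule pushed_convergence)
    fix \<delta> :: real assume \<delta>: "0 < \<delta>"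
    define s where "s = min \<delta> (r / 2) / 2"
    have s: "0 < s" "s < r / 2" "s < \<delta>" using \<delta> r by (auto simp: s_def min_def)
    define K where "K = (\<lambda>x. x + s *\<^sub>R \<nu>) ` (closure S \<inter> cball x0 (r / 2))"
    have "compact K" unfolding K_def
      by (intro compact_continuous_image continuous_intros) auto
    moreover have "K \<subseteq> S" using up s by (auto simp: K_def)
    moreover have "\<forall>x\<in>S \<inter> ball x0 (r / 2). x + s *\<^sub>R \<nu> \<in> K"
      using closure_subset by (fastforce simp: K_def)
    moreover have "x + c *\<^sub>R s *\<^sub>R \<nu> \<in> S" if x: "x \<in> S \<inter> ball x0 (r / 2)" and c: "0 \<le> c" "c \<le> 1" for x c
    proof (cases "c = 0")
      case False
      have "c * s \<le> s" using c s by (simp add: mult_left_le_one_le)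
      moreover have "0 < c * s" using c False s by simp
      moreover have "x \<in> closure S" using x closure_subset by blast
      moreover have "x \<in> cball x0 (r / 2)" using x by auto
      moreover have "c * s < r / 2" using \<open>c * s \<le> s\<close> s(2) by linarith
      ultimately have "x + (c * s) *\<^sub>R \<nu> \<in> S" by (intro up)
      then show ?thesis by simp
    qed (use x in simp)
    moreover have "norm (s *\<^sub>R \<nu>) < \<delta>" using s \<nu> by simp
    ultimately show "\<exists>t K. norm t < \<delta> \<and> compact K \<and> K \<subseteq> S \<and> (\<forall>x\<in>S \<inter> ball x0 (r / 2). x + t \<in> K) \<and>
      (\<forall>x\<in>S \<inter> ball x0 (r / 2). \<forall>c. 0 \<le> c \<longrightarrow> c \<le> 1 \<longrightarrow> x + c *\<^sub>R t \<in> S)"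
      by blast
  qed (use S_open in auto)
  then show ?thesis using r by (intro exI[of _ "r / 2"]) auto
qed

text \<open>Finitely many of the local neighbourhoods cover the closure of the bounded set \<open>S\<close>.\<close>

theorem strongly_null:
  assumes lip: "lipschitz_boundary S"
  shows "(\<lambda>n. LBINT x. (U n x)\<^sup>2) \<longlonglongrightarrow> 0"
proof -
  define P where "P x r \<longleftrightarrow> 0 < r \<and>
    (\<lambda>n. mass n (S \<inter> ball x r)) \<longlonglongrightarrow> 0" for x r
  have "\<exists>r. P x r" if "x \<in> closure S" for x
    using local_convergence[OF lip that] by (simp add: P_def)
  then obtain r where "\<And>x. x \<in> closure S \<Longrightarrow> P x (r x)" by metis
  then have r: "\<And>x. x \<in> closure S \<Longrightarrow> 0 < r x"
    and lim: "\<And>x. x \<in> closure S \<Longrightarrow> (\<lambda>n. mass n (S \<inter> ball x (r x))) \<longlonglongrightarrow> 0"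
    by (simp_all add: P_def)
  have "compact (closure S)" using S_bounded by simp
  then obtain D where D: "D \<subseteq> closure S" "finite D" "closure S \<subseteq> (\<Union>x\<in>D. ball x (r x))"
    by (rule compactE_image[of _ "closure S" "\<lambda>x. ball x (r x)"]) (use r in auto)
  have [measurable]: "S \<in> sets borel" using S_open by simp
  have le: "(LBINT x. (U n x)\<^sup>2) \<le> (\<Sum>z\<in>D. mass n (S \<inter> ball z (r z)))" for n
  proof -
    have "(LBINT x. (U n x)\<^sup>2) \<le> (LBINT x. (\<Sum>z\<in>D. indicator (S \<inter> ball z (r z)) x * (U n x)\<^sup>2))"
    proof (rule integral_mono[OF U_sq])
      show "integrable lborel (\<lambda>x. \<Sum>z\<in>D. indicator (S \<inter> ball z (r z)) x * (U n x)\<^sup>2)"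
        by (intro Bochner_Integration.integrable_sum integrable_indicator_sq) auto
      show "(U n x)\<^sup>2 \<le> (\<Sum>z\<in>D. indicator (S \<inter> ball z (r z)) x * (U n x)\<^sup>2)" for x
      proof (cases "x \<in> S")
        case True
        then obtain z where z: "z \<in> D" "x \<in> ball z (r z)" using D(3) closure_subset by blast
        have "(U n x)\<^sup>2 = indicator (S \<inter> ball z (r z)) x * (U n x)\<^sup>2" using True z by simp
        also have "\<dots> \<le> (\<Sum>z\<in>D. indicator (S \<inter> ball z (r z)) x * (U n x)\<^sup>2)"
          using z(1) D(2) by (intro member_le_sum[of z D "\<lambda>z. indicator (S \<inter> ball z (r z)) x * (U n x)\<^sup>2"]) auto
        finally show ?thesis .
      qed (simp add: U_0)
    qed
    also have "\<dots> = (\<Sum>z\<in>D. mass n (S \<inter> ball z (r z)))"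
      by (intro Bochner_Integration.integral_sum integrable_indicator_sq) auto
    finally show ?thesis .
  qed
  have "(\<lambda>n. \<Sum>z\<in>D. mass n (S \<inter> ball z (r z))) \<longlonglongrightarrow> (\<Sum>z\<in>D. 0)"
    using D(1) by (intro tendsto_sum lim) auto
  then have "(\<lambda>n. \<Sum>z\<in>D. mass n (S \<inter> ball z (r z))) \<longlonglongrightarrow> 0" by simp
  then show ?thesis
    by (rule tendsto_sandwich[OF always_eventually always_eventually tendsto_const, rotated 2]) (use le in auto)
qed

end

section \<open>The Rellich theorem\<close>

text \<open>It remains to pass to Borel representatives. The derivative in direction \<open>t\<close> is the combination of
  the partial derivatives with the coordinates of \<open>t\<close>, so its norm is at most \<open>norm t\<close> times that of
  the gradient.\<close>

theorem rellich:
  fixes S :: "'a::euclidean_space set" and u :: "nat \<Rightarrow> 'a \<Rightarrow> real"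
  assumes S: "open S" "bounded S" "lipschitz_boundary S"
    and u: "\<And>n. u n \<in> H1 S" and bound: "\<And>n. H1ip S (u n) (u n) \<le> B"
    and weak: "\<And>w. w \<in> L2 S \<Longrightarrow> (\<lambda>n. L2ip S (u n) w) \<longlonglongrightarrow> 0"
  shows "(\<lambda>n. L2ip S (u n) (u n)) \<longlonglongrightarrow> 0"
proof -
  have S': "S \<in> sets borel" using S by simp
  interpret L2: semi_hilbert "L2 S" "L2ip S" by (rule semi_hilbert_L2)
  have "\<exists>F. borel_rep S (u n) F \<and> F \<in> borel_measurable borel \<and> (\<forall>x. x \<notin> S \<longrightarrow> F x = 0) \<and>
     integrable lborel (\<lambda>x. (F x)\<^sup>2)" for n
    using L2_rep[OF S' H1_imp_L2[OF u[of n]]] by metis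
  then obtain U where U: "\<And>n. borel_rep S (u n) (U n)" "\<And>n. U n \<in> borel_measurable borel"
    "\<And>n x. x \<notin> S \<Longrightarrow> U n x = 0" "\<And>n. integrable lborel (\<lambda>x. (U n x)\<^sup>2)" by metis
  have sum_ge0: "0 \<le> (\<Sum>b\<in>Basis. L2ip S (wpartial S b (u n)) (wpartial S b (u n)))" for n
    by (simp add: sum_nonneg L2ip_self_ge0)
  have B0: "0 \<le> B" using bound[of 0] sum_ge0[of 0] L2ip_self_ge0[of S "u 0"] by (simp add: H1ip_def)
  have L2_sq: "L2ip S (u n) (u n) = (LBINT x. (U n x)\<^sup>2)" for n
    using borel_rep_L2ip[OF S' U(1) U(1)] by (simp add: power2_eq_square)
  interpret weakly_null_bounded S U B
  proof
    show "(LBINT x. (U n x)\<^sup>2) \<le> B" for n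
      using bound[of n] sum_ge0[of n] L2_sq[of n] by (simp add: H1ip_def)
    show "(\<lambda>n. LBINT x. U n x * w x) \<longlonglongrightarrow> 0"
      if w: "w \<in> borel_measurable borel" "integrable lborel (\<lambda>x. (w x)\<^sup>2)" for w
    proof -
      define W where "W x = indicator S x * w x" for x
      have [measurable]: "w \<in> borel_measurable borel" "S \<in> sets borel" using w S' by auto
      have W: "borel_rep S W W" by (rule borel_rep_self) (auto simp: W_def[abs_def])
      have "integrable lborel (\<lambda>x. indicator S x *\<^sub>R (w x)\<^sup>2)"
        using w by (intro integrable_mult_indicator) auto
      then have "integrable lborel (\<lambda>x. (W x)\<^sup>2)"
        by (rule Bochner_Integration.integrable_cong[THEN iffD1, rotated 2]) (auto simp: W_def indicator_def)
      then have "W \<in> L2 S" using borel_rep_L2_iff[OF S' W] by simp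
      from weak[OF this] have "(\<lambda>n. LBINT x. U n x * W x) \<longlonglongrightarrow> 0"
        using borel_rep_L2ip[OF S' U(1) W] by simp
      moreover have "(\<lambda>x. U n x * W x) = (\<lambda>x. U n x * w x)" for n
      proof (rule ext)
        fix x show "U n x * W x = U n x * w x" by (cases "x \<in> S") (simp_all add: W_def U(3))
      qed
      ultimately show ?thesis by simp
    qed
    show "(LBINT x. indicator A x * (U n (x + t) - U n x)\<^sup>2) \<le> (norm t)\<^sup>2 * B"
      if A: "open A" "\<And>x c. x \<in> A \<Longrightarrow> 0 \<le> c \<Longrightarrow> c \<le> 1 \<Longrightarrow> x + c *\<^sub>R t \<in> S" for n t A
    proof -
      have "\<exists>F. borel_rep S (wpartial S b (u n)) F \<and> F \<in> borel_measurable borel \<and> integrable lborel (\<lambda>x. (F x)\<^sup>2)"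
        if "b \<in> Basis" for b
        using L2_rep[OF S' H1_wpartial(1)[OF u[of n] that]] by metis
      then obtain G where G: "\<And>b. b \<in> Basis \<Longrightarrow> borel_rep S (wpartial S b (u n)) (G b)"
        "\<And>b. b \<in> Basis \<Longrightarrow> G b \<in> borel_measurable borel"
        "\<And>b. b \<in> Basis \<Longrightarrow> integrable lborel (\<lambda>x. (G b x)\<^sup>2)" by metis
      define H where "H x = (\<Sum>b\<in>Basis. (t \<bullet> b) * G b x)" for x
      have [measurable]: "H \<in> borel_measurable borel"
        unfolding H_def[abs_def] using G(2) by (intro borel_measurable_sum borel_measurable_times) auto
      have H_le: "(H x)\<^sup>2 \<le> (norm t)\<^sup>2 * (\<Sum>b\<in>Basis. (G b x)\<^sup>2)" for x
      proof -
        have "(H x)\<^sup>2 \<le> (\<Sum>b\<in>Basis. (t \<bullet> b)\<^sup>2) * (\<Sum>b\<in>Basis. (G b x)\<^sup>2)"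
          unfolding H_def by (rule Cauchy_Schwarz_ineq_sum)
        then show ?thesis by (simp add: norm_eq_sqrt_inner euclidean_inner[of t t] power2_eq_square[symmetric] sum_nonneg)
      qed
      have Gsum: "integrable lborel (\<lambda>x. (norm t)\<^sup>2 * (\<Sum>b\<in>Basis. (G b x)\<^sup>2))"
        using G(3) by (intro integrable_mult_right Bochner_Integration.integrable_sum) auto
      have H2: "integrable lborel (\<lambda>x. (H x)\<^sup>2)"
        by (rule Bochner_Integration.integrable_bound[OF Gsum]) (use H_le in \<open>auto intro!: AE_I2 order_trans[OF _ abs_ge_self]\<close>)
      have Uint: "integrable lborel (U n)"
      proof -
        have "emeasure lborel S < \<infinity>" using emeasure_bounded_finite[OF S(2)] by simp
        then have "integrable lborel (\<lambda>x. indicator S x * U n x)"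
          using U(2,4) S' by (intro indicator_mult_integrable) auto
        moreover have "(\<lambda>x. indicator S x * U n x) = U n"
        proof (rule ext)
          fix x show "indicator S x * U n x = U n x" by (cases "x \<in> S") (simp_all add: U(3))
        qed
        ultimately show ?thesis by simp
      qed
      have "(LBINT x. indicator A x * (U n (x + t) - U n x)\<^sup>2) \<le> (LBINT x. (H x)\<^sup>2)"
      proof (rule translation_estimate[OF S(1) U(2,4) Uint _ H2 _ A])
        fix \<phi> assume \<phi>: "\<phi> \<in> test_functions S"
        have test: "partial b \<phi> \<in> test_functions S" for b using partial_test_function[OF \<phi>] .
        note sq = test_function_square_integrable and bm = test_function_borel
        have 1: "(LBINT x. U n x * partial b \<phi> x) = - (LBINT x. G b x * \<phi> x)" if b: "b \<in> Basis" for b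
          using H1_wpartial[OF u[of n] b] \<phi> borel_rep_L2ip[OF S' U(1)[of n] test_function_rep[OF S' test[of b]]]
            borel_rep_L2ip[OF S' G(1)[OF b] test_function_rep[OF S' \<phi>]]
          by (simp add: weak_partial_L2_iff[OF S(1) H1_imp_L2[OF u]])
        have iU: "integrable lborel (\<lambda>x. (t \<bullet> b) * (U n x * partial b \<phi> x))" for b
          using square_integrable_mult[OF _ _ U(4)[of n] sq[OF test[of b]]] U(2) bm[OF test[of b]] by simp
        have iG: "integrable lborel (\<lambda>x. (t \<bullet> b) * (G b x * \<phi> x))" if "b \<in> Basis" for b
          using square_integrable_mult[OF _ _ G(3)[OF that] sq[OF \<phi>]] G(2)[OF that] bm[OF \<phi>] by simp
        have "U n x * partial t \<phi> x = (\<Sum>b\<in>Basis. (t \<bullet> b) * (U n x * partial b \<phi> x))" for x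
          unfolding partial_eq_sum[OF \<phi>, where t=t and x=x] sum_distrib_left by (rule sum.cong) simp_all
        then have "(LBINT x. U n x * partial t \<phi> x) = (LBINT x. (\<Sum>b\<in>Basis. (t \<bullet> b) * (U n x * partial b \<phi> x)))"
          by presburger
        also have "\<dots> = (\<Sum>b\<in>Basis. (t \<bullet> b) * (LBINT x. U n x * partial b \<phi> x))"
          using iU by (subst Bochner_Integration.integral_sum) auto
        also have "\<dots> = - (\<Sum>b\<in>Basis. (t \<bullet> b) * (LBINT x. G b x * \<phi> x))"
          using 1 by (simp add: sum_negf)
        also have "(\<Sum>b\<in>Basis. (t \<bullet> b) * (LBINT x. G b x * \<phi> x)) = (LBINT x. (\<Sum>b\<in>Basis. (t \<bullet> b) * (G b x * \<phi> x)))"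
          using iG by (subst Bochner_Integration.integral_sum) auto
        also have "\<dots> = (LBINT x. H x * \<phi> x)"
          by (simp add: H_def sum_distrib_right mult.assoc)
        finally show "(LBINT x. U n x * partial t \<phi> x) = - (LBINT x. H x * \<phi> x)" .
      qed auto
      also have "\<dots> \<le> (LBINT x. (norm t)\<^sup>2 * (\<Sum>b\<in>Basis. (G b x)\<^sup>2))"
        by (rule integral_mono[OF H2 Gsum H_le])
      also have "\<dots> = (norm t)\<^sup>2 * (\<Sum>b\<in>Basis. LBINT x. (G b x)\<^sup>2)"
        using G(3) by simp
      also have "(\<Sum>b\<in>Basis. LBINT x. (G b x)\<^sup>2) = (\<Sum>b\<in>Basis. L2ip S (wpartial S b (u n)) (wpartial S b (u n)))"
        using borel_rep_L2ip[OF S' G(1) G(1)] by (intro sum.cong) (auto simp: power2_eq_square)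
      also have "\<dots> \<le> B" using bound[of n] L2ip_self_ge0[of S "u n"] by (simp add: H1ip_def)
      finally show ?thesis by (simp add: mult_left_mono)
    qed
  qed (use S B0 U in auto)
  show ?thesis using strongly_null[OF S(3)] by (simp add: L2_sq)
qed

section \<open>Cells\<close>

text \<open>The centre of the cell, with half-open cells, which partition the plane exactly.\<close>

definition cell_floor :: "real^2 \<Rightarrow> real^2" where
  "cell_floor x = (\<chi> i. of_int \<lfloor>x $ i + 1 / 2\<rfloor>)"

definition unfold_map :: "real \<Rightarrow> real^2 \<Rightarrow> real^2 \<Rightarrow> real^2" where
  "unfold_map d x z = d *\<^sub>R cell_floor ((1 / d) *\<^sub>R x) + d *\<^sub>R z"

text \<open>The points in the open cells, where \<open>cell_index\<close> is specified.\<close>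

definition off_grid :: "real^2 \<Rightarrow> bool" where
  "off_grid x \<longleftrightarrow> (\<forall>i. x $ i + 1 / 2 \<notin> \<int>)"

lemma vec_borel_measurable:
  fixes f :: "'a \<Rightarrow> real^2"
  assumes "\<And>i. (\<lambda>x. f x $ i) \<in> borel_measurable M"
  shows "f \<in> borel_measurable M"
proof (subst borel_measurable_euclidean_space, intro ballI)
  fix b :: "real^2" assume "b \<in> Basis"
  then obtain i where "b = axis i 1" by (auto simp: Basis_vec_def)
  then show "(\<lambda>x. f x \<bullet> b) \<in> borel_measurable M" using assms[of i] by (simp add: inner_axis)
qed

lemma nth_borel_measurable [measurable]: "(\<lambda>x :: real^2. x $ i) \<in> borel_measurable borel"
  by (intro borel_measurable_continuous_onI continuous_intros)

lemma pair_borel_measurable [measurable]: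
  "(fst :: 'a::euclidean_space \<times> 'b::euclidean_space \<Rightarrow> 'a) \<in> borel_measurable borel"
  "(snd :: 'a::euclidean_space \<times> 'b::euclidean_space \<Rightarrow> 'b) \<in> borel_measurable borel"
  by (intro borel_measurable_continuous_onI continuous_intros)+

lemma cell_floor_measurable [measurable]: "cell_floor \<in> borel_measurable borel"
  by (rule vec_borel_measurable) (simp add: cell_floor_def)

lemma unfold_map_measurable [measurable]:
  assumes [measurable]: "f \<in> borel_measurable M" "g \<in> borel_measurable M"
  shows "(\<lambda>x. unfold_map d (f x) (g x)) \<in> borel_measurable M"
  unfolding unfold_map_def by measurable

lemma Zcell'_box: "Zcell' = box (\<chi> i. - 1 / 2) (\<chi> i. 1 / 2)"
  by (auto simp: Zcell'_def mem_box_cart)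

lemma open_Zcell': "open Zcell'" unfolding Zcell'_box by (rule open_box)

lemma Zcell'_measurable [measurable]: "Zcell' \<in> sets borel" by (simp add: open_Zcell')

lemma AE_off_grid: "AE x in lborel. off_grid x"
proof -
  have "AE x :: real^2 in lborel. x $ i + 1 / 2 \<noteq> of_int m" for i :: 2 and m :: int
  proof -
    have "negligible {x :: real^2. x \<bullet> axis i 1 = of_int m - 1 / 2}"
      by (rule negligible_standard_hyperplane) (simp add: axis_in_Basis_iff)
    then have "AE x in lebesgue. x \<notin> {x :: real^2. x \<bullet> axis i 1 = of_int m - 1 / 2}"
      by (intro AE_not_in) (simp add: negligible_iff_null_sets)
    then show ?thesis by (simp add: AE_completion_iff inner_axis algebra_simps)
  qed
  then have "AE x :: real^2 in lborel. \<forall>i :: 2. \<forall>m :: int. x $ i + 1 / 2 \<noteq> of_int m"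
    by (simp add: AE_all_countable)
  then show ?thesis by eventually_elim (auto simp: off_grid_def Ints_def)
qed

lemma cell_floor_int: "cell_floor x $ i = of_int \<lfloor>x $ i + 1 / 2\<rfloor>"
  by (simp add: cell_floor_def)

lemma cell_floor_bounds: "\<bar>x $ i - cell_floor x $ i\<bar> \<le> 1 / 2"
  unfolding cell_floor_int by linarith

text \<open>Off the grid, open and half-open cells contain the same points.\<close>

lemma in_cell_iff:
  assumes "off_grid y"
  shows "y - cell_floor x \<in> Zcell' \<longleftrightarrow> cell_floor x = cell_floor y"
proof -
  have ne: "y $ i + 1 / 2 \<noteq> of_int m" for i m using assms by (metis Ints_of_int off_grid_def)
  have "- 1 / 2 < y $ i - of_int m \<and> y $ i - of_int m < 1 / 2 \<longleftrightarrow> m = \<lfloor>y $ i + 1 / 2\<rfloor>" for i and m :: int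
  proof
    assume "- 1 / 2 < y $ i - of_int m \<and> y $ i - of_int m < 1 / 2"
    then have "\<lfloor>y $ i + 1 / 2\<rfloor> = m" by (intro floor_unique) linarith+
    then show "m = \<lfloor>y $ i + 1 / 2\<rfloor>" by simp
  next
    assume "m = \<lfloor>y $ i + 1 / 2\<rfloor>"
    then show "- 1 / 2 < y $ i - of_int m \<and> y $ i - of_int m < 1 / 2"
      using ne[of i m] by linarith
  qed
  from this[of _ "\<lfloor>x $ _ + 1 / 2\<rfloor>"] show ?thesis
    by (simp add: Zcell'_def cell_floor_int vec_eq_iff)
qed

lemma cell_index_eq:
  assumes "off_grid x"
  shows "lattice_vec (cell_index x) = cell_floor x"
proof -
  have iff: "x \<in> (+) (lattice_vec k) ` Zcell' \<longleftrightarrow> lattice_vec k = cell_floor x" for k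
  proof -
    have "x \<in> (+) (lattice_vec k) ` Zcell' \<longleftrightarrow> x - lattice_vec k \<in> Zcell'"
      by (auto simp: image_iff algebra_simps intro!: bexI[of _ "x - lattice_vec k"])
    also have "lattice_vec k = cell_floor (lattice_vec k)"
      by (simp add: lattice_vec_def cell_floor_def vec_eq_iff floor_unique)
    also have "x - cell_floor (lattice_vec k) \<in> Zcell' \<longleftrightarrow> cell_floor (lattice_vec k) = cell_floor x"
      by (rule in_cell_iff[OF assms])
    finally show ?thesis using \<open>lattice_vec k = cell_floor (lattice_vec k)\<close> by simp
  qed
  have "\<exists>!k. lattice_vec k = cell_floor x"
  proof
    show "lattice_vec (\<chi> i. \<lfloor>x $ i + 1 / 2\<rfloor>) = cell_floor x" by (simp add: lattice_vec_def cell_floor_def)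
    show "k = (\<chi> i. \<lfloor>x $ i + 1 / 2\<rfloor>)" if "lattice_vec k = cell_floor x" for k
      using that by (simp add: lattice_vec_def cell_floor_def vec_eq_iff)
  qed
  then show ?thesis unfolding cell_index_def iff by (rule theI')
qed

lemma unfold_point_eq:
  assumes "0 < \<epsilon>" "off_grid ((1 / \<epsilon> powr ell) *\<^sub>R x)"
  shows "unfold_point ell \<epsilon> x z = unfold_map (\<epsilon> powr ell) x z"
  using assms by (simp add: unfold_point_def unfold_map_def cell_index_eq)

lemma unfold_map_close:
  assumes d: "0 < d" and z: "z \<in> Zcell'"
  shows "norm (unfold_map d x z - x) \<le> 2 * d"
proof -
  have "\<bar>(unfold_map d x z - x) $ i\<bar> \<le> d" for i
  proof -
    have "(unfold_map d x z - x) $ i = d * (z $ i - ((1 / d) *\<^sub>R x $ i - cell_floor ((1 / d) *\<^sub>R x) $ i))"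
      using d by (simp add: unfold_map_def algebra_simps)
    moreover have "\<bar>z $ i - (((1 / d) *\<^sub>R x) $ i - cell_floor ((1 / d) *\<^sub>R x) $ i)\<bar> \<le> 1"
    proof -
      have "- 1 / 2 < z $ i" "z $ i < 1 / 2" using z by (auto simp: Zcell'_def)
      then show ?thesis using cell_floor_bounds[of "(1 / d) *\<^sub>R x" i] by linarith
    qed
    ultimately show ?thesis using d by (simp add: abs_mult mult_left_le)
  qed
  then have "(\<Sum>i\<in>UNIV. \<bar>(unfold_map d x z - x) $ i\<bar>) \<le> (\<Sum>i\<in>(UNIV :: 2 set). d)"
    by (intro sum_mono) auto
  then show ?thesis using norm_le_l1_cart[of "unfold_map d x z - x"] by simp
qed

section \<open>The unfolding map preserves Lebesgue measure\<close>

abbreviation umap0 :: "real \<Rightarrow> (real^2) \<times> (real^2) \<Rightarrow> real^2" where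
  "umap0 d p \<equiv> unfold_map d (fst p) (snd p)"

abbreviation umap1 :: "real \<Rightarrow> (real^2) \<times> ((real^2) \<times> 'c) \<Rightarrow> (real^2) \<times> 'c" where
  "umap1 d p \<equiv> (unfold_map d (fst p) (fst (snd p)), snd (snd p))"

lemma nn_integral_lborel_scale:
  fixes f :: "'a::euclidean_space \<Rightarrow> ennreal"
  assumes [measurable]: "f \<in> borel_measurable borel" and c: "0 < c"
  shows "(\<integral>\<^sup>+x. f x \<partial>lborel) = ennreal (c ^ DIM('a)) * (\<integral>\<^sup>+x. f (c *\<^sub>R x) \<partial>lborel)"
proof -
  have "(\<integral>\<^sup>+x. f x \<partial>lborel) = (\<integral>\<^sup>+x. f x \<partial>density (distr lborel borel (\<lambda>x. 0 + c *\<^sub>R x)) (\<lambda>_. ennreal (\<bar>c\<bar> ^ DIM('a))))"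
    using lborel_affine[of c "0 :: 'a"] c by simp
  also have "\<dots> = (\<integral>\<^sup>+x. ennreal (c ^ DIM('a)) * f (c *\<^sub>R x) \<partial>lborel)"
    using c by (simp add: nn_integral_density nn_integral_distr)
  finally show ?thesis by (simp add: nn_integral_cmult)
qed

lemma nn_integral_lborel_translate:
  fixes f :: "'a::euclidean_space \<Rightarrow> ennreal"
  assumes [measurable]: "f \<in> borel_measurable borel"
  shows "(\<integral>\<^sup>+x. f (t + x) \<partial>lborel) = (\<integral>\<^sup>+x. f x \<partial>lborel)"
proof -
  have "(\<integral>\<^sup>+x. f x \<partial>lborel) = (\<integral>\<^sup>+x. f x \<partial>distr lborel borel ((+) t))" by (simp add: lborel_distr_plus)
  also have "\<dots> = (\<integral>\<^sup>+x. f (t + x) \<partial>lborel)" by (simp add: nn_integral_distr)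
  finally show ?thesis by simp
qed

lemma emeasure_Zcell': "emeasure lborel Zcell' = 1"
proof -
  have "emeasure lborel Zcell' = ennreal (\<Prod>b\<in>Basis. ((\<chi> i. 1 / 2) - (\<chi> i. - 1 / 2) :: real^2) \<bullet> b)"
    unfolding Zcell'_box by (rule emeasure_lborel_box) (auto simp: Basis_vec_def inner_axis)
  also have "(\<Prod>b\<in>Basis. ((\<chi> i. 1 / 2) - (\<chi> i. - 1 / 2) :: real^2) \<bullet> b) = 1"
    by (rule prod.neutral) (auto simp: Basis_vec_def inner_axis)
  finally show ?thesis by simp
qed

lemma emeasure_same_cell: "emeasure lborel {x. cell_floor x = cell_floor y} = 1"
proof -
  define k where "k = cell_floor y"
  have meas: "{x. cell_floor x = k} \<in> sets borel" by measurable
  let ?l = "k - (\<chi> i. 1 / 2)" and ?u = "k + (\<chi> i. 1 / 2)"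
  have "box ?l ?u \<subseteq> {x. cell_floor x = k}"
  proof
    fix x assume x: "x \<in> box ?l ?u"
    have "cell_floor x $ i = k $ i" for i
    proof -
      have "\<lfloor>x $ i + 1 / 2\<rfloor> = \<lfloor>y $ i + 1 / 2\<rfloor>"
        using x by (intro floor_unique) (auto simp: mem_box_cart k_def cell_floor_int dest: spec[of _ i])
      then show ?thesis by (simp add: k_def cell_floor_int)
    qed
    then show "x \<in> {x. cell_floor x = k}" by (simp add: vec_eq_iff)
  qed
  moreover have "{x. cell_floor x = k} \<subseteq> cbox ?l ?u"
  proof
    fix x assume "x \<in> {x. cell_floor x = k}"
    then have le: "\<bar>x $ i - k $ i\<bar> \<le> 1 / 2" for i using cell_floor_bounds[of x i] by simp
    have "?l $ i \<le> x $ i \<and> x $ i \<le> ?u $ i" for i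
    proof
      show "?l $ i \<le> x $ i" using le[of i] unfolding vector_minus_component vec_lambda_beta by linarith
      show "x $ i \<le> ?u $ i" using le[of i] unfolding vector_add_component vec_lambda_beta by linarith
    qed
    then show "x \<in> cbox ?l ?u" by (simp add: mem_box_cart)
  qed
  moreover have "emeasure lborel (box ?l ?u) = 1" "emeasure lborel (cbox ?l ?u) = 1"
  proof -
    have p: "(\<Prod>b\<in>Basis. (?u - ?l) \<bullet> b) = 1"
      by (rule prod.neutral) (auto simp: Basis_vec_def inner_axis)
    have le: "?l \<bullet> b \<le> ?u \<bullet> b" if "b \<in> Basis" for b using that by (auto simp: Basis_vec_def inner_axis)
    show "emeasure lborel (box ?l ?u) = 1" "emeasure lborel (cbox ?l ?u) = 1"
      using emeasure_lborel_box[OF le] emeasure_lborel_cbox[OF le] p by simp_all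
  qed
  ultimately have "1 \<le> emeasure lborel {x. cell_floor x = k}" "emeasure lborel {x. cell_floor x = k} \<le> 1"
    using emeasure_mono[of "box ?l ?u" "{x. cell_floor x = k}" lborel] meas
      emeasure_mono[of "{x. cell_floor x = k}" "cbox ?l ?u" lborel] by simp_all
  then show ?thesis unfolding k_def by (rule antisym[rotated])
qed

text \<open>For \<open>d = 1\<close>, substitute \<open>y = cell_floor x + z\<close>: then \<open>z\<close> ranges over the unit cell iff \<open>x\<close> and \<open>y\<close> lie
  in the same cell. Tonelli's theorem leaves, for each \<open>y\<close>, the measure of the set of such \<open>x\<close>, which is
  \<open>1\<close>. The general case follows by scaling.\<close>

lemma nn_integral_unfold:
  assumes [measurable]: "F \<in> borel_measurable borel" and d: "0 < d"
  shows "(\<integral>\<^sup>+x. \<integral>\<^sup>+z. indicator Zcell' z * F (unfold_map d x z) \<partial>lborel \<partial>lborel) = (\<integral>\<^sup>+y. F y \<partial>lborel)"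
proof -
  have unit: "(\<integral>\<^sup>+x. \<integral>\<^sup>+z. indicator Zcell' z * G (cell_floor x + z) \<partial>lborel \<partial>lborel) = (\<integral>\<^sup>+y. G y \<partial>lborel)"
    if [measurable]: "G \<in> borel_measurable borel" for G :: "real^2 \<Rightarrow> ennreal"
  proof -
    have "(\<integral>\<^sup>+z. indicator Zcell' z * G (cell_floor x + z) \<partial>lborel)
       = (\<integral>\<^sup>+y. indicator Zcell' (y - cell_floor x) * G y \<partial>lborel)" for x
      using nn_integral_lborel_translate[of "\<lambda>y. indicator Zcell' (y - cell_floor x) * G y" "cell_floor x"] by simp
    then have "(\<integral>\<^sup>+x. \<integral>\<^sup>+z. indicator Zcell' z * G (cell_floor x + z) \<partial>lborel \<partial>lborel)
       = (\<integral>\<^sup>+x. \<integral>\<^sup>+y. indicator Zcell' (y - cell_floor x) * G y \<partial>lborel \<partial>lborel)" by simp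
    also have "\<dots> = (\<integral>\<^sup>+y. \<integral>\<^sup>+x. indicator Zcell' (y - cell_floor x) * G y \<partial>lborel \<partial>lborel)"
      by (rule lborel_pair.Fubini'[symmetric]) measurable
    also have "\<dots> = (\<integral>\<^sup>+y. G y \<partial>lborel)"
    proof (rule nn_integral_cong_AE, use AE_off_grid in eventually_elim)
      fix y assume y: "off_grid y"
      have "(\<integral>\<^sup>+x. indicator Zcell' (y - cell_floor x) * G y \<partial>lborel)
         = (\<integral>\<^sup>+x. G y * indicator {x. cell_floor x = cell_floor y} x \<partial>lborel)"
        by (intro nn_integral_cong) (auto simp: in_cell_iff[OF y] indicator_def)
      also have "\<dots> = G y" by (subst nn_integral_cmult_indicator) (simp_all add: emeasure_same_cell)
      finally show "(\<integral>\<^sup>+x. indicator Zcell' (y - cell_floor x) * G y \<partial>lborel) = G y" .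
    qed
    finally show ?thesis .
  qed
  have "(\<integral>\<^sup>+x. \<integral>\<^sup>+z. indicator Zcell' z * F (unfold_map d x z) \<partial>lborel \<partial>lborel)
    = ennreal (d ^ DIM(real^2)) * (\<integral>\<^sup>+x. \<integral>\<^sup>+z. indicator Zcell' z * F (unfold_map d (d *\<^sub>R x) z) \<partial>lborel \<partial>lborel)"
    using d by (subst nn_integral_lborel_scale[of _ d]) auto
  also have "\<dots> = ennreal (d ^ DIM(real^2)) * (\<integral>\<^sup>+x. \<integral>\<^sup>+z. indicator Zcell' z * F (d *\<^sub>R (cell_floor x + z)) \<partial>lborel \<partial>lborel)"
    using d by (simp add: unfold_map_def scaleR_add_right)
  also have "\<dots> = (\<integral>\<^sup>+y. F y \<partial>lborel)"
    using unit[of "\<lambda>y. F (d *\<^sub>R y)"] nn_integral_lborel_scale[OF assms(1) d] by simp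
  finally show ?thesis .
qed

lemma nn_integral_lborel_pair:
  fixes f :: "'a::euclidean_space \<times> 'b::euclidean_space \<Rightarrow> ennreal"
  assumes "f \<in> borel_measurable borel"
  shows "(\<integral>\<^sup>+p. f p \<partial>lborel) = (\<integral>\<^sup>+x. \<integral>\<^sup>+y. f (x, y) \<partial>lborel \<partial>lborel)"
proof -
  have "f \<in> borel_measurable (lborel \<Otimes>\<^sub>M lborel)" using assms by (simp add: lborel_prod)
  from lborel.nn_integral_fst[OF this] show ?thesis by (simp add: lborel_prod)
qed

lemma nn_integral_unfold0:
  assumes [measurable]: "F \<in> borel_measurable borel" and d: "0 < d"
  shows "(\<integral>\<^sup>+p. indicator Zcell' (snd p) * F (umap0 d p) \<partial>lborel) = (\<integral>\<^sup>+y. F y \<partial>lborel)"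
  by (subst nn_integral_lborel_pair) (simp_all add: nn_integral_unfold[OF assms])

lemma nn_integral_unfold1:
  fixes F :: "(real^2) \<times> 'c::euclidean_space \<Rightarrow> ennreal"
  assumes [measurable]: "F \<in> borel_measurable borel" and d: "0 < d"
  shows "(\<integral>\<^sup>+p. indicator Zcell' (fst (snd p)) * F (umap1 d p) \<partial>lborel)
    = (\<integral>\<^sup>+q. F q \<partial>lborel)"
proof -
  have [measurable]: "F \<in> borel_measurable (borel \<Otimes>\<^sub>M borel)" by (simp add: borel_prod)
  have "(\<integral>\<^sup>+p. indicator Zcell' (fst (snd p)) * F (umap1 d p) \<partial>lborel)
    = (\<integral>\<^sup>+x. \<integral>\<^sup>+q. indicator Zcell' (fst q) * F (unfold_map d x (fst q), snd q) \<partial>lborel \<partial>lborel)"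
    by (subst nn_integral_lborel_pair) simp_all
  also have "\<dots> = (\<integral>\<^sup>+x. \<integral>\<^sup>+z. \<integral>\<^sup>+w. indicator Zcell' z * F (unfold_map d x z, w) \<partial>lborel \<partial>lborel \<partial>lborel)"
    by (intro nn_integral_cong, subst nn_integral_lborel_pair) simp_all
  also have "\<dots> = (\<integral>\<^sup>+x. \<integral>\<^sup>+z. indicator Zcell' z * (\<integral>\<^sup>+w. F (unfold_map d x z, w) \<partial>lborel) \<partial>lborel \<partial>lborel)"
    by (intro nn_integral_cong nn_integral_cmult) simp
  also have "\<dots> = (\<integral>\<^sup>+y. (\<integral>\<^sup>+w. F (y, w) \<partial>lborel) \<partial>lborel)"
    by (rule nn_integral_unfold[OF _ d]) simp
  also have "\<dots> = (\<integral>\<^sup>+q. F q \<partial>lborel)"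
    by (rule nn_integral_lborel_pair[symmetric]) simp
  finally show ?thesis .
qed

lemma AE_of_indicator_nn_integral_0:
  assumes "(\<integral>\<^sup>+x. indicator A (f x) \<partial>lborel) = 0"
  assumes [measurable]: "(\<lambda>x. indicator A (f x) :: ennreal) \<in> borel_measurable borel"
  shows "AE x in lborel. f x \<notin> A"
proof -
  have "AE x in lborel. (indicator A (f x) :: ennreal) = 0"
    using assms by (subst (asm) nn_integral_0_iff_AE) auto
  then show ?thesis by eventually_elim (auto simp: indicator_def split: if_splits)
qed

lemma AE_lborel_borel_null:
  assumes "AE x in lborel. P x"
  obtains N where "N \<in> sets borel" "emeasure lborel N = 0" "\<And>x. x \<notin> N \<Longrightarrow> P x"
  using assms unfolding eventually_ae_filter null_sets_def by auto

text \<open>Sets of measure zero have preimages of measure zero under the unfolding map, so up to null sets the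
  unfolding of a function does not depend on its representative.\<close>

lemma AE_unfold0:
  assumes "AE y in lborel. P y" and d: "0 < d"
  shows "AE p in lborel. snd p \<in> Zcell' \<longrightarrow> P (umap0 d p)"
proof -
  obtain N where N [measurable]: "N \<in> sets borel" and N0: "emeasure lborel N = 0" and P: "\<And>x. x \<notin> N \<Longrightarrow> P x"
    using AE_lborel_borel_null[OF assms(1)] by blast
  have "(\<integral>\<^sup>+p. indicator Zcell' (snd p) * indicator N (umap0 d p) \<partial>lborel) = 0"
    using nn_integral_unfold0[of "indicator N" d] N0 d by simp
  then have "AE p in lborel. (indicator Zcell' (snd p) * indicator N (umap0 d p) :: ennreal) = 0"
    by (subst (asm) nn_integral_0_iff_AE) auto
  then show ?thesis by eventually_elim (use P in \<open>auto simp: indicator_def split: if_splits\<close>)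
qed

lemma AE_unfold1:
  fixes P :: "(real^2) \<times> 'c::euclidean_space \<Rightarrow> bool"
  assumes "AE q in lborel. P q" and d: "0 < d"
  shows "AE p in lborel. fst (snd p) \<in> Zcell' \<longrightarrow> P (umap1 d p)"
proof -
  obtain N where N: "N \<in> sets borel" and N0: "emeasure lborel N = 0" and P: "\<And>x. x \<notin> N \<Longrightarrow> P x"
    using AE_lborel_borel_null[OF assms(1)] by blast
  have [measurable]: "N \<in> sets (borel \<Otimes>\<^sub>M borel)" using N unfolding borel_prod .
  have "(\<integral>\<^sup>+p. indicator Zcell' (fst (snd p)) * indicator N (umap1 d p) \<partial>lborel) = 0"
    using nn_integral_unfold1[of "indicator N" d] N N0 d by simp
  then have "AE p in lborel. (indicator Zcell' (fst (snd p)) * indicator N (umap1 d p) :: ennreal) = 0"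
    by (subst (asm) nn_integral_0_iff_AE) auto
  then show ?thesis by eventually_elim (use P in \<open>auto simp: indicator_def split: if_splits\<close>)
qed

section \<open>Strong convergence of unfolded sequences\<close>

text \<open>Pointwise convergence is continuity of \<open>\<phi>\<close>. The integrands vanish outside of a fixed bounded set,
  because \<open>\<phi>\<close> has compact support and the unfolding moves points by a bounded amount.\<close>

lemma unfold_test_function_tendsto:
  assumes \<phi>: "\<phi> \<in> test_functions UNIV" and d: "\<And>n. 0 < d n" "d \<longlonglongrightarrow> 0"
  shows "(\<lambda>n. \<integral>\<^sup>+p. ennreal (indicator Zcell' (snd p) * (\<phi> (umap0 (d n) p) - \<phi> (fst p))\<^sup>2) \<partial>lborel) \<longlonglongrightarrow> 0"
proof -
  have [measurable]: "\<phi> \<in> borel_measurable borel" using test_function_borel[OF \<phi>] .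
  obtain M where M: "\<And>x. \<bar>\<phi> x\<bar> \<le> M" using test_function_bounded[OF \<phi>] by blast
  obtain D where D: "\<And>n. d n \<le> D"
    using convergent_imp_Bseq[of d] d(2) unfolding convergent_def Bseq_def by (metis abs_le_D1 real_norm_def)
  have "bounded {x. \<phi> x \<noteq> 0}"
    using \<phi> unfolding test_functions_def by (metis (mono_tags, lifting) bounded_closure bounded_subset closure_subset compact_imp_bounded mem_Collect_eq)
  then obtain R where R: "\<And>x. \<phi> x \<noteq> 0 \<Longrightarrow> norm x \<le> R" by (auto simp: bounded_iff)
  define w where "w p = (2 * M)\<^sup>2 * indicator (cball 0 (R + 2 * D) \<times> Zcell') p" for p :: "(real^2) \<times> (real^2)"
  have bd: "indicator Zcell' (snd p) * (\<phi> (umap0 (d n) p) - \<phi> (fst p))\<^sup>2 \<le> w p" for n p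
  proof (cases "p \<in> cball 0 (R + 2 * D) \<times> Zcell'")
    case True
    have "\<bar>\<phi> (umap0 (d n) p) - \<phi> (fst p)\<bar> \<le> 2 * M"
      using M[of "umap0 (d n) p"] M[of "fst p"] by linarith
    then have "(\<phi> (umap0 (d n) p) - \<phi> (fst p))\<^sup>2 \<le> (2 * M)\<^sup>2"
      using power_mono[of "\<bar>\<phi> (umap0 (d n) p) - \<phi> (fst p)\<bar>" "2 * M" 2] by simp
    then show ?thesis using True by (auto simp: w_def indicator_def)
  next
    case False
    show ?thesis
    proof (cases "snd p \<in> Zcell'")
      case True
      with False have far: "R + 2 * D < norm (fst p)" by (cases p) auto
      have "norm (umap0 (d n) p - fst p) \<le> 2 * D"
        using unfold_map_close[OF d(1)[of n] True, of "fst p"] D[of n] by linarith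
      then have "R < norm (umap0 (d n) p)"
        using far norm_triangle_ineq2[of "fst p" "umap0 (d n) p"] by (simp add: norm_minus_commute)
      moreover have "0 \<le> D" using D[of 0] d(1)[of 0] by linarith
      ultimately have "\<phi> (umap0 (d n) p) = 0" "\<phi> (fst p) = 0" using R far by force+
      then show ?thesis by (simp add: w_def)
    qed (simp add: w_def)
  qed
  have "(\<lambda>n. \<integral>\<^sup>+p. ennreal (indicator Zcell' (snd p) * (\<phi> (umap0 (d n) p) - \<phi> (fst p))\<^sup>2) \<partial>lborel)
    \<longlonglongrightarrow> (\<integral>\<^sup>+p. 0 \<partial>(lborel :: ((real^2) \<times> (real^2)) measure))"
  proof (rule nn_integral_dominated_convergence[where w="\<lambda>p. ennreal (w p)"])
    have C: "cball 0 (R + 2 * D) \<times> Zcell' \<in> sets (borel :: ((real^2) \<times> (real^2)) measure)"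
      by (simp add: borel_prod[symmetric])
    have "emeasure lborel (cball 0 (R + 2 * D) \<times> Zcell' :: ((real^2) \<times> (real^2)) set) < \<infinity>"
      by (intro emeasure_bounded_finite bounded_Times) (auto simp: Zcell'_box)
    then have "integrable lborel w" unfolding w_def using C by (intro integrable_mult_right integrable_real_indicator) auto
    then show "(\<integral>\<^sup>+p. ennreal (w p) \<partial>lborel) < \<infinity>" by (subst nn_integral_eq_integral) (auto simp: w_def)
    show "(\<lambda>p. ennreal (w p)) \<in> borel_measurable lborel" unfolding w_def using C by simp
    show "AE p in lborel. ennreal (indicator Zcell' (snd p) * (\<phi> (umap0 (d n) p) - \<phi> (fst p))\<^sup>2) \<le> ennreal (w p)" for n
      using bd by (intro AE_I2 ennreal_leI) auto
    show "AE p in lborel. (\<lambda>n. ennreal (indicator Zcell' (snd p) * (\<phi> (umap0 (d n) p) - \<phi> (fst p))\<^sup>2)) \<longlonglongrightarrow> 0"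
    proof (rule AE_I2)
      fix p :: "(real^2) \<times> (real^2)"
      show "(\<lambda>n. ennreal (indicator Zcell' (snd p) * (\<phi> (umap0 (d n) p) - \<phi> (fst p))\<^sup>2)) \<longlonglongrightarrow> 0"
      proof (cases "snd p \<in> Zcell'")
        case True
        have "(\<lambda>n. umap0 (d n) p - fst p) \<longlonglongrightarrow> 0"
        proof (rule Lim_null_comparison)
          show "\<forall>\<^sub>F n in sequentially. norm (umap0 (d n) p - fst p) \<le> 2 * d n"
            using unfold_map_close[OF d(1) True] by simp
          show "(\<lambda>n. 2 * d n) \<longlonglongrightarrow> 0" using tendsto_mult_right_zero[OF d(2), of 2] by simp
        qed
        then have "(\<lambda>n. umap0 (d n) p) \<longlonglongrightarrow> fst p" by (simp add: LIM_zero_iff)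
        then have "(\<lambda>n. \<phi> (umap0 (d n) p)) \<longlonglongrightarrow> \<phi> (fst p)"
          using test_function_continuous[OF \<phi>] by (intro isCont_tendsto_compose[of _ \<phi>]) (auto simp: continuous_on_eq_continuous_at)
        then have "(\<lambda>n. indicator Zcell' (snd p) * (\<phi> (umap0 (d n) p) - \<phi> (fst p))\<^sup>2)
          \<longlonglongrightarrow> indicator Zcell' (snd p) * (\<phi> (fst p) - \<phi> (fst p))\<^sup>2" by (intro tendsto_intros)
        then show ?thesis by (intro tendsto_ennrealI[where x=0, simplified]) simp
      qed simp
    qed
  qed auto
  then show ?thesis by simp
qed

text \<open>Replace \<open>F n\<close> by \<open>G\<close> and \<open>G\<close> by a test function \<open>\<phi>\<close>, both before and after unfolding. Unfolding
  preserves these errors, and the unit cell has measure \<open>1\<close>.\<close>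

theorem unfold_strong_convergence:
  fixes F :: "nat \<Rightarrow> real^2 \<Rightarrow> real"
  assumes [measurable]: "\<And>n. F n \<in> borel_measurable borel" "G \<in> borel_measurable borel"
    and G: "integrable lborel (\<lambda>x. (G x)\<^sup>2)"
    and lim: "(\<lambda>n. \<integral>\<^sup>+x. ennreal ((F n x - G x)\<^sup>2) \<partial>lborel) \<longlonglongrightarrow> 0"
    and d: "\<And>n. 0 < d n" "d \<longlonglongrightarrow> 0"
  shows "(\<lambda>n. \<integral>\<^sup>+p. ennreal (indicator Zcell' (snd p) * (F n (umap0 (d n) p) - G (fst p))\<^sup>2) \<partial>lborel) \<longlonglongrightarrow> 0"
proof -
  have small: "\<forall>\<^sub>F n in sequentially. (\<integral>\<^sup>+p. ennreal (indicator Zcell' (snd p) * (F n (umap0 (d n) p) - G (fst p))\<^sup>2) \<partial>lborel)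
      \<le> ennreal (16 * e)" if e: "0 < e" for e :: real
  proof -
    have G_rep: "borel_rep UNIV G G" by (auto simp: borel_rep_def)
    have "G \<in> L2 UNIV" using borel_rep_L2_iff[OF _ G_rep] G by simp
    then obtain \<phi> where \<phi>: "\<phi> \<in> test_functions UNIV" and near: "L2_dist_sq UNIV G \<phi> < e"
      using test_functions_dense_L2[OF open_UNIV _ e] by blast
    have [measurable]: "\<phi> \<in> borel_measurable borel" using test_function_borel[OF \<phi>] .
    have dif: "integrable lborel (\<lambda>x. (G x - \<phi> x)\<^sup>2)"
      using square_integrable_lin[of G lborel \<phi> 1 "-1"] G test_function_square_integrable[OF \<phi>] by simp
    have rep: "borel_rep UNIV (\<lambda>x. G x - \<phi> x) (\<lambda>x. G x - \<phi> x)" by (auto simp: borel_rep_def)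
    have near': "(\<integral>\<^sup>+x. ennreal ((G x - \<phi> x)\<^sup>2) \<partial>lborel) \<le> ennreal e"
      using near borel_rep_L2ip[OF _ rep rep] dif
      by (simp add: nn_integral_eq_integral power2_eq_square ennreal_leI)
    have ev1: "\<forall>\<^sub>F n in sequentially. (\<integral>\<^sup>+x. ennreal ((F n x - G x)\<^sup>2) \<partial>lborel) < ennreal e"
      using e by (intro order_tendstoD(2)[OF lim]) simp
    have ev2: "\<forall>\<^sub>F n in sequentially. (\<integral>\<^sup>+p. ennreal (indicator Zcell' (snd p) * (\<phi> (umap0 (d n) p) - \<phi> (fst p))\<^sup>2) \<partial>lborel) < ennreal e"
      using e by (intro order_tendstoD(2)[OF unfold_test_function_tendsto[OF \<phi> d]]) simp
    from ev1 ev2 show ?thesis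
    proof eventually_elim
      case (elim n)
      let ?T = "\<lambda>p. umap0 (d n) p" and ?\<chi> = "\<lambda>p. indicator Zcell' (snd p) :: real"
      \<comment> \<open>Four differences, each with the factor \<open>4\<close> from squaring a sum of four terms: hence \<open>16\<close>.\<close>
      have pt: "?\<chi> p * (F n (?T p) - G (fst p))\<^sup>2 \<le> 4 * (?\<chi> p * (F n (?T p) - G (?T p))\<^sup>2) + 4 * (?\<chi> p * (G (?T p) - \<phi> (?T p))\<^sup>2)
          + 4 * (?\<chi> p * (\<phi> (?T p) - \<phi> (fst p))\<^sup>2) + 4 * (?\<chi> p * (G (fst p) - \<phi> (fst p))\<^sup>2)" for p
      proof -
        have "(a + b + c + k)\<^sup>2 \<le> 4 * a\<^sup>2 + 4 * b\<^sup>2 + 4 * c\<^sup>2 + 4 * k\<^sup>2" for a b c k :: real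
          using square_add_le[of "a + b" "c + k"] square_add_le[of a b] square_add_le[of c k] by (simp add: add.assoc)
        from this[of "F n (?T p) - G (?T p)" "G (?T p) - \<phi> (?T p)" "\<phi> (?T p) - \<phi> (fst p)" "\<phi> (fst p) - G (fst p)"]
        have "(F n (?T p) - G (fst p))\<^sup>2 \<le> 4 * (F n (?T p) - G (?T p))\<^sup>2 + 4 * (G (?T p) - \<phi> (?T p))\<^sup>2
          + 4 * (\<phi> (?T p) - \<phi> (fst p))\<^sup>2 + 4 * (G (fst p) - \<phi> (fst p))\<^sup>2" by (simp add: power2_commute)
        then show ?thesis by (simp add: indicator_def)
      qed
      have "(\<integral>\<^sup>+p. ennreal (?\<chi> p * (F n (?T p) - G (fst p))\<^sup>2) \<partial>lborel)
        \<le> (\<integral>\<^sup>+p. 4 * ennreal (?\<chi> p * (F n (?T p) - G (?T p))\<^sup>2) + 4 * ennreal (?\<chi> p * (G (?T p) - \<phi> (?T p))\<^sup>2)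
          + 4 * ennreal (?\<chi> p * (\<phi> (?T p) - \<phi> (fst p))\<^sup>2) + 4 * ennreal (?\<chi> p * (G (fst p) - \<phi> (fst p))\<^sup>2) \<partial>lborel)"
      proof (rule nn_integral_mono)
        fix p
        have "ennreal (?\<chi> p * (F n (?T p) - G (fst p))\<^sup>2) \<le> ennreal (4 * (?\<chi> p * (F n (?T p) - G (?T p))\<^sup>2) + 4 * (?\<chi> p * (G (?T p) - \<phi> (?T p))\<^sup>2)
          + 4 * (?\<chi> p * (\<phi> (?T p) - \<phi> (fst p))\<^sup>2) + 4 * (?\<chi> p * (G (fst p) - \<phi> (fst p))\<^sup>2))"
          using pt by (rule ennreal_leI)
        then show "ennreal (?\<chi> p * (F n (?T p) - G (fst p))\<^sup>2) \<le> 4 * ennreal (?\<chi> p * (F n (?T p) - G (?T p))\<^sup>2) + 4 * ennreal (?\<chi> p * (G (?T p) - \<phi> (?T p))\<^sup>2)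
          + 4 * ennreal (?\<chi> p * (\<phi> (?T p) - \<phi> (fst p))\<^sup>2) + 4 * ennreal (?\<chi> p * (G (fst p) - \<phi> (fst p))\<^sup>2)"
          by (simp add: ennreal_plus ennreal_mult' del: ennreal_plus[symmetric])
      qed
      also have "\<dots> = 4 * (\<integral>\<^sup>+p. ennreal (?\<chi> p * (F n (?T p) - G (?T p))\<^sup>2) \<partial>lborel) + 4 * (\<integral>\<^sup>+p. ennreal (?\<chi> p * (G (?T p) - \<phi> (?T p))\<^sup>2) \<partial>lborel)
          + 4 * (\<integral>\<^sup>+p. ennreal (?\<chi> p * (\<phi> (?T p) - \<phi> (fst p))\<^sup>2) \<partial>lborel) + 4 * (\<integral>\<^sup>+p. ennreal (?\<chi> p * (G (fst p) - \<phi> (fst p))\<^sup>2) \<partial>lborel)"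
        by (simp add: nn_integral_add nn_integral_cmult)
      also have "\<dots> \<le> 4 * ennreal e + 4 * ennreal e + 4 * ennreal e + 4 * ennreal e"
      proof (intro add_mono mult_left_mono)
        have *: "(\<integral>\<^sup>+p. ennreal (?\<chi> p * H (?T p)) \<partial>lborel) = (\<integral>\<^sup>+x. ennreal (H x) \<partial>lborel)"
          if [measurable]: "H \<in> borel_measurable borel" for H
        proof -
          have "ennreal (?\<chi> p * H (?T p)) = indicator Zcell' (snd p) * ennreal (H (?T p))" for p
            by (simp add: indicator_def)
          then show ?thesis using nn_integral_unfold0[of "\<lambda>y. ennreal (H y)" "d n"] d(1) by simp
        qed
        show "(\<integral>\<^sup>+p. ennreal (?\<chi> p * (F n (?T p) - G (?T p))\<^sup>2) \<partial>lborel) \<le> ennreal e"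
          using *[of "\<lambda>y. (F n y - G y)\<^sup>2"] elim(1) by simp
        show "(\<integral>\<^sup>+p. ennreal (?\<chi> p * (G (?T p) - \<phi> (?T p))\<^sup>2) \<partial>lborel) \<le> ennreal e"
          using *[of "\<lambda>y. (G y - \<phi> y)\<^sup>2"] near' by simp
        show "(\<integral>\<^sup>+p. ennreal (?\<chi> p * (\<phi> (?T p) - \<phi> (fst p))\<^sup>2) \<partial>lborel) \<le> ennreal e" using elim(2) by simp
        have "(\<integral>\<^sup>+p. ennreal (?\<chi> p * (G (fst p) - \<phi> (fst p))\<^sup>2) \<partial>lborel)
          = (\<integral>\<^sup>+x. \<integral>\<^sup>+z. ennreal ((G x - \<phi> x)\<^sup>2) * indicator Zcell' z \<partial>lborel \<partial>lborel)"
          by (subst nn_integral_lborel_pair) (auto intro!: nn_integral_cong simp: indicator_def)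
        also have "\<dots> = (\<integral>\<^sup>+x. ennreal ((G x - \<phi> x)\<^sup>2) \<partial>lborel)"
          by (simp add: nn_integral_cmult_indicator emeasure_Zcell')
        finally show "(\<integral>\<^sup>+p. ennreal (?\<chi> p * (G (fst p) - \<phi> (fst p))\<^sup>2) \<partial>lborel) \<le> ennreal e" using near' by simp
      qed auto
      also have "\<dots> = ennreal (16 * e)" using e by (simp flip: ennreal_plus ennreal_numeral ennreal_mult)
      finally show ?case .
    qed
  qed
  show ?thesis
  proof (rule order_tendstoI)
    fix a :: ennreal assume "0 < a"
    then obtain e :: real where e: "0 < e" "ennreal e < a"
      using dense[of 0 a] by (metis ennreal_cases ennreal_less_zero_iff not_less_iff_gr_or_eq top.not_eq_extremum)
    from small[of "e / 16"] e show "\<forall>\<^sub>F n in sequentially. (\<integral>\<^sup>+p. ennreal (indicator Zcell' (snd p) * (F n (umap0 (d n) p) - G (fst p))\<^sup>2) \<partial>lborel) < a"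
      by (auto elim!: eventually_mono)
  qed simp
qed

section \<open>Square integrable functions with values in a space of square integrable functions\<close>

text \<open>By Fubini's theorem, almost every section of a representative represents the section.\<close>

lemma L2_sections:
  fixes A :: "'a::euclidean_space set" and B :: "'b::euclidean_space set"
  assumes A: "A \<in> sets borel" and B: "B \<in> sets borel" and Q: "borel_rep (A \<times> B) q Q"
  shows AE_section_rep: "AE x in lborel. x \<in> A \<longrightarrow> borel_rep B (\<lambda>z. q (x, z)) (\<lambda>z. Q (x, z))"
    and section_norm_rep: "borel_rep A (\<lambda>x. L2norm B (\<lambda>z. q (x, z))) (\<lambda>x. sqrt (LBINT z. (Q (x, z))\<^sup>2))"
proof -
  have Q0: "Q (x, z) = 0" if "x \<notin> A \<or> z \<notin> B" for x z using Q that by (auto simp: borel_rep_def)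
  have [measurable]: "Q \<in> borel_measurable (borel \<Otimes>\<^sub>M borel)" using Q by (simp add: borel_rep_def borel_prod)
  have "AE p in lborel \<Otimes>\<^sub>M lborel. p \<in> A \<times> B \<longrightarrow> q p = Q p"
    using Q unfolding borel_rep_def lborel_prod by blast
  then have "AE x in lborel. AE z in lborel. (x, z) \<in> A \<times> B \<longrightarrow> q (x, z) = Q (x, z)"
    by (rule lborel_pair.AE_pair)
  then show 1: "AE x in lborel. x \<in> A \<longrightarrow> borel_rep B (\<lambda>z. q (x, z)) (\<lambda>z. Q (x, z))"
    by eventually_elim (auto simp: borel_rep_def Q0)
  show "borel_rep A (\<lambda>x. L2norm B (\<lambda>z. q (x, z))) (\<lambda>x. sqrt (LBINT z. (Q (x, z))\<^sup>2))"
    unfolding borel_rep_def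
  proof (intro conjI allI impI)
    show "(\<lambda>x. sqrt (LBINT z. (Q (x, z))\<^sup>2)) \<in> borel_measurable borel" by measurable
    show "sqrt (LBINT z. (Q (x, z))\<^sup>2) = 0" if "x \<notin> A" for x using that Q0 by simp
    show "AE x in lborel. x \<in> A \<longrightarrow> L2norm B (\<lambda>z. q (x, z)) = sqrt (LBINT z. (Q (x, z))\<^sup>2)"
      using 1
    proof eventually_elim
      case (elim x)
      show ?case
      proof
        assume "x \<in> A"
        with elim have r: "borel_rep B (\<lambda>z. q (x, z)) (\<lambda>z. Q (x, z))" by simp
        show "L2norm B (\<lambda>z. q (x, z)) = sqrt (LBINT z. (Q (x, z))\<^sup>2)"
          unfolding L2norm_eq borel_rep_L2ip[OF B r r] by (simp add: power2_eq_square)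
      qed
    qed
  qed
qed

text \<open>Tonelli's theorem, applied to a Borel representative.\<close>

theorem L2_vec_L2:
  fixes A :: "'a::euclidean_space set" and B :: "'b::euclidean_space set"
  assumes A: "A \<in> sets borel" and B: "B \<in> sets borel"
  shows L2_vec_eq: "L2_vec A B (L2 B) = L2 (A \<times> B)"
    and L2_vec_norm_eq: "q \<in> L2 (A \<times> B) \<Longrightarrow> L2_vec_norm A B q = L2norm (A \<times> B) q"
proof -
  have AB: "A \<times> B \<in> sets borel" using A B by (simp add: borel_prod[symmetric])
  have sq: "(sqrt (LBINT z. (Q (x, z))\<^sup>2))\<^sup>2 = (LBINT z. (Q (x, z))\<^sup>2)" for Q :: "'a \<times> 'b \<Rightarrow> real" and x
    by simp
  have 1: "q \<in> L2_vec A B (L2 B) \<and> L2_vec_norm A B q = L2norm (A \<times> B) q" if q: "q \<in> L2 (A \<times> B)" for q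
  proof -
    obtain Q where Q: "borel_rep (A \<times> B) q Q" "Q \<in> borel_measurable borel"
      "\<And>p. p \<notin> A \<times> B \<Longrightarrow> Q p = 0" "integrable lborel (\<lambda>p. (Q p)\<^sup>2)"
      by (rule L2_rep[OF AB q]) (rule that)
    have Q2: "integrable (lborel \<Otimes>\<^sub>M lborel) (\<lambda>(x, z). (Q (x, z))\<^sup>2)" using Q(4) by (simp add: lborel_prod case_prod_beta')
    note rep = section_norm_rep[OF A B Q(1)]
    have "AE x in lborel. integrable lborel (\<lambda>z. (Q (x, z))\<^sup>2)" using lborel_pair.AE_integrable_fst[OF Q2] by simp
    with AE_section_rep[OF A B Q(1)] have "AE x in lborel. x \<in> A \<longrightarrow> (\<lambda>z. q (x, z)) \<in> L2 B"
      by eventually_elim (use borel_rep_L2_iff[OF B] in blast)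
    moreover have fst: "integrable lborel (\<lambda>x. LBINT z. (Q (x, z))\<^sup>2)" using lborel_pair.integrable_fst[OF Q2] by simp
    then have "(\<lambda>x. L2norm B (\<lambda>z. q (x, z))) \<in> L2 A" using borel_rep_L2_iff[OF A rep] by (simp add: sq)
    ultimately have "q \<in> L2_vec A B (L2 B)"
      using q by (auto simp: L2_vec_def L2_iff[of q] AE_lebesgue_on_iff[OF A])
    moreover have "L2_vec_norm A B q = sqrt (LBINT x. (LBINT z. (Q (x, z))\<^sup>2))"
      unfolding L2_vec_norm_def L2norm_eq[of A] borel_rep_L2ip[OF A rep rep] by (simp flip: power2_eq_square)
    then have "L2_vec_norm A B q = sqrt (LBINT p. (Q p)\<^sup>2)"
      using lborel_pair.integral_fst[OF Q2] by (simp add: lborel_prod case_prod_beta')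
    then have "L2_vec_norm A B q = L2norm (A \<times> B) q"
      unfolding L2norm_eq[of "A \<times> B"] borel_rep_L2ip[OF AB Q(1) Q(1)] by (simp add: power2_eq_square)
    ultimately show ?thesis by blast
  qed
  have 2: "q \<in> L2 (A \<times> B)" if q: "q \<in> L2_vec A B (L2 B)" for q
  proof -
    obtain Q where Q: "borel_rep (A \<times> B) q Q" using borel_rep_exists[OF AB, of q] q by (auto simp: L2_vec_def)
    have Qb [measurable]: "Q \<in> borel_measurable borel" using Q by (simp add: borel_rep_def)
    have Q0: "Q (x, z) = 0" if "x \<notin> A" for x z using Q that by (auto simp: borel_rep_def)
    note rep = section_norm_rep[OF A B Q]
    have "AE x in lborel. x \<in> A \<longrightarrow> (\<lambda>z. q (x, z)) \<in> L2 B"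
      using q A by (simp add: L2_vec_def AE_lebesgue_on_iff)
    with AE_section_rep[OF A B Q] have "AE x in lborel. x \<in> A \<longrightarrow> integrable lborel (\<lambda>z. (Q (x, z))\<^sup>2)"
      by eventually_elim (use borel_rep_L2_iff[OF B] in blast)
    then have eq: "AE x in lborel. (\<integral>\<^sup>+z. ennreal ((Q (x, z))\<^sup>2) \<partial>lborel) = ennreal (LBINT z. (Q (x, z))\<^sup>2)"
    proof eventually_elim
      case (elim x)
      then show ?case by (cases "x \<in> A") (simp_all add: nn_integral_eq_integral Q0)
    qed
    have int: "integrable lborel (\<lambda>x. LBINT z. (Q (x, z))\<^sup>2)"
      using q borel_rep_L2_iff[OF A rep] by (simp add: L2_vec_def sq)
    have "(\<integral>\<^sup>+p. ennreal ((Q p)\<^sup>2) \<partial>lborel) = (\<integral>\<^sup>+x. \<integral>\<^sup>+z. ennreal ((Q (x, z))\<^sup>2) \<partial>lborel \<partial>lborel)"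
      by (rule nn_integral_lborel_pair) simp
    also have "\<dots> = (\<integral>\<^sup>+x. ennreal (LBINT z. (Q (x, z))\<^sup>2) \<partial>lborel)" using eq by (rule nn_integral_cong_AE)
    also have "\<dots> < \<infinity>" using int by (subst nn_integral_eq_integral) auto
    finally have "integrable lborel (\<lambda>p. (Q p)\<^sup>2)" by (intro integrableI_bounded) auto
    then show ?thesis using borel_rep_L2_iff[OF AB Q] by simp
  qed
  show "L2_vec A B (L2 B) = L2 (A \<times> B)" using 1 2 by blast
  show "q \<in> L2 (A \<times> B) \<Longrightarrow> L2_vec_norm A B q = L2norm (A \<times> B) q" using 1 by blast
qed

section \<open>Null sets and integrals under scaling and unfolding\<close>

lemma AE_lborel_scale:
  fixes P :: "'a::euclidean_space \<Rightarrow> bool"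
  assumes "AE y in lborel. P y" and c: "0 < c"
  shows "AE x in lborel. P (c *\<^sub>R x)"
proof -
  obtain N where N [measurable]: "N \<in> sets borel" and N0: "emeasure lborel N = 0" and P: "\<And>x. x \<notin> N \<Longrightarrow> P x"
    using AE_lborel_borel_null[OF assms(1)] by blast
  have "ennreal (c ^ DIM('a)) * (\<integral>\<^sup>+x. indicator N (c *\<^sub>R x) \<partial>lborel) = 0"
    using nn_integral_lborel_scale[of "indicator N" c] c N0 by simp
  then have "(\<integral>\<^sup>+x. indicator N (c *\<^sub>R x) \<partial>lborel) = 0" using c by simp
  then have "AE x in lborel. c *\<^sub>R x \<notin> N" by (rule AE_of_indicator_nn_integral_0) measurable
  then show ?thesis by eventually_elim (rule P)
qed

lemma AE_lborel_fst:
  fixes P :: "'a::euclidean_space \<Rightarrow> bool"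
  assumes "AE x in lborel. P x"
  shows "AE p in (lborel :: ('a \<times> 'b::euclidean_space) measure). P (fst p)"
proof -
  obtain N where N [measurable]: "N \<in> sets borel" and N0: "emeasure lborel N = 0" and P: "\<And>x. x \<notin> N \<Longrightarrow> P x"
    using AE_lborel_borel_null[OF assms(1)] by blast
  have "AE x in lborel. x \<notin> N" using N N0 by (intro AE_not_in) (simp add: null_sets_def)
  then have "AE x in lborel. (\<integral>\<^sup>+y. indicator N x \<partial>(lborel :: 'b measure)) = (0 :: ennreal)"
    by eventually_elim simp
  then have "(\<integral>\<^sup>+x. \<integral>\<^sup>+y. indicator N x \<partial>(lborel :: 'b measure) \<partial>lborel) = (0 :: ennreal)"
    using N0 by (subst nn_integral_cong_AE) auto
  then have "(\<integral>\<^sup>+p. indicator N (fst p) \<partial>(lborel :: ('a \<times> 'b) measure)) = (0 :: ennreal)"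
    by (subst nn_integral_lborel_pair) auto
  then have "AE p in (lborel :: ('a \<times> 'b) measure). fst p \<notin> N"
    by (rule AE_of_indicator_nn_integral_0) measurable
  then show ?thesis by eventually_elim (rule P)
qed

lemma nn_integral_scale_snd:
  fixes F :: "'a::euclidean_space \<times> real \<Rightarrow> ennreal"
  assumes "F \<in> borel_measurable borel" and c: "0 < c"
  shows "(\<integral>\<^sup>+p. F p \<partial>lborel) = ennreal c * (\<integral>\<^sup>+p. F (fst p, c * snd p) \<partial>lborel)"
proof -
  have [measurable]: "F \<in> borel_measurable (borel \<Otimes>\<^sub>M borel)" using assms(1) unfolding borel_prod .
  have "(\<integral>\<^sup>+p. F p \<partial>lborel) = (\<integral>\<^sup>+x. \<integral>\<^sup>+z. F (x, z) \<partial>lborel \<partial>lborel)"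
    by (rule nn_integral_lborel_pair[OF assms(1)])
  also have "\<dots> = (\<integral>\<^sup>+x. ennreal c * (\<integral>\<^sup>+z. F (x, c * z) \<partial>lborel) \<partial>lborel)"
    using c by (subst nn_integral_lborel_scale[OF _ c]) simp_all
  also have "\<dots> = ennreal c * (\<integral>\<^sup>+x. \<integral>\<^sup>+z. F (x, c * z) \<partial>lborel \<partial>lborel)"
    by (rule nn_integral_cmult) measurable
  also have "(\<integral>\<^sup>+x. \<integral>\<^sup>+z. F (x, c * z) \<partial>lborel \<partial>lborel) = (\<integral>\<^sup>+p. F (fst p, c * snd p) \<partial>lborel)"
    by (subst nn_integral_lborel_pair) simp_all
  finally show ?thesis .
qed

lemma AE_scale_snd:
  fixes P :: "'a::euclidean_space \<times> real \<Rightarrow> bool"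
  assumes "AE p in lborel. P p" and c: "0 < c"
  shows "AE p in lborel. P (fst p, c * snd p)"
proof -
  obtain N where N: "N \<in> sets borel" and N0: "emeasure lborel N = 0" and P: "\<And>x. x \<notin> N \<Longrightarrow> P x"
    using AE_lborel_borel_null[OF assms(1)] by blast
  have [measurable]: "N \<in> sets (borel \<Otimes>\<^sub>M borel)" using N unfolding borel_prod .
  have "ennreal c * (\<integral>\<^sup>+p. indicator N (fst p, c * snd p) \<partial>lborel) = 0"
    using nn_integral_scale_snd[of "indicator N" c] c N N0 by simp
  then have "(\<integral>\<^sup>+p. indicator N (fst p, c * snd p) \<partial>lborel) = 0" using c by simp
  then have "AE p in lborel. (fst p, c * snd p) \<notin> N" by (rule AE_of_indicator_nn_integral_0) measurable
  then show ?thesis by eventually_elim (rule P)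
qed

lemma integral_unfold0:
  fixes F :: "real^2 \<Rightarrow> real"
  assumes F: "integrable lborel F" and d: "0 < d"
  shows "integrable lborel (\<lambda>p. indicator Zcell' (snd p) * F (umap0 d p))"
    and "(LBINT p. indicator Zcell' (snd p) * F (umap0 d p)) = (LBINT y. F y)"
proof -
  have [measurable]: "F \<in> borel_measurable borel" using borel_measurable_integrable[OF F] by simp
  define M where "M = density lborel (\<lambda>p :: (real^2) \<times> (real^2). ennreal (indicator Zcell' (snd p)))"
  have T: "(\<lambda>p. umap0 d p) \<in> borel_measurable M" by (simp add: M_def)
  have eq: "distr M borel (\<lambda>p. umap0 d p) = lborel"
  proof (rule measure_eqI)
    fix A assume "A \<in> sets (distr M borel (\<lambda>p. umap0 d p))"
    then have A [measurable]: "A \<in> sets borel" by simp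
    have "emeasure (distr M borel (\<lambda>p. umap0 d p)) A
       = (\<integral>\<^sup>+q. indicator A q \<partial>distr M borel (\<lambda>p. umap0 d p))" by simp
    also have "\<dots> = (\<integral>\<^sup>+p. indicator A (umap0 d p) \<partial>M)"
      using T by (subst nn_integral_distr) simp_all
    also have "\<dots> = (\<integral>\<^sup>+p. indicator Zcell' (snd p) * indicator A (umap0 d p) \<partial>lborel)"
      unfolding M_def by (subst nn_integral_density) (auto intro!: nn_integral_cong simp: indicator_def)
    also have "\<dots> = emeasure lborel A" using nn_integral_unfold0[of "indicator A" d] d by simp
    finally show "emeasure (distr M borel (\<lambda>p. umap0 d p)) A = emeasure lborel A" .
  qed simp
  have "integrable (distr M borel (\<lambda>p. umap0 d p)) F" using F eq by simp
  then have "integrable M (\<lambda>p. F (umap0 d p))" using T by (subst (asm) integrable_distr_eq) simp_all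
  then show "integrable lborel (\<lambda>p. indicator Zcell' (snd p) * F (umap0 d p))"
    unfolding M_def by (subst (asm) integrable_density) auto
  have "(LBINT y. F y) = (\<integral>y. F y \<partial>distr M borel (\<lambda>p. umap0 d p))" using eq by simp
  also have "\<dots> = (\<integral>p. F (umap0 d p) \<partial>M)" using T by (subst integral_distr) simp_all
  also have "\<dots> = (LBINT p. indicator Zcell' (snd p) * F (umap0 d p))"
    unfolding M_def by (subst integral_density) auto
  finally show "(LBINT p. indicator Zcell' (snd p) * F (umap0 d p)) = (LBINT y. F y)" by simp
qed

lemma borel_rep_cmult: "borel_rep S f F \<Longrightarrow> borel_rep S (\<lambda>x. a * f x) (\<lambda>x. a * F x)"
  using borel_rep_lin[of S f F f F a 0] by simp

section \<open>Unfolding in the thin domain\<close>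

locale thin_geometry =
  fixes \<omega> :: "(real^2) set" and h :: "real^2 \<Rightarrow> real" and ell H m :: real
  assumes omega: "open \<omega>" "bounded \<omega>"
    and periodic: "Z'_periodic h" and cont: "continuous_on UNIV h"
    and h_bounds: "0 < m" "\<And>z. m \<le> h z" "\<And>z. h z \<le> H"
    and ell: "0 < ell"
begin

lemma h_measurable [measurable]: "h \<in> borel_measurable borel"
  by (rule borel_measurable_continuous_onI[OF cont])

lemma omega_measurable [measurable]: "\<omega> \<in> sets borel" using omega(1) by simp

lemma h_pos: "0 < h z" using h_bounds(1) h_bounds(2)[of z] by linarith

lemma domain_measurable [measurable]:
  "thin_domain \<omega> h ell \<epsilon> \<in> sets borel" "rescaled_domain \<omega> h ell \<epsilon> \<in> sets borel" "Zcell h \<in> sets borel"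
proof -
  have "thin_domain \<omega> h ell \<epsilon> = {p. fst p \<in> \<omega> \<and> 0 < snd p \<and> snd p < \<epsilon> * h ((1 / \<epsilon> powr ell) *\<^sub>R fst p)}"
    by (auto simp: thin_domain_def)
  also have "\<dots> \<in> sets borel" by measurable
  finally show "thin_domain \<omega> h ell \<epsilon> \<in> sets borel" .
  have "rescaled_domain \<omega> h ell \<epsilon> = {p. fst p \<in> \<omega> \<and> 0 < snd p \<and> snd p < h ((1 / \<epsilon> powr ell) *\<^sub>R fst p)}"
    by (auto simp: rescaled_domain_def)
  also have "\<dots> \<in> sets borel" by measurable
  finally show "rescaled_domain \<omega> h ell \<epsilon> \<in> sets borel" .
  have "Zcell h = {p. fst p \<in> Zcell' \<and> 0 < snd p \<and> snd p < h (fst p)}"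
    by (auto simp: Zcell_def)
  also have "\<dots> \<in> sets borel" by measurable
  finally show "Zcell h \<in> sets borel" .
qed

lemma product_measurable [measurable]: "\<omega> \<times> Zcell' \<in> sets borel" "\<omega> \<times> Zcell h \<in> sets borel"
proof -
  show "\<omega> \<times> Zcell' \<in> sets borel" by (simp add: borel_prod[symmetric])
  have "\<omega> \<times> Zcell h \<in> sets (borel \<Otimes>\<^sub>M borel)" by (intro pair_measureI) simp_all
  then show "\<omega> \<times> Zcell h \<in> sets borel" unfolding borel_prod .
qed

lemma h_cell: "h (cell_floor x + z) = h z"
proof -
  have "cell_floor x = lattice_vec (\<chi> i. \<lfloor>x $ i + 1 / 2\<rfloor>)" by (simp add: cell_floor_def lattice_vec_def)
  then show ?thesis using periodic by (metis Z'_periodic_def add.commute)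
qed

text \<open>Periodicity: the unfolding turns the oscillating height into the height of one cell.\<close>

lemma h_unfold: "0 < d \<Longrightarrow> h ((1 / d) *\<^sub>R unfold_map d x z) = h z"
  by (simp add: unfold_map_def scaleR_add_right h_cell)

lemma AE_unfold_point:
  assumes "0 < \<epsilon>"
  shows "AE x in lborel. \<forall>z. unfold_point ell \<epsilon> x z = unfold_map (\<epsilon> powr ell) x z"
proof -
  have "AE x in lborel. off_grid ((1 / \<epsilon> powr ell) *\<^sub>R x)"
    using assms by (intro AE_lborel_scale AE_off_grid) simp
  then show ?thesis by eventually_elim (use unfold_point_eq[OF assms] in blast)
qed

lemma unfold0_rep:
  assumes \<epsilon>: "0 < \<epsilon>" and P: "borel_rep \<omega> p P"
  shows "borel_rep (\<omega> \<times> Zcell') (unfold0 \<omega> ell \<epsilon> p)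
    (\<lambda>y. indicator (\<omega> \<times> Zcell') y * P (umap0 (\<epsilon> powr ell) y))"
  unfolding borel_rep_def
proof (intro conjI)
  have [measurable]: "P \<in> borel_measurable borel" using P by (simp add: borel_rep_def)
  show "(\<lambda>y. indicator (\<omega> \<times> Zcell') y * P (umap0 (\<epsilon> powr ell) y)) \<in> borel_measurable borel"
    by measurable
  have d: "0 < \<epsilon> powr ell" using \<epsilon> by simp
  have "AE x in lborel. x \<in> \<omega> \<longrightarrow> p x = P x" using P by (simp add: borel_rep_def)
  from AE_unfold0[OF this d] AE_lborel_fst[OF AE_unfold_point[OF \<epsilon>]]
  show "AE y in lborel. y \<in> \<omega> \<times> Zcell' \<longrightarrow> unfold0 \<omega> ell \<epsilon> p y
      = indicator (\<omega> \<times> Zcell') y * P (umap0 (\<epsilon> powr ell) y)"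
  proof eventually_elim
    case (elim y)
    then show ?case using P by (cases y) (auto simp: unfold0_def Let_def borel_rep_def)
  qed
qed simp

lemma rescale_rep:
  assumes \<epsilon>: "0 < \<epsilon>" and P: "borel_rep (thin_domain \<omega> h ell \<epsilon>) p P"
  shows "borel_rep (rescaled_domain \<omega> h ell \<epsilon>) (rescale \<epsilon> p) (\<lambda>y. P (fst y, \<epsilon> * snd y))"
  unfolding borel_rep_def
proof (intro conjI allI impI)
  have [measurable]: "P \<in> borel_measurable (borel \<Otimes>\<^sub>M borel)" using P unfolding borel_prod by (simp add: borel_rep_def)
  show "(\<lambda>y. P (fst y, \<epsilon> * snd y)) \<in> borel_measurable borel" by measurable
  have dom: "(fst y, \<epsilon> * snd y) \<in> thin_domain \<omega> h ell \<epsilon> \<longleftrightarrow> y \<in> rescaled_domain \<omega> h ell \<epsilon>" for y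
    using \<epsilon> by (cases y) (auto simp: thin_domain_def rescaled_domain_def zero_less_mult_iff)
  show "P (fst y, \<epsilon> * snd y) = 0" if "y \<notin> rescaled_domain \<omega> h ell \<epsilon>" for y
    using that P dom by (auto simp: borel_rep_def)
  have "AE y in lborel. y \<in> thin_domain \<omega> h ell \<epsilon> \<longrightarrow> p y = P y" using P by (simp add: borel_rep_def)
  from AE_scale_snd[OF this \<epsilon>]
  show "AE y in lborel. y \<in> rescaled_domain \<omega> h ell \<epsilon> \<longrightarrow> rescale \<epsilon> p y = P (fst y, \<epsilon> * snd y)"
    by eventually_elim (simp add: dom rescale_def case_prod_beta')
qed

text \<open>A point of \<open>\<omega> \<times> Z\<close> is unfolded into the rescaled domain iff its horizontal part is unfolded into
  \<open>\<omega>\<close>; this is where periodicity of the height enters.\<close>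

lemma unfold1_rep:
  assumes \<epsilon>: "0 < \<epsilon>" and Q: "borel_rep (rescaled_domain \<omega> h ell \<epsilon>) q Q"
  shows "borel_rep (\<omega> \<times> Zcell h) (unfold1 \<omega> ell \<epsilon> q)
    (\<lambda>y. indicator (\<omega> \<times> Zcell h) y * Q (umap1 (\<epsilon> powr ell) y))"
  unfolding borel_rep_def
proof (intro conjI)
  have [measurable]: "Q \<in> borel_measurable (borel \<Otimes>\<^sub>M borel)" using Q unfolding borel_prod by (simp add: borel_rep_def)
  show "(\<lambda>y. indicator (\<omega> \<times> Zcell h) y * Q (umap1 (\<epsilon> powr ell) y)) \<in> borel_measurable borel"
    by measurable
  have d: "0 < \<epsilon> powr ell" using \<epsilon> by simp
  have "AE y in lborel. y \<in> rescaled_domain \<omega> h ell \<epsilon> \<longrightarrow> q y = Q y" using Q by (simp add: borel_rep_def)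
  from AE_unfold1[OF this d] AE_lborel_fst[OF AE_unfold_point[OF \<epsilon>]]
  show "AE y in lborel. y \<in> \<omega> \<times> Zcell h \<longrightarrow> unfold1 \<omega> ell \<epsilon> q y
      = indicator (\<omega> \<times> Zcell h) y * Q (umap1 (\<epsilon> powr ell) y)"
  proof eventually_elim
    case (elim y)
    obtain x z w where y: "y = (x, (z, w))" by (metis prod.exhaust)
    let ?t = "unfold_map (\<epsilon> powr ell) x z"
    show ?case
    proof
      assume "y \<in> \<omega> \<times> Zcell h"
      then have zw: "z \<in> Zcell'" "0 < w" "w < h z" and x: "x \<in> \<omega>" by (auto simp: y Zcell_def)
      have dom: "(?t, w) \<in> rescaled_domain \<omega> h ell \<epsilon> \<longleftrightarrow> ?t \<in> \<omega>"
        using zw h_unfold[OF d, of x z] by (auto simp: rescaled_domain_def)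
      show "unfold1 \<omega> ell \<epsilon> q y
        = indicator (\<omega> \<times> Zcell h) y * Q (umap1 (\<epsilon> powr ell) y)"
        using elim zw x Q dom by (auto simp: y unfold1_def Let_def borel_rep_def Zcell_def)
    qed
  qed
qed simp

text \<open>The vertical scaling multiplies squared norms by \<open>\<epsilon>\<close>, and the unfolding preserves them, except that
  the horizontal variable is cut off to \<open>\<omega>\<close>.\<close>

lemma unfold1_norm_bound:
  assumes \<epsilon>: "0 < \<epsilon>" and p: "p \<in> L2 (thin_domain \<omega> h ell \<epsilon>)"
  shows "unfold1 \<omega> ell \<epsilon> (rescale \<epsilon> p) \<in> L2 (\<omega> \<times> Zcell h)"
    and "L2ip (\<omega> \<times> Zcell h) (unfold1 \<omega> ell \<epsilon> (rescale \<epsilon> p)) (unfold1 \<omega> ell \<epsilon> (rescale \<epsilon> p))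
      \<le> (L2norm (rescaled_domain \<omega> h ell \<epsilon>) (rescale \<epsilon> p))\<^sup>2"
    and "\<exists>P. borel_rep (thin_domain \<omega> h ell \<epsilon>) p P \<and> integrable lborel (\<lambda>y. (P y)\<^sup>2) \<and>
      (LBINT y. (P y)\<^sup>2) = \<epsilon> * (L2norm (rescaled_domain \<omega> h ell \<epsilon>) (rescale \<epsilon> p))\<^sup>2"
proof -
  have d: "0 < \<epsilon> powr ell" using \<epsilon> by simp
  obtain P where P: "borel_rep (thin_domain \<omega> h ell \<epsilon>) p P" "integrable lborel (\<lambda>y. (P y)\<^sup>2)"
    using L2_rep[OF domain_measurable(1) p] by blast
  have [measurable]: "P \<in> borel_measurable borel" using P by (simp add: borel_rep_def)
  have [measurable]: "P \<in> borel_measurable (borel \<Otimes>\<^sub>M borel)" unfolding borel_prod by simp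
  define Q where "Q y = P (fst y, \<epsilon> * snd y)" for y
  have Q: "borel_rep (rescaled_domain \<omega> h ell \<epsilon>) (rescale \<epsilon> p) Q"
    using rescale_rep[OF \<epsilon> P(1)] by (simp add: Q_def[abs_def])
  have Qb [measurable]: "Q \<in> borel_measurable borel" using Q by (simp add: borel_rep_def)
  have [measurable]: "Q \<in> borel_measurable (borel \<Otimes>\<^sub>M borel)" unfolding borel_prod by simp
  have scale: "(\<integral>\<^sup>+y. ennreal ((P y)\<^sup>2) \<partial>lborel) = ennreal \<epsilon> * (\<integral>\<^sup>+y. ennreal ((Q y)\<^sup>2) \<partial>lborel)"
    using nn_integral_scale_snd[of "\<lambda>y. ennreal ((P y)\<^sup>2)" \<epsilon>] \<epsilon> by (simp add: Q_def)
  have P_fin: "(\<integral>\<^sup>+y. ennreal ((P y)\<^sup>2) \<partial>lborel) = ennreal (LBINT y. (P y)\<^sup>2)"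
    using P(2) by (intro nn_integral_eq_integral) auto
  have Q2: "integrable lborel (\<lambda>y. (Q y)\<^sup>2)"
  proof (rule integrableI_bounded)
    have "ennreal \<epsilon> * (\<integral>\<^sup>+y. ennreal ((Q y)\<^sup>2) \<partial>lborel) < \<infinity>"
      unfolding scale[symmetric] P_fin by simp
    then show "(\<integral>\<^sup>+y. ennreal (norm ((Q y)\<^sup>2)) \<partial>lborel) < \<infinity>"
      using \<epsilon> by (auto simp: ennreal_mult_less_top)
  qed simp
  have Q_fin: "(\<integral>\<^sup>+y. ennreal ((Q y)\<^sup>2) \<partial>lborel) = ennreal (LBINT y. (Q y)\<^sup>2)"
    using Q2 by (intro nn_integral_eq_integral) auto
  have norm_Q: "(L2norm (rescaled_domain \<omega> h ell \<epsilon>) (rescale \<epsilon> p))\<^sup>2 = (LBINT y. (Q y)\<^sup>2)"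
    unfolding L2norm_eq borel_rep_L2ip[OF domain_measurable(2) Q Q] by (simp flip: power2_eq_square)
  have "(LBINT y. (P y)\<^sup>2) = \<epsilon> * (LBINT y. (Q y)\<^sup>2)"
    using scale unfolding P_fin Q_fin using \<epsilon> by (simp flip: ennreal_mult)
  then show "\<exists>P. borel_rep (thin_domain \<omega> h ell \<epsilon>) p P \<and> integrable lborel (\<lambda>y. (P y)\<^sup>2) \<and>
      (LBINT y. (P y)\<^sup>2) = \<epsilon> * (L2norm (rescaled_domain \<omega> h ell \<epsilon>) (rescale \<epsilon> p))\<^sup>2"
    using P norm_Q by auto
  let ?u = "unfold1 \<omega> ell \<epsilon> (rescale \<epsilon> p)"
  define U where "U y = indicator (\<omega> \<times> Zcell h) y * Q (umap1 (\<epsilon> powr ell) y)" for y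
  have U: "borel_rep (\<omega> \<times> Zcell h) ?u U" using unfold1_rep[OF \<epsilon> Q] by (simp add: U_def[abs_def])
  have [measurable]: "U \<in> borel_measurable borel" using U by (simp add: borel_rep_def)
  have "(\<integral>\<^sup>+y. ennreal ((U y)\<^sup>2) \<partial>lborel)
    \<le> (\<integral>\<^sup>+y. indicator Zcell' (fst (snd y)) * ennreal ((Q (umap1 (\<epsilon> powr ell) y))\<^sup>2) \<partial>lborel)"
    by (intro nn_integral_mono) (auto simp: U_def indicator_def Zcell_def)
  also have "\<dots> = ennreal (LBINT y. (Q y)\<^sup>2)"
    using nn_integral_unfold1[of "\<lambda>y. ennreal ((Q y)\<^sup>2)", OF _ d] Q_fin by simp
  finally have U2: "integrable lborel (\<lambda>y. (U y)\<^sup>2)" "(LBINT y. (U y)\<^sup>2) \<le> (LBINT y. (Q y)\<^sup>2)"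
    by (auto intro!: ennreal_integral_le)
  show "?u \<in> L2 (\<omega> \<times> Zcell h)" using borel_rep_L2_iff[OF _ U] U2(1) by simp
  show "L2ip (\<omega> \<times> Zcell h) ?u ?u \<le> (L2norm (rescaled_domain \<omega> h ell \<epsilon>) (rescale \<epsilon> p))\<^sup>2"
    unfolding borel_rep_L2ip[OF product_measurable(2) U U] norm_Q using U2(2) by (simp add: power2_eq_square)
qed

text \<open>The section of the thin domain over \<open>x\<close> has length \<open>\<epsilon> * h (x / \<epsilon> powr ell)\<close>.\<close>

lemma thin_domain_integral:
  assumes \<epsilon>: "0 < \<epsilon>" and P: "P \<in> borel_measurable borel" "integrable lborel P" "\<And>x. x \<notin> \<omega> \<Longrightarrow> P x = 0"
  shows "integrable lborel (\<lambda>y. indicator (thin_domain \<omega> h ell \<epsilon>) y * P (fst y))"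
    and "(LBINT y. indicator (thin_domain \<omega> h ell \<epsilon>) y * P (fst y))
      = \<epsilon> * (LBINT x. P x * h ((1 / \<epsilon> powr ell) *\<^sub>R x))"
proof -
  note [measurable] = P(1)
  have H: "0 < H" using h_pos[of 0] h_bounds(3)[of 0] by linarith
  let ?f = "\<lambda>y. indicator (thin_domain \<omega> h ell \<epsilon>) y * P (fst y) :: real" and ?hh = "\<lambda>x. h ((1 / \<epsilon> powr ell) *\<^sub>R x)"
  have sec: "?f (x, z) = P x * indicator {0<..<\<epsilon> * ?hh x} z" for x z
    using P(3)[of x] by (auto simp: thin_domain_def indicator_def)
  have pos: "0 \<le> \<epsilon> * ?hh x" for x using \<epsilon> h_pos[of "(1 / \<epsilon> powr ell) *\<^sub>R x"] by simp
  have "(\<integral>\<^sup>+y. ennreal (norm (?f y)) \<partial>lborel) = (\<integral>\<^sup>+x. \<integral>\<^sup>+z. ennreal (norm (?f (x, z))) \<partial>lborel \<partial>lborel)"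
    by (rule nn_integral_lborel_pair) measurable
  also have "\<dots> = (\<integral>\<^sup>+x. ennreal (norm (P x)) * ennreal (\<epsilon> * ?hh x) \<partial>lborel)"
  proof (intro nn_integral_cong)
    fix x
    have "(\<integral>\<^sup>+z. ennreal (norm (?f (x, z))) \<partial>lborel) = (\<integral>\<^sup>+z. ennreal (norm (P x)) * indicator {0<..<\<epsilon> * ?hh x} z \<partial>lborel)"
      unfolding sec by (intro nn_integral_cong) (auto simp: indicator_def)
    also have "\<dots> = ennreal (norm (P x)) * ennreal (\<epsilon> * ?hh x)"
      using pos[of x] by (subst nn_integral_cmult_indicator) auto
    finally show "(\<integral>\<^sup>+z. ennreal (norm (?f (x, z))) \<partial>lborel) = ennreal (norm (P x)) * ennreal (\<epsilon> * ?hh x)" .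
  qed
  also have "\<dots> \<le> (\<integral>\<^sup>+x. ennreal (norm (P x)) * ennreal (\<epsilon> * H) \<partial>lborel)"
    using \<epsilon> h_bounds(3) by (intro nn_integral_mono mult_left_mono ennreal_leI) auto
  also have "\<dots> < \<infinity>"
    using P(2) by (simp add: nn_integral_multc integrable_iff_bounded ennreal_mult_less_top)
  finally show int: "integrable lborel ?f" by (intro integrableI_bounded) auto
  have "(LBINT y. ?f y) = (LBINT x. LBINT z. ?f (x, z))"
    using lborel_pair.integral_fst'[of ?f] int unfolding lborel_prod by simp
  also have "\<dots> = (LBINT x. P x * (\<epsilon> * ?hh x))"
    unfolding sec using pos by simp
  also have "\<dots> = (LBINT x. \<epsilon> * (P x * ?hh x))" by (simp add: mult_ac)
  finally show "(LBINT y. ?f y) = \<epsilon> * (LBINT x. P x * ?hh x)" by simp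
qed

end

section \<open>Limits of the two parts of the pressure\<close>

context thin_geometry
begin

text \<open>Unfolding turns the integral of \<open>F n\<close> against the oscillating height into the pairing of the
  unfolded \<open>F n\<close> with the fixed function \<open>h\<close> on the cell, and the unfolded functions converge strongly.\<close>

lemma oscillating_integral_tendsto:
  assumes F: "\<And>n. borel_rep \<omega> (f n) (F n)" "\<And>n. f n \<in> L2 \<omega>" and G: "borel_rep \<omega> g G" "g \<in> L2 \<omega>"
    and lim: "(\<lambda>n. \<integral>\<^sup>+x. ennreal ((F n x - G x)\<^sup>2) \<partial>lborel) \<longlonglongrightarrow> 0"
    and d: "\<And>n. 0 < d n" "d \<longlonglongrightarrow> 0"
  shows "(\<lambda>n. LBINT x. F n x * h ((1 / d n) *\<^sub>R x))
    \<longlonglongrightarrow> (LBINT z. indicator Zcell' z * h z) * (LBINT x. G x)"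
proof -
  have Fb [measurable]: "F n \<in> borel_measurable borel" for n using F(1)[of n] by (simp add: borel_rep_def)
  have Gb [measurable]: "G \<in> borel_measurable borel" using G(1) by (simp add: borel_rep_def)
  have F0: "F n x = 0" if "x \<notin> \<omega>" for n x using F(1)[of n] that by (simp add: borel_rep_def)
  have G0: "G x = 0" if "x \<notin> \<omega>" for x using G(1) that by (simp add: borel_rep_def)
  have F2: "integrable lborel (\<lambda>x. (F n x)\<^sup>2)" for n using borel_rep_L2_iff[OF _ F(1)] F(2) by simp
  have G2: "integrable lborel (\<lambda>x. (G x)\<^sup>2)" using borel_rep_L2_iff[OF _ G(1)] G(2) by simp
  have fin: "emeasure lborel \<omega> < \<infinity>" using emeasure_bounded_finite[OF omega(2)] by simp
  have F1: "integrable lborel (F n)" for n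
    using L2_finite_measure_integrable[OF fin _ F(2)] borel_rep_integrable_iff[OF _ F(1)] by simp
  have G1: "integrable lborel G"
    using L2_finite_measure_integrable[OF fin _ G(2)] borel_rep_integrable_iff[OF _ G(1)] by simp
  obtain D where D: "\<And>n. d n \<le> D"
    using convergent_imp_Bseq[of d] d(2) unfolding convergent_def Bseq_def by (metis abs_le_D1 real_norm_def)
  have D0: "0 \<le> D" using D[of 0] d(1)[of 0] by linarith
  obtain R where R: "\<And>x. x \<in> \<omega> \<Longrightarrow> norm x \<le> R" using omega(2) by (auto simp: bounded_iff)
  let ?\<chi> = "\<lambda>p :: (real^2) \<times> (real^2). indicator Zcell' (snd p) :: real"
  let ?T = "\<lambda>n p. umap0 (d n) p"
  define k where "k p = indicator (cball 0 (R + 2 * D)) (fst p) * (?\<chi> p * h (snd p))" for p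
  have [measurable]: "cball (0 :: real^2) (R + 2 * D) \<in> sets borel" by simp
  have [measurable]: "k \<in> borel_measurable borel" unfolding k_def[abs_def] by measurable
  have k2: "integrable lborel (\<lambda>p. (k p)\<^sup>2)"
  proof (rule Bochner_Integration.integrable_bound)
    have C: "cball 0 (R + 2 * D) \<times> Zcell' \<in> sets (borel :: ((real^2) \<times> (real^2)) measure)"
      by (simp add: borel_prod[symmetric])
    have "emeasure lborel (cball 0 (R + 2 * D) \<times> Zcell' :: ((real^2) \<times> (real^2)) set) < \<infinity>"
      by (intro emeasure_bounded_finite bounded_Times) (auto simp: Zcell'_box)
    then show "integrable lborel (\<lambda>p :: (real^2) \<times> (real^2). H\<^sup>2 * indicator (cball 0 (R + 2 * D) \<times> Zcell') p)"
      using C by (intro integrable_mult_right integrable_real_indicator) auto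
    have "(h z)\<^sup>2 \<le> H\<^sup>2" for z using h_pos[of z] h_bounds(3)[of z] by (intro power_mono) auto
    then show "AE p in lborel. norm ((k p)\<^sup>2) \<le> norm (H\<^sup>2 * indicator (cball 0 (R + 2 * D) \<times> Zcell') p)"
      by (auto simp: k_def indicator_def)
  qed simp
  define s where "s n p = ?\<chi> p * (F n (?T n p) - G (fst p))" for n p
  have [measurable]: "s n \<in> borel_measurable borel" for n unfolding s_def[abs_def] by measurable
  have s_sq: "(s n p)\<^sup>2 = ?\<chi> p * (F n (?T n p) - G (fst p))\<^sup>2" for n p by (simp add: s_def indicator_def)
  have s_lim: "(\<lambda>n. \<integral>\<^sup>+p. ennreal ((s n p)\<^sup>2) \<partial>lborel) \<longlonglongrightarrow> 0"
    unfolding s_sq by (rule unfold_strong_convergence[OF Fb Gb G2 lim d])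
  \<comment> \<open>Outside of the ball both terms vanish, because the unfolding moves points by at most \<open>2 * D\<close>.\<close>
  have cut: "?\<chi> p * F n (?T n p) = indicator (cball 0 (R + 2 * D)) (fst p) * (?\<chi> p * F n (?T n p))"
      "?\<chi> p * G (fst p) = indicator (cball 0 (R + 2 * D)) (fst p) * (?\<chi> p * G (fst p))" for n p
  proof -
    have "?T n p \<notin> \<omega>" if "snd p \<in> Zcell'" "fst p \<notin> cball 0 (R + 2 * D)"
    proof
      assume "?T n p \<in> \<omega>"
      then have "norm (?T n p) \<le> R" by (rule R)
      moreover have "norm (?T n p - fst p) \<le> 2 * D"
        using unfold_map_close[OF d(1)[of n] that(1), of "fst p"] D[of n] by linarith
      ultimately show False
        using that(2) norm_triangle_ineq2[of "fst p" "?T n p"] by (simp add: norm_minus_commute)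
    qed
    then show "?\<chi> p * F n (?T n p) = indicator (cball 0 (R + 2 * D)) (fst p) * (?\<chi> p * F n (?T n p))"
      using F0 by (auto simp: indicator_def)
    show "?\<chi> p * G (fst p) = indicator (cball 0 (R + 2 * D)) (fst p) * (?\<chi> p * G (fst p))"
      using G0[of "fst p"] R[of "fst p"] D0 by (cases "fst p \<in> \<omega>") (auto simp: indicator_def)
  qed
  have lhs: "(LBINT x. F n x * h ((1 / d n) *\<^sub>R x)) = (LBINT p. k p * (?\<chi> p * F n (?T n p)))"
    and lhs_int: "integrable lborel (\<lambda>p. k p * (?\<chi> p * F n (?T n p)))" for n
  proof -
    have "integrable lborel (\<lambda>x. F n x * h ((1 / d n) *\<^sub>R x))"
    proof (rule Bochner_Integration.integrable_bound)
      show "integrable lborel (\<lambda>x. H * F n x)" using F1 by simp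
      have "\<bar>h z\<bar> \<le> \<bar>H\<bar>" for z using h_pos[of z] h_bounds(3)[of z] by linarith
      then show "AE x in lborel. norm (F n x * h ((1 / d n) *\<^sub>R x)) \<le> norm (H * F n x)"
        by (auto simp: abs_mult mult.commute[of "\<bar>H\<bar>"] intro!: AE_I2 mult_left_mono)
    qed simp
    note u = integral_unfold0[OF this d(1)[of n]]
    have eq: "?\<chi> p * (F n (?T n p) * h ((1 / d n) *\<^sub>R ?T n p)) = k p * (?\<chi> p * F n (?T n p))" for p
    proof -
      have "?\<chi> p * (F n (?T n p) * h ((1 / d n) *\<^sub>R ?T n p)) = (?\<chi> p * F n (?T n p)) * (?\<chi> p * h (snd p))"
        using h_unfold[OF d(1)[of n]] by (simp add: indicator_def)
      also have "\<dots> = k p * (?\<chi> p * F n (?T n p))" by (subst cut(1)) (simp add: k_def)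
      finally show ?thesis .
    qed
    show "(LBINT x. F n x * h ((1 / d n) *\<^sub>R x)) = (LBINT p. k p * (?\<chi> p * F n (?T n p)))"
      "integrable lborel (\<lambda>p. k p * (?\<chi> p * F n (?T n p)))"
      using u unfolding eq by simp_all
  qed
  have G_sq: "integrable lborel (\<lambda>p. (?\<chi> p * G (fst p))\<^sup>2)"
  proof (rule integrableI_bounded)
    have "(\<integral>\<^sup>+p. ennreal (norm ((?\<chi> p * G (fst p))\<^sup>2)) \<partial>lborel)
        = (\<integral>\<^sup>+x. \<integral>\<^sup>+z. ennreal ((G x)\<^sup>2) * indicator Zcell' z \<partial>lborel \<partial>lborel)"
      by (subst nn_integral_lborel_pair) (auto intro!: nn_integral_cong simp: indicator_def)
    also have "\<dots> = (\<integral>\<^sup>+x. ennreal ((G x)\<^sup>2) \<partial>lborel)"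
      by (simp add: nn_integral_cmult_indicator emeasure_Zcell')
    also have "\<dots> < \<infinity>" using G2 by (subst nn_integral_eq_integral) auto
    finally show "(\<integral>\<^sup>+p. ennreal (norm ((?\<chi> p * G (fst p))\<^sup>2)) \<partial>lborel) < \<infinity>" .
  qed simp
  have rhs_int: "integrable lborel (\<lambda>p. k p * (?\<chi> p * G (fst p)))"
    using k2 G_sq by (intro square_integrable_mult) auto
  have rhs: "(LBINT p. k p * (?\<chi> p * G (fst p))) = (LBINT z. indicator Zcell' z * h z) * (LBINT x. G x)"
  proof -
    have eq: "k p * (?\<chi> p * G (fst p)) = G (fst p) * (indicator Zcell' (snd p) * h (snd p))" for p
      using cut(2)[of p] by (auto simp: k_def indicator_def split: if_splits)
    have "(LBINT p. k p * (?\<chi> p * G (fst p))) = (LBINT x. LBINT z. G x * (indicator Zcell' z * h z))"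
      using lborel_pair.integral_fst'[of "\<lambda>p. k p * (?\<chi> p * G (fst p))"] rhs_int
      unfolding lborel_prod eq by simp
    also have "\<dots> = (LBINT x. G x * (LBINT z. indicator Zcell' z * h z))" by simp
    finally show ?thesis by simp
  qed
  have s2: "\<forall>\<^sub>F n in sequentially. integrable lborel (\<lambda>p. (s n p)\<^sup>2)"
  proof -
    have "\<forall>\<^sub>F n in sequentially. (\<integral>\<^sup>+p. ennreal ((s n p)\<^sup>2) \<partial>lborel) < 1"
      using order_tendstoD(2)[OF s_lim, of 1] by simp
    then show ?thesis
    proof eventually_elim
      case (elim n)
      then show ?case by (intro integrableI_bounded) (auto intro: less_trans)
    qed
  qed
  have "(\<lambda>n. sqrt (LBINT p. (s n p)\<^sup>2)) \<longlonglongrightarrow> sqrt 0"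
  proof (rule tendsto_real_sqrt)
    have "(\<lambda>n. enn2real (\<integral>\<^sup>+p. ennreal ((s n p)\<^sup>2) \<partial>lborel)) \<longlonglongrightarrow> enn2real 0"
      using s_lim by (intro tendsto_enn2real) auto
    then show "(\<lambda>n. LBINT p. (s n p)\<^sup>2) \<longlonglongrightarrow> 0" by (simp add: integral_eq_nn_integral)
  qed
  then have bound_lim: "(\<lambda>n. sqrt (LBINT p. (k p)\<^sup>2) * sqrt (LBINT p. (s n p)\<^sup>2)) \<longlonglongrightarrow> 0"
    using tendsto_mult_right_zero by simp
  have "(\<lambda>n. (LBINT x. F n x * h ((1 / d n) *\<^sub>R x))
      - (LBINT z. indicator Zcell' z * h z) * (LBINT x. G x)) \<longlonglongrightarrow> 0"
  proof (rule Lim_null_comparison[OF _ bound_lim], use s2 in eventually_elim)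
    fix n assume s2: "integrable lborel (\<lambda>p. (s n p)\<^sup>2)"
    have "(LBINT x. F n x * h ((1 / d n) *\<^sub>R x)) - (LBINT z. indicator Zcell' z * h z) * (LBINT x. G x)
      = (LBINT p. k p * (?\<chi> p * F n (?T n p)) - k p * (?\<chi> p * G (fst p)))"
      unfolding lhs rhs[symmetric] by (rule Bochner_Integration.integral_diff[OF lhs_int rhs_int, symmetric])
    also have "\<dots> = (LBINT p. k p * s n p)"
      by (intro Bochner_Integration.integral_cong) (simp_all add: s_def right_diff_distrib)
    finally show "norm ((LBINT x. F n x * h ((1 / d n) *\<^sub>R x)) - (LBINT z. indicator Zcell' z * h z) * (LBINT x. G x))
      \<le> sqrt (LBINT p. (k p)\<^sup>2) * sqrt (LBINT p. (s n p)\<^sup>2)"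
      using lborel_Cauchy_Schwarz[of k "s n"] k2 s2 by simp
  qed
  then show ?thesis by (simp add: LIM_zero_iff)
qed

lemma cell_mean_pos: "0 < (LBINT z. indicator Zcell' z * h z)"
proof -
  have meas: "emeasure lborel Zcell' < \<infinity>" by (simp add: emeasure_Zcell')
  have int: "integrable lborel (\<lambda>z. indicator Zcell' z * h z)"
  proof (rule Bochner_Integration.integrable_bound)
    show "integrable lborel (\<lambda>z. H * indicator Zcell' z)"
      using meas by (intro integrable_mult_right integrable_real_indicator) auto
    have "\<bar>h z\<bar> \<le> \<bar>H\<bar>" for z using h_pos[of z] h_bounds(3)[of z] by linarith
    then show "AE z in lborel. norm (indicator Zcell' z * h z) \<le> norm (H * indicator Zcell' z)"
      by (auto simp: indicator_def)
  qed simp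
  have "m = (LBINT z. m * indicator Zcell' z)" by (simp add: measure_def emeasure_Zcell')
  also have "\<dots> \<le> (LBINT z. indicator Zcell' z * h z)"
    using meas h_bounds(2) int by (intro integral_mono integrable_mult_right integrable_real_indicator) (auto simp: indicator_def)
  finally show ?thesis using h_bounds(1) by linarith
qed

text \<open>The mean of the pressure vanishes, so the integral of \<open>p0\<close> over the thin domain is minus that of
  \<open>p1\<close>. The latter is bounded by Cauchy-Schwarz, where the measure of the domain and the vertical
  scaling contribute a factor \<open>sqrt \<epsilon>\<close> each, which cancels the \<open>1 / \<epsilon>\<close> in the bound on \<open>p1\<close>.\<close>

lemma pressure_mean_bound:
  assumes \<epsilon>: "0 < \<epsilon>" and p: "p \<in> L2_0 (thin_domain \<omega> h ell \<epsilon>)"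
    and dec: "AE x in lebesgue_on (thin_domain \<omega> h ell \<epsilon>). p x = p0 (fst x) + p1 x"
    and p0: "p0 \<in> L2 \<omega>" "borel_rep \<omega> p0 P0" and p1: "p1 \<in> L2 (thin_domain \<omega> h ell \<epsilon>)"
    and bound: "L2norm (rescaled_domain \<omega> h ell \<epsilon>) (rescale \<epsilon> p1) \<le> C / \<epsilon>"
  shows "\<bar>LBINT x. (\<epsilon>\<^sup>2 * P0 x) * h ((1 / \<epsilon> powr ell) *\<^sub>R x)\<bar> \<le> \<epsilon> * (sqrt (H * measure lborel \<omega>) * C)"
proof -
  let ?\<Theta> = "thin_domain \<omega> h ell \<epsilon>" and ?N = "L2norm (rescaled_domain \<omega> h ell \<epsilon>) (rescale \<epsilon> p1)"
  have fin: "emeasure lborel \<omega> < \<infinity>" using emeasure_bounded_finite[OF omega(2)] by simp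
  have P0b [measurable]: "P0 \<in> borel_measurable borel" and P00: "\<And>x. x \<notin> \<omega> \<Longrightarrow> P0 x = 0"
    using p0(2) by (auto simp: borel_rep_def)
  have P01: "integrable lborel P0"
    using L2_finite_measure_integrable[OF fin _ p0(1)] borel_rep_integrable_iff[OF _ p0(2)] by simp
  obtain P1 where P1: "borel_rep ?\<Theta> p1 P1" "integrable lborel (\<lambda>y. (P1 y)\<^sup>2)" "(LBINT y. (P1 y)\<^sup>2) = \<epsilon> * ?N\<^sup>2"
    using unfold1_norm_bound(3)[OF \<epsilon> p1] by blast
  have P1b [measurable]: "P1 \<in> borel_measurable borel" using P1(1) by (simp add: borel_rep_def)
  note thin0 = thin_domain_integral[OF \<epsilon> P0b P01 P00]
  have ind: "borel_rep \<omega> (indicator \<omega>) (indicator \<omega>)" by (rule borel_rep_self) auto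
  have ind1: "integrable lborel (indicator \<omega> :: _ \<Rightarrow> real)" using fin by (intro integrable_real_indicator) auto
  have thin1: "integrable lborel (\<lambda>y. indicator ?\<Theta> y * indicator \<omega> (fst y) :: real)"
    "(LBINT y. indicator ?\<Theta> y * indicator \<omega> (fst y)) = \<epsilon> * (LBINT x. indicator \<omega> x * h ((1 / \<epsilon> powr ell) *\<^sub>R x))"
    using thin_domain_integral[OF \<epsilon> _ ind1] by auto
  have \<Theta>_eq: "indicator ?\<Theta> y * indicator \<omega> (fst y) = (indicator ?\<Theta> y :: real)\<^sup>2" for y
    by (auto simp: indicator_def thin_domain_def)
  have \<Theta>_le: "(LBINT y. (indicator ?\<Theta> y)\<^sup>2) \<le> \<epsilon> * (H * measure lborel \<omega>)"
  proof -
    have "(LBINT x. indicator \<omega> x * h ((1 / \<epsilon> powr ell) *\<^sub>R x)) \<le> (LBINT x. H * indicator \<omega> x)"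
    proof (rule integral_mono')
      show "integrable lborel (\<lambda>x. H * indicator \<omega> x)" using ind1 by simp
      show "indicator \<omega> x * h ((1 / \<epsilon> powr ell) *\<^sub>R x) \<le> H * indicator \<omega> x" for x
        using h_bounds(3) by (auto simp: indicator_def)
      show "0 \<le> H * indicator \<omega> x" for x using h_pos[of 0] h_bounds(3)[of 0] by simp
    qed
    also have "\<dots> = H * measure lborel \<omega>" by simp
    finally show ?thesis using thin1(2) \<epsilon> unfolding \<Theta>_eq by simp
  qed
  have \<Theta>_int: "integrable lborel (\<lambda>y. (indicator ?\<Theta> y :: real)\<^sup>2)" using thin1(1) unfolding \<Theta>_eq .
  have P1_eq: "indicator ?\<Theta> y * P1 y = P1 y" for y
  proof (cases "y \<in> ?\<Theta>")
    case False
    then have "P1 y = 0" using P1(1) unfolding borel_rep_def by blast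
    then show ?thesis by simp
  qed simp
  have P1_int: "integrable lborel P1"
    using square_integrable_mult[OF _ _ \<Theta>_int P1(2)] unfolding P1_eq by simp
  have rep: "borel_rep ?\<Theta> p (\<lambda>y. indicator ?\<Theta> y * P0 (fst y) + P1 y)"
    unfolding borel_rep_def
  proof (intro conjI)
    have "AE y in lborel. fst y \<in> \<omega> \<longrightarrow> p0 (fst y) = P0 (fst y)"
      using p0(2) by (intro AE_lborel_fst) (simp add: borel_rep_def)
    moreover have "AE y in lborel. y \<in> ?\<Theta> \<longrightarrow> p y = p0 (fst y) + p1 y"
      using dec by (simp add: AE_lebesgue_on_iff)
    moreover have "AE y in lborel. y \<in> ?\<Theta> \<longrightarrow> p1 y = P1 y" using P1(1) by (simp add: borel_rep_def)
    ultimately show "AE y in lborel. y \<in> ?\<Theta> \<longrightarrow> p y = indicator ?\<Theta> y * P0 (fst y) + P1 y"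
      by eventually_elim (auto simp: thin_domain_def)
  qed (use P1(1) in \<open>auto simp: borel_rep_def\<close>)
  have "0 = (\<integral>x. p x \<partial>lebesgue_on ?\<Theta>)" using p by (simp add: L2_0_def)
  also have "\<dots> = (LBINT y. indicator ?\<Theta> y * P0 (fst y) + P1 y)"
    by (rule borel_rep_integral_eq[OF domain_measurable(1) rep])
  also have "\<dots> = \<epsilon> * (LBINT x. P0 x * h ((1 / \<epsilon> powr ell) *\<^sub>R x)) + (LBINT y. P1 y)"
    using thin0 P1_int by simp
  finally have "\<bar>\<epsilon> * (LBINT x. P0 x * h ((1 / \<epsilon> powr ell) *\<^sub>R x))\<bar> = \<bar>LBINT y. P1 y\<bar>" by simp
  also have "\<dots> = \<bar>LBINT y. indicator ?\<Theta> y * P1 y\<bar>" unfolding P1_eq ..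
  also have "\<dots> \<le> sqrt (LBINT y. (indicator ?\<Theta> y)\<^sup>2) * sqrt (LBINT y. (P1 y)\<^sup>2)"
    by (intro lborel_Cauchy_Schwarz \<Theta>_int P1(2)) auto
  also have "\<dots> \<le> sqrt (\<epsilon> * (H * measure lborel \<omega>)) * (sqrt \<epsilon> * (C / \<epsilon>))"
  proof (intro mult_mono)
    show "sqrt (LBINT y. (indicator ?\<Theta> y)\<^sup>2) \<le> sqrt (\<epsilon> * (H * measure lborel \<omega>))"
      using \<Theta>_le by simp
    have "0 \<le> ?N" by (simp add: L2norm_eq L2ip_self_ge0)
    then have "sqrt (LBINT y. (P1 y)\<^sup>2) = sqrt \<epsilon> * ?N" unfolding P1(3) by (simp add: real_sqrt_mult)
    then show "sqrt (LBINT y. (P1 y)\<^sup>2) \<le> sqrt \<epsilon> * (C / \<epsilon>)"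
      using mult_left_mono[OF bound, of "sqrt \<epsilon>"] \<epsilon> by simp
    show "0 \<le> sqrt (\<epsilon> * (H * measure lborel \<omega>))"
      using \<epsilon> h_pos[of 0] h_bounds(3)[of 0] by (simp add: mult_nonneg_nonneg)
  qed simp
  also have "\<dots> = sqrt (H * measure lborel \<omega>) * C"
  proof -
    have "sqrt (\<epsilon> * (H * measure lborel \<omega>)) * (sqrt \<epsilon> * (C / \<epsilon>)) = (sqrt \<epsilon> * sqrt \<epsilon>) * (sqrt (H * measure lborel \<omega>) * (C / \<epsilon>))"
      by (simp add: real_sqrt_mult mult_ac)
    also have "sqrt \<epsilon> * sqrt \<epsilon> = \<epsilon>" using \<epsilon> by simp
    finally show ?thesis using \<epsilon> by simp
  qed
  finally have "\<epsilon> * \<bar>\<epsilon> * (LBINT x. P0 x * h ((1 / \<epsilon> powr ell) *\<^sub>R x))\<bar> \<le> \<epsilon> * (sqrt (H * measure lborel \<omega>) * C)"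
    using \<epsilon> by (intro mult_left_mono) auto
  moreover have "(LBINT x. (\<epsilon>\<^sup>2 * P0 x) * h ((1 / \<epsilon> powr ell) *\<^sub>R x)) = \<epsilon> * (\<epsilon> * (LBINT x. P0 x * h ((1 / \<epsilon> powr ell) *\<^sub>R x)))"
    by (simp add: mult.assoc power2_eq_square)
  ultimately show ?thesis using \<epsilon> by (simp add: abs_mult)
qed

text \<open>The second conclusion restates the hypothesis for representatives on the whole plane, where the
  unfolding is isometric.\<close>

lemma unfold0_strong_convergence:
  assumes F: "\<And>n. borel_rep \<omega> (f n) (F n)" and fL: "\<And>n. f n \<in> L2 \<omega>" and G: "borel_rep \<omega> g G" "g \<in> L2 \<omega>"
    and lim: "(\<lambda>n. L2_dist_sq \<omega> (\<lambda>x. a n * f n x) g) \<longlonglongrightarrow> 0"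
    and e: "\<And>n. 0 < e n" "e \<longlonglongrightarrow> 0"
  shows "strongly_tendsto (L2 (\<omega> \<times> Zcell')) (L2norm (\<omega> \<times> Zcell'))
    (\<lambda>n y. a n * unfold0 \<omega> ell (e n) (f n) y) (\<lambda>(x', z'). g x')"
    and "(\<lambda>n. \<integral>\<^sup>+x. ennreal ((a n * F n x - G x)\<^sup>2) \<partial>lborel) \<longlonglongrightarrow> 0"
proof -
  let ?\<chi> = "\<lambda>p :: (real^2) \<times> (real^2). indicator (\<omega> \<times> Zcell') p :: real"
  let ?T = "\<lambda>n p. umap0 (e n powr ell) p"
  have Fb [measurable]: "F n \<in> borel_measurable borel" for n using F(1)[of n] by (simp add: borel_rep_def)
  have Gb [measurable]: "G \<in> borel_measurable borel" using G(1) by (simp add: borel_rep_def)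
  have F2: "integrable lborel (\<lambda>x. (F n x)\<^sup>2)" for n using borel_rep_L2_iff[OF _ F] fL by simp
  have G2: "integrable lborel (\<lambda>x. (G x)\<^sup>2)" using borel_rep_L2_iff[OF _ G(1)] G(2) by simp
  have d: "\<And>n. 0 < e n powr ell" "(\<lambda>n. e n powr ell) \<longlonglongrightarrow> 0"
  proof -
    show "0 < e n powr ell" for n using e(1)[of n] by simp
    show "(\<lambda>n. e n powr ell) \<longlonglongrightarrow> 0"
      using e ell by (intro tendsto_zero_powrI[OF e(2) tendsto_const]) (auto simp: less_imp_le)
  qed
  have dif: "integrable lborel (\<lambda>x. (a n * F n x - G x)\<^sup>2)" for n
    using square_integrable_lin[of "F n" lborel G "a n" "-1"] F2 G2 by simp
  have rep: "borel_rep \<omega> (\<lambda>x. a n * f n x - g x) (\<lambda>x. a n * F n x - G x)" for n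
    using borel_rep_lin[OF F[of n] G(1), of "a n" "-1"] by simp
  have "L2_dist_sq \<omega> (\<lambda>x. a n * f n x) g = (LBINT x. (a n * F n x - G x)\<^sup>2)" for n
    using borel_rep_L2ip[OF _ rep rep, of n] by (simp add: power2_eq_square)
  then have "(\<lambda>n. ennreal (LBINT x. (a n * F n x - G x)\<^sup>2)) \<longlonglongrightarrow> ennreal 0"
    using lim by (intro tendsto_ennrealI) simp
  then show nn: "(\<lambda>n. \<integral>\<^sup>+x. ennreal ((a n * F n x - G x)\<^sup>2) \<partial>lborel) \<longlonglongrightarrow> 0"
    using dif by (simp add: nn_integral_eq_integral)
  have conv: "(\<lambda>n. \<integral>\<^sup>+p. ennreal (indicator Zcell' (snd p) * (a n * F n (?T n p) - G (fst p))\<^sup>2) \<partial>lborel) \<longlonglongrightarrow> 0"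
    by (rule unfold_strong_convergence[where F="\<lambda>n x. a n * F n x", OF _ Gb G2 nn d]) measurable
  have repu: "borel_rep (\<omega> \<times> Zcell') (\<lambda>y. a n * unfold0 \<omega> ell (e n) (f n) y) (\<lambda>p. a n * (?\<chi> p * F n (?T n p)))" for n
    by (rule borel_rep_cmult[OF unfold0_rep[OF e(1) F]])
  have repg: "borel_rep (\<omega> \<times> Zcell') (\<lambda>(x', z'). g x') (\<lambda>p. ?\<chi> p * G (fst p))"
    unfolding borel_rep_def
  proof (intro conjI)
    have "AE y in (lborel :: ((real^2) \<times> (real^2)) measure). fst y \<in> \<omega> \<longrightarrow> g (fst y) = G (fst y)"
      using G(1) by (intro AE_lborel_fst) (simp add: borel_rep_def)
    then show "AE y in lborel. y \<in> \<omega> \<times> Zcell' \<longrightarrow> (case y of (x', z') \<Rightarrow> g x') = ?\<chi> y * G (fst y)"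
      by eventually_elim auto
  qed auto
  have unf_L2: "(\<lambda>y. a n * unfold0 \<omega> ell (e n) (f n) y) \<in> L2 (\<omega> \<times> Zcell')" for n
  proof -
    have "(\<integral>\<^sup>+p. ennreal ((a n * (?\<chi> p * F n (?T n p)))\<^sup>2) \<partial>lborel)
      \<le> (\<integral>\<^sup>+p. indicator Zcell' (snd p) * ennreal ((a n * F n (?T n p))\<^sup>2) \<partial>lborel)"
      by (intro nn_integral_mono) (auto simp: indicator_def)
    also have "\<dots> = (\<integral>\<^sup>+x. ennreal ((a n * F n x)\<^sup>2) \<partial>lborel)"
      using nn_integral_unfold0[of "\<lambda>x. ennreal ((a n * F n x)\<^sup>2)", OF _ d(1)] by simp
    also have "\<dots> < \<infinity>" using F2[of n] by (subst nn_integral_eq_integral) (auto simp: power_mult_distrib)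
    finally have "integrable lborel (\<lambda>p. (a n * (?\<chi> p * F n (?T n p)))\<^sup>2)" by (intro integrableI_bounded) auto
    then show ?thesis using borel_rep_L2_iff[OF _ repu] by simp
  qed
  have g_L2: "(\<lambda>(x', z'). g x') \<in> L2 (\<omega> \<times> Zcell')"
  proof -
    have "(\<integral>\<^sup>+p. ennreal ((?\<chi> p * G (fst p))\<^sup>2) \<partial>lborel) \<le> (\<integral>\<^sup>+x. \<integral>\<^sup>+z. ennreal ((G x)\<^sup>2) * indicator Zcell' z \<partial>lborel \<partial>lborel)"
      by (subst nn_integral_lborel_pair) (auto intro!: nn_integral_mono simp: indicator_def)
    also have "\<dots> = (\<integral>\<^sup>+x. ennreal ((G x)\<^sup>2) \<partial>lborel)"
      by (simp add: nn_integral_cmult_indicator emeasure_Zcell')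
    also have "\<dots> < \<infinity>" using G2 by (subst nn_integral_eq_integral) auto
    finally have "integrable lborel (\<lambda>p. (?\<chi> p * G (fst p))\<^sup>2)" by (intro integrableI_bounded) auto
    then show ?thesis using borel_rep_L2_iff[OF _ repg] by simp
  qed
  have "(\<lambda>n. L2norm (\<omega> \<times> Zcell') (\<lambda>y. a n * unfold0 \<omega> ell (e n) (f n) y - (case y of (x', z') \<Rightarrow> g x'))) \<longlonglongrightarrow> 0"
  proof -
    let ?D = "\<lambda>n p. a n * (?\<chi> p * F n (?T n p)) - ?\<chi> p * G (fst p)"
    have repd: "borel_rep (\<omega> \<times> Zcell') (\<lambda>y. a n * unfold0 \<omega> ell (e n) (f n) y - (case y of (x', z') \<Rightarrow> g x')) (?D n)" for n
      using borel_rep_lin[OF repu[of n] repg, of 1 "-1"] by simp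
    have norm_eq: "L2norm (\<omega> \<times> Zcell') (\<lambda>y. a n * unfold0 \<omega> ell (e n) (f n) y - (case y of (x', z') \<Rightarrow> g x'))
        = sqrt (enn2real (\<integral>\<^sup>+p. ennreal ((?D n p)\<^sup>2) \<partial>lborel))" for n
      unfolding L2norm_eq borel_rep_L2ip[OF product_measurable(1) repd repd]
      by (subst integral_eq_nn_integral) (auto simp: power2_eq_square)
    have "(\<lambda>n. \<integral>\<^sup>+p. ennreal ((?D n p)\<^sup>2) \<partial>lborel) \<longlonglongrightarrow> 0"
    proof (rule tendsto_sandwich[OF _ _ tendsto_const conv])
      show "\<forall>\<^sub>F n in sequentially. (\<integral>\<^sup>+p. ennreal ((?D n p)\<^sup>2) \<partial>lborel)
        \<le> (\<integral>\<^sup>+p. ennreal (indicator Zcell' (snd p) * (a n * F n (?T n p) - G (fst p))\<^sup>2) \<partial>lborel)"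
        by (intro always_eventually allI nn_integral_mono ennreal_leI) (auto simp: indicator_def)
    qed simp
    then have "(\<lambda>n. sqrt (enn2real (\<integral>\<^sup>+p. ennreal ((?D n p)\<^sup>2) \<partial>lborel))) \<longlonglongrightarrow> sqrt (enn2real 0)"
      by (intro tendsto_real_sqrt tendsto_enn2real) auto
    then show ?thesis unfolding norm_eq by simp
  qed
  then show "strongly_tendsto (L2 (\<omega> \<times> Zcell')) (L2norm (\<omega> \<times> Zcell'))
    (\<lambda>n y. a n * unfold0 \<omega> ell (e n) (f n) y) (\<lambda>(x', z'). g x')"
    using unf_L2 g_L2 by (simp add: strongly_tendsto_def)
qed

text \<open>Only the values on the central cell matter, so a function can be replaced by its periodic extension.\<close>

lemma periodic_representative:
  assumes q: "q \<in> L2 (\<omega> \<times> Zcell h)"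
  obtains q' where "q' \<in> L2_vec \<omega> (Zcell h) (L2_per h)" "\<And>y. y \<in> \<omega> \<times> Zcell h \<Longrightarrow> q' y = q y"
proof -
  define q' where "q' y = q (fst y, (fst (snd y) - cell_floor (fst (snd y)), snd (snd y)))" for y
  have cell: "cell_floor z = 0" if "z \<in> Zcell'" for z
  proof -
    have "\<lfloor>z $ i + 1 / 2\<rfloor> = 0" for i using that by (intro floor_unique) (auto simp: Zcell'_def dest: spec[of _ i])
    then show ?thesis by (simp add: cell_floor_def vec_eq_iff)
  qed
  have eq: "q' y = q y" if "y \<in> \<omega> \<times> Zcell h" for y
    using that by (cases y) (auto simp: q'_def Zcell_def cell)
  have shift: "cell_floor (z + lattice_vec k) = cell_floor z + lattice_vec k" for z k
  proof -
    have "\<lfloor>(z $ i + of_int (k $ i)) + 1 / 2\<rfloor> = \<lfloor>z $ i + 1 / 2\<rfloor> + k $ i" for i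
      by linarith
    then show ?thesis by (simp add: cell_floor_def lattice_vec_def vec_eq_iff)
  qed
  have per: "q' (x, (z + lattice_vec k, w)) = q' (x, (z, w))" for x z k w
    by (simp add: q'_def shift)
  obtain Q where "borel_rep (\<omega> \<times> Zcell h) q Q" using borel_rep_exists[OF product_measurable(2)] q by (auto simp: L2_iff)
  then have Q: "borel_rep (\<omega> \<times> Zcell h) q Q" "borel_rep (\<omega> \<times> Zcell h) q' Q"
    using eq by (auto simp: borel_rep_def elim!: eventually_mono)
  have "q' \<in> L2 (\<omega> \<times> Zcell h)"
    using q borel_rep_L2_iff[OF product_measurable(2) Q(1)] borel_rep_L2_iff[OF product_measurable(2) Q(2)] by simp
  then have "q' \<in> L2_vec \<omega> (Zcell h) (L2 (Zcell h))"
    using L2_vec_eq[OF omega_measurable domain_measurable(3)] by simp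
  then have "q' \<in> L2_vec \<omega> (Zcell h) (L2_per h)"
    using per unfolding L2_vec_def L2_per_def by (auto elim!: eventually_mono)
  with that eq show thesis by blast
qed

end

section \<open>Compactness in H1 and the limit of the pressure\<close>

lemma weakly_tendsto_subseq:
  "weakly_tendsto V N u v \<Longrightarrow> strict_mono r \<Longrightarrow> weakly_tendsto V N (u \<circ> r) v"
  unfolding weakly_tendsto_def by (auto intro: LIMSEQ_subseq_LIMSEQ[unfolded comp_def])

lemma H1ip_scale:
  assumes "open S" "u \<in> H1 S"
  shows "(\<lambda>x. a * u x) \<in> H1 S" "H1ip S (\<lambda>x. a * u x) (\<lambda>x. a * u x) = a\<^sup>2 * H1ip S u u"
proof -
  interpret semi_hilbert "H1 S" "H1ip S" by (rule semi_hilbert_H1[OF assms(1)])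
  show "(\<lambda>x. a * u x) \<in> H1 S" using lin[OF assms(2,2), of a 0] by simp
  show "H1ip S (\<lambda>x. a * u x) (\<lambda>x. a * u x) = a\<^sup>2 * H1ip S u u" using ip_comb_self[OF assms(2,2), of a 0] by simp
qed

text \<open>Pairings in \<open>L\<^sup>2\<close> are bounded functionals on \<open>H\<^sup>1\<close>, so the weak convergence obtained from the Hilbert
  space structure is the hypothesis of the Rellich theorem.\<close>

theorem H1_compact:
  fixes S :: "'a::euclidean_space set" and v :: "nat \<Rightarrow> 'a \<Rightarrow> real"
  assumes S: "open S" "bounded S" "lipschitz_boundary S"
    and v: "\<And>n. v n \<in> H1 S" and bound: "\<And>n. H1norm S (v n) \<le> C"
  obtains l and r :: "nat \<Rightarrow> nat" where "l \<in> H1 S" "strict_mono r"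
    "weakly_tendsto (H1 S) (H1norm S) (v \<circ> r) l"
    "(\<lambda>n. L2_dist_sq S (v (r n)) l) \<longlonglongrightarrow> 0"
proof -
  interpret H1: semi_hilbert "H1 S" "H1ip S" by (rule semi_hilbert_H1[OF S(1)])
  interpret L2: semi_hilbert "L2 S" "L2ip S" by (rule semi_hilbert_L2)
  have N: "H1norm S = (\<lambda>u. sqrt (H1ip S u u))" by (rule ext) (rule H1norm_eq)
  obtain l r where l: "l \<in> H1 S" and r: "strict_mono r" and w: "weakly_tendsto (H1 S) (H1norm S) (v \<circ> r) l"
    unfolding N using H1.weakly_compact[of v C] v bound unfolding N by blast
  have L2_le: "L2ip S u u \<le> H1ip S u u" for u :: "'a \<Rightarrow> real"
    by (simp add: H1ip_def sum_nonneg L2ip_self_ge0)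
  have "(\<lambda>n. L2_dist_sq S (v (r n)) l) \<longlonglongrightarrow> 0"
  proof (rule rellich[OF S])
    show "(\<lambda>x. v (r n) x - l x) \<in> H1 S" for n using H1.diff_in[OF v l] .
    show "H1_dist_sq S (v (r n)) l \<le> 2 * C\<^sup>2 + 2 * H1ip S l l" for n
    proof -
      have "(sqrt (H1ip S (v (r n)) (v (r n))))\<^sup>2 \<le> C\<^sup>2"
        using bound[of "r n"] H1.ip_ge0[OF v] unfolding N by (intro power_mono) auto
      then show ?thesis using H1.norm_sq_add_le[OF v[of "r n"] l, of 1 "-1"] H1.ip_ge0[OF v[of "r n"]] by simp
    qed
    show "(\<lambda>n. L2ip S (\<lambda>x. v (r n) x - l x) w) \<longlonglongrightarrow> 0" if wL: "w \<in> L2 S" for w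
    proof -
      have "bounded_functional (H1 S) (H1norm S) (\<lambda>u. L2ip S u w)"
        unfolding bounded_functional_def
      proof (intro conjI exI[of _ "sqrt (L2ip S w w)"] ballI allI)
        show "L2ip S (\<lambda>x. a * u x + b * v x) w = a * L2ip S u w + b * L2ip S v w"
          if "u \<in> H1 S" "v \<in> H1 S" for u v a b
          using that by (intro L2.ip_lin wL) (auto dest: H1_imp_L2)
        show "\<bar>L2ip S u w\<bar> \<le> sqrt (L2ip S w w) * H1norm S u" if "u \<in> H1 S" for u
        proof -
          have "\<bar>L2ip S u w\<bar> \<le> sqrt (L2ip S u u) * sqrt (L2ip S w w)"
            by (rule L2.Cauchy_Schwarz[OF H1_imp_L2[OF that] wL])
          also have "\<dots> \<le> H1norm S u * sqrt (L2ip S w w)"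
            unfolding N using L2_le by (intro mult_right_mono) (auto simp: L2ip_self_ge0)
          finally show ?thesis by (simp add: mult.commute)
        qed
      qed
      then have "(\<lambda>n. L2ip S ((v \<circ> r) n) w) \<longlonglongrightarrow> L2ip S l w"
        using w unfolding weakly_tendsto_def by blast
      then have "(\<lambda>n. L2ip S (v (r n)) w - L2ip S l w) \<longlonglongrightarrow> 0" by (simp add: LIM_zero)
      then show ?thesis using L2.ip_diff_left[OF H1_imp_L2[OF v] H1_imp_L2[OF l] wL] by simp
    qed
  qed
  with that l r w show thesis by blast
qed

theorem lemma4p3:
  fixes \<omega> :: "(real^2) set" and h :: "real^2 \<Rightarrow> real" and f' :: "real^2 \<Rightarrow> real^2"
    and \<mu> \<mu>eff K ell \<epsilon>0 C :: real
    and u :: "real \<Rightarrow> R3 \<Rightarrow> R3" and p :: "real \<Rightarrow> R3 \<Rightarrow> real"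
    and p0 :: "real \<Rightarrow> real^2 \<Rightarrow> real" and p1 :: "real \<Rightarrow> R3 \<Rightarrow> real"
    and e :: "nat \<Rightarrow> real"
  assumes omega: "open \<omega>" "connected \<omega>" "bounded \<omega>" "lipschitz_boundary \<omega>"
    and h: "Z'_periodic h" "h \<in> W1inf UNIV" "continuous_on UNIV h"
    and h_min: "\<exists>z0. 0 < h z0 \<and> (\<forall>z. h z0 \<le> h z)"
    and h_max: "\<exists>z1. \<forall>z. h z \<le> h z1"
    and constants: "0 < \<mu>" "0 < \<mu>eff" "0 < K"
    and f': "f' \<in> L2 \<omega>"
    and ell: "0 < ell" "ell \<le> 1"
    and eps0: "0 < \<epsilon>0"
    and solution: "\<And>\<epsilon>. 0 < \<epsilon> \<Longrightarrow> \<epsilon> < \<epsilon>0 \<Longrightarrow>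
          weak_solution \<mu> \<mu>eff K f' (thin_domain \<omega> h ell \<epsilon>) \<epsilon> (u \<epsilon>) (p \<epsilon>)"
    and decomposition: "\<And>\<epsilon>. 0 < \<epsilon> \<Longrightarrow> \<epsilon> < \<epsilon>0 \<Longrightarrow>
          AE x in lebesgue_on (thin_domain \<omega> h ell \<epsilon>). p \<epsilon> x = p0 \<epsilon> (fst x) + p1 \<epsilon> x"
    and p0: "\<And>\<epsilon>. 0 < \<epsilon> \<Longrightarrow> \<epsilon> < \<epsilon>0 \<Longrightarrow> p0 \<epsilon> \<in> H1 \<omega>"
    and p1: "\<And>\<epsilon>. 0 < \<epsilon> \<Longrightarrow> \<epsilon> < \<epsilon>0 \<Longrightarrow> p1 \<epsilon> \<in> L2 (thin_domain \<omega> h ell \<epsilon>)"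
    and p0_bound: "\<And>\<epsilon>. 0 < \<epsilon> \<Longrightarrow> \<epsilon> < \<epsilon>0 \<Longrightarrow> H1norm \<omega> (p0 \<epsilon>) \<le> C / \<epsilon>\<^sup>2"
    and p1_bound: "\<And>\<epsilon>. 0 < \<epsilon> \<Longrightarrow> \<epsilon> < \<epsilon>0 \<Longrightarrow>
          L2norm (rescaled_domain \<omega> h ell \<epsilon>) (rescale \<epsilon> (p1 \<epsilon>)) \<le> C / \<epsilon>"
    and e: "\<And>n. 0 < e n" "\<And>n. e n < \<epsilon>0" "e \<longlonglongrightarrow> 0"
  shows "\<exists>p_lim \<in> L2_0 \<omega> \<inter> H1 \<omega>. \<exists>q_lim \<in> L2_vec \<omega> (Zcell h) (L2_per h).
    \<exists>r :: nat \<Rightarrow> nat. strict_mono r \<and>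
      weakly_tendsto (H1 \<omega>) (H1norm \<omega>)
        (\<lambda>n x'. (e (r n))\<^sup>2 * p0 (e (r n)) x') p_lim \<and>
      strongly_tendsto (L2 \<omega>) (L2norm \<omega>)
        (\<lambda>n x'. (e (r n))\<^sup>2 * p0 (e (r n)) x') p_lim \<and>
      strongly_tendsto (L2 (\<omega> \<times> Zcell')) (L2norm (\<omega> \<times> Zcell'))
        (\<lambda>n y. (e (r n))\<^sup>2 * unfold0 \<omega> ell (e (r n)) (p0 (e (r n))) y) (\<lambda>(x', z'). p_lim x') \<and>
      weakly_tendsto (L2_vec \<omega> (Zcell h) (L2 (Zcell h))) (L2_vec_norm \<omega> (Zcell h))
        (\<lambda>n y. e (r n) * unfold1 \<omega> ell (e (r n)) (rescale (e (r n)) (p1 (e (r n)))) y) q_lim"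
proof -
  obtain z0 where z0: "0 < h z0" "\<And>z. h z0 \<le> h z" using h_min by blast
  obtain z1 where z1: "\<And>z. h z \<le> h z1" using h_max by blast
  interpret geo: thin_geometry \<omega> h ell "h z1" "h z0"
    by unfold_locales (use omega h z0 z1 ell in auto)
  note e_pos = e(1) and e_less = e(2)
  \<comment> \<open>The factor \<open>(e n)\<^sup>2\<close> cancels the growth of the bound on \<open>p0\<close>.\<close>
  define v where "v n x = (e n)\<^sup>2 * p0 (e n) x" for n x
  have vH: "v n \<in> H1 \<omega>" and v_norm: "H1norm \<omega> (v n) \<le> C" for n
  proof -
    note P = p0[OF e_pos[of n] e_less[of n]] and bd = p0_bound[OF e_pos[of n] e_less[of n]]
    show "v n \<in> H1 \<omega>" using H1ip_scale(1)[OF omega(1) P] by (simp add: v_def[abs_def])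
    have "H1norm \<omega> (v n) = sqrt (((e n)\<^sup>2)\<^sup>2 * H1ip \<omega> (p0 (e n)) (p0 (e n)))"
      unfolding v_def[abs_def] H1norm_eq H1ip_scale(2)[OF omega(1) P] ..
    also have "\<dots> = (e n)\<^sup>2 * H1norm \<omega> (p0 (e n))"
      by (simp only: H1norm_eq real_sqrt_mult real_sqrt_abs abs_power2)
    also have "\<dots> \<le> (e n)\<^sup>2 * (C / (e n)\<^sup>2)" using bd by (intro mult_left_mono) auto
    also have "\<dots> = C" using e_pos[of n] by simp
    finally show "H1norm \<omega> (v n) \<le> C" .
  qed
  obtain l r1 where l: "l \<in> H1 \<omega>" and r1: "strict_mono r1"
    and v_weak: "weakly_tendsto (H1 \<omega>) (H1norm \<omega>) (v \<circ> r1) l"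
    and v_strong: "(\<lambda>n. L2_dist_sq \<omega> (v (r1 n)) l) \<longlonglongrightarrow> 0"
    by (rule H1_compact[OF omega(1,3,4) vH v_norm]) (rule that)
  \<comment> \<open>Likewise \<open>e n\<close> for \<open>p1\<close>; the second subsequence is taken from the first.\<close>
  define g where "g n y = e n * unfold1 \<omega> ell (e n) (rescale (e n) (p1 (e n))) y" for n y
  interpret LZ: semi_hilbert "L2 (\<omega> \<times> Zcell h)" "L2ip (\<omega> \<times> Zcell h)" by (rule semi_hilbert_L2)
  have C0: "0 \<le> C"
  proof -
    have "0 \<le> H1norm \<omega> (v 0)" by (simp add: H1norm_def sum_nonneg)
    then show ?thesis using v_norm[of 0] by linarith
  qed
  have gL: "g n \<in> L2 (\<omega> \<times> Zcell h)" and g_norm: "sqrt (L2ip (\<omega> \<times> Zcell h) (g n) (g n)) \<le> C" for n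
  proof -
    note P = p1[OF e_pos[of n] e_less[of n]] and bd = p1_bound[OF e_pos[of n] e_less[of n]]
    note unf = geo.unfold1_norm_bound[OF e_pos[of n] P]
    show "g n \<in> L2 (\<omega> \<times> Zcell h)" using LZ.lin[OF unf(1) unf(1), of "e n" 0] by (simp add: g_def[abs_def])
    have "L2ip (\<omega> \<times> Zcell h) (g n) (g n) = (e n)\<^sup>2 * L2ip (\<omega> \<times> Zcell h)
       (unfold1 \<omega> ell (e n) (rescale (e n) (p1 (e n)))) (unfold1 \<omega> ell (e n) (rescale (e n) (p1 (e n))))"
      using LZ.ip_comb_self[OF unf(1) unf(1), of "e n" 0] by (simp add: g_def[abs_def])
    also have "\<dots> \<le> (e n)\<^sup>2 * (C / e n)\<^sup>2"
    proof (intro mult_left_mono order_trans[OF unf(2)] power_mono bd)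
      show "0 \<le> L2norm (rescaled_domain \<omega> h ell (e n)) (rescale (e n) (p1 (e n)))"
        by (simp add: L2norm_eq L2ip_self_ge0)
    qed simp
    also have "\<dots> = C\<^sup>2" using e_pos[of n] by (simp add: power_divide)
    finally show "sqrt (L2ip (\<omega> \<times> Zcell h) (g n) (g n)) \<le> C" using C0 by (intro real_le_lsqrt) auto
  qed
  obtain q r2 where q: "q \<in> L2 (\<omega> \<times> Zcell h)" and r2: "strict_mono r2"
    and g_weak: "weakly_tendsto (L2 (\<omega> \<times> Zcell h)) (\<lambda>u. sqrt (L2ip (\<omega> \<times> Zcell h) u u)) ((g \<circ> r1) \<circ> r2) q"
    using LZ.weakly_compact[of "g \<circ> r1" C] gL g_norm by auto
  obtain q' where q': "q' \<in> L2_vec \<omega> (Zcell h) (L2_per h)" and qq': "\<And>y. y \<in> \<omega> \<times> Zcell h \<Longrightarrow> q' y = q y"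
    by (rule geo.periodic_representative[OF q]) (rule that)
  define r where "r = r1 \<circ> r2"
  have r: "strict_mono r" unfolding r_def using r1 r2 by (rule strict_mono_o)
  define E where "E n = e (r n)" for n
  have E_pos: "0 < E n" and E_less: "E n < \<epsilon>0" for n by (simp_all add: E_def e_pos e_less)
  have E_lim: "E \<longlonglongrightarrow> 0" using LIMSEQ_subseq_LIMSEQ[OF e(3) r] by (simp add: E_def[abs_def] comp_def)
  have vr_lim: "(\<lambda>n. L2_dist_sq \<omega> (\<lambda>x. (E n)\<^sup>2 * p0 (E n) x) l) \<longlonglongrightarrow> 0"
    using LIMSEQ_subseq_LIMSEQ[OF v_strong r2] by (simp add: E_def r_def v_def comp_def)

  have A1: "weakly_tendsto (H1 \<omega>) (H1norm \<omega>) (\<lambda>n x'. (e (r n))\<^sup>2 * p0 (e (r n)) x') l"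
    using weakly_tendsto_subseq[OF v_weak r2] by (simp add: v_def[abs_def] comp_def r_def)
  have A2: "strongly_tendsto (L2 \<omega>) (L2norm \<omega>) (\<lambda>n x'. (e (r n))\<^sup>2 * p0 (e (r n)) x') l"
  proof -
    have "(\<lambda>x'. (e (r n))\<^sup>2 * p0 (e (r n)) x') \<in> L2 \<omega>" for n
      using H1_imp_L2[OF vH[of "r n"]] by (simp add: v_def[abs_def])
    moreover have "(\<lambda>n. L2norm \<omega> (\<lambda>x'. (e (r n))\<^sup>2 * p0 (e (r n)) x' - l x')) \<longlonglongrightarrow> 0"
      using tendsto_real_sqrt[OF vr_lim] by (simp add: L2norm_eq E_def)
    ultimately show ?thesis using H1_imp_L2[OF l] by (simp add: strongly_tendsto_def)
  qed
  have pL: "p0 (E n) \<in> L2 \<omega>" for n using p0[OF E_pos E_less] by (rule H1_imp_L2)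
  have "\<exists>P. borel_rep \<omega> (p0 (E n)) P" for n
    using borel_rep_exists[OF geo.omega_measurable] pL[of n] by (metis L2_iff)
  then obtain P0 where P0: "\<And>n. borel_rep \<omega> (p0 (E n)) (P0 n)" by metis
  obtain G where G: "borel_rep \<omega> l G"
    using borel_rep_exists[OF geo.omega_measurable] H1_imp_L2[OF l] by (metis L2_iff)
  note unf0 = geo.unfold0_strong_convergence[OF P0 pL G H1_imp_L2[OF l] vr_lim E_pos E_lim]
  have A3: "strongly_tendsto (L2 (\<omega> \<times> Zcell')) (L2norm (\<omega> \<times> Zcell'))
        (\<lambda>n y. (e (r n))\<^sup>2 * unfold0 \<omega> ell (e (r n)) (p0 (e (r n))) y) (\<lambda>(x', z'). l x')"
    using unf0(1) by (simp add: E_def)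
  \<comment> \<open>The mean of \<open>l\<close> vanishes since the pressure has mean zero on the thin domains.\<close>
  have mean: "(\<integral>x. l x \<partial>lebesgue_on \<omega>) = 0"
  proof -
    let ?I = "\<lambda>n. LBINT x. ((E n)\<^sup>2 * P0 n x) * h ((1 / E n powr ell) *\<^sub>R x)"
    have d: "0 < E n powr ell" for n using E_pos[of n] by simp
    have d0: "(\<lambda>n. E n powr ell) \<longlonglongrightarrow> 0"
      using E_pos ell(1) by (intro tendsto_zero_powrI[OF E_lim tendsto_const]) (auto simp: less_imp_le)
    have EL: "(\<lambda>x. (E n)\<^sup>2 * p0 (E n) x) \<in> L2 \<omega>" for n
      using H1_imp_L2[OF vH[of "r n"]] by (simp add: v_def[abs_def] E_def)
    have lim: "?I \<longlonglongrightarrow> (LBINT z. indicator Zcell' z * h z) * (LBINT x. G x)"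
      by (rule geo.oscillating_integral_tendsto[OF borel_rep_cmult[OF P0] EL G H1_imp_L2[OF l] unf0(2) d d0])
    have "\<bar>?I n\<bar> \<le> E n * (sqrt (h z1 * measure lborel \<omega>) * C)" for n
      using solution[OF E_pos E_less, of n] decomposition[OF E_pos E_less, of n]
        p1[OF E_pos E_less] p1_bound[OF E_pos E_less]
      by (intro geo.pressure_mean_bound[OF E_pos _ _ pL P0]) (auto simp: weak_solution_def)
    then have "?I \<longlonglongrightarrow> 0"
      by (intro Lim_null_comparison[OF _ tendsto_mult_left_zero[OF E_lim, of "sqrt (h z1 * measure lborel \<omega>) * C"]]) auto
    then have "(LBINT z. indicator Zcell' z * h z) * (LBINT x. G x) = 0"
      using LIMSEQ_unique lim by blast
    then have "(LBINT x. G x) = 0" using geo.cell_mean_pos by simp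
    then show ?thesis using borel_rep_integral_eq[OF geo.omega_measurable G] by simp
  qed
  have A4: "weakly_tendsto (L2_vec \<omega> (Zcell h) (L2 (Zcell h))) (L2_vec_norm \<omega> (Zcell h))
        (\<lambda>n y. e (r n) * unfold1 \<omega> ell (e (r n)) (rescale (e (r n)) (p1 (e (r n)))) y) q'"
  proof -
    let ?V = "L2 (\<omega> \<times> Zcell h)" and ?ip = "L2ip (\<omega> \<times> Zcell h)"
    have V: "L2_vec \<omega> (Zcell h) (L2 (Zcell h)) = ?V"
      by (rule L2_vec_eq) simp_all
    have N: "L2_vec_norm \<omega> (Zcell h) u = sqrt (?ip u u)" if "u \<in> ?V" for u
      using L2_vec_norm_eq[OF geo.omega_measurable geo.domain_measurable(3) that] by (simp add: L2norm_eq)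
    have q'V: "q' \<in> ?V"
      using q' unfolding V[symmetric] by (auto simp: L2_vec_def L2_per_def elim!: eventually_mono)
    \<comment> \<open>\<open>q\<close> and \<open>q'\<close> differ outside of \<open>\<omega> \<times> Zcell h\<close> only, so no bounded functional separates them.\<close>
    have null: "?ip (\<lambda>y. q y - q' y) (\<lambda>y. q y - q' y) = 0"
    proof -
      have "?ip (\<lambda>y. q y - q' y) (\<lambda>y. q y - q' y) = (\<integral>y. 0 \<partial>lebesgue_on (\<omega> \<times> Zcell h))"
        unfolding L2ip_def using qq' by (intro Bochner_Integration.integral_cong) (auto simp: space_restrict_space)
      then show ?thesis by simp
    qed
    have "(\<lambda>n. F (\<lambda>y. g (r n) y)) \<longlonglongrightarrow> F q'" if F: "bounded_functional ?V (L2_vec_norm \<omega> (Zcell h)) F" for F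
    proof -
      have F': "bounded_functional ?V (\<lambda>u. sqrt (?ip u u)) F"
        using F N unfolding bounded_functional_def by simp
      then obtain k where k: "k \<in> ?V" "\<And>u. u \<in> ?V \<Longrightarrow> F u = ?ip u k" by (rule LZ.riesz) blast
      have "F q = F q'" using k q q'V LZ.ip_cong_null[OF q q'V k(1) null] by simp
      moreover have "(\<lambda>n. F (((g \<circ> r1) \<circ> r2) n)) \<longlonglongrightarrow> F q"
        using g_weak F' unfolding weakly_tendsto_def by blast
      ultimately show ?thesis by (simp add: r_def)
    qed
    then have "weakly_tendsto ?V (L2_vec_norm \<omega> (Zcell h)) (\<lambda>n y. g (r n) y) q'"
      using gL q'V by (simp add: weakly_tendsto_def)
    then show ?thesis unfolding V by (simp add: g_def)
  qed
  have "l \<in> L2_0 \<omega> \<inter> H1 \<omega>" using l H1_imp_L2[OF l] mean by (simp add: L2_0_def)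
  with q' r A1 A2 A3 A4 show ?thesis by blast
qed

end
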